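(* Let $\mathcal{S}$ be a symmetric free domain in $\mathbb{M}^2$, and let $\mathcal{G}$ (with topology $\mathcal{T}$), $\mathcal{U}_{\gamma\tau}(\mathcal{S})$ and $\mathfrak{G}_{oo}(\mathcal{S})=\bigcup_{\gamma\in\Gamma}\bigcup_{\tau\in\{-1,1\}^\gamma}\Phi_{\gamma\tau}(\mathcal{U}_{\gamma\tau}(\mathcal{S}))$ be as defined in the context. Then $\mathfrak{G}_{oo}(\mathcal{S})$ is an open subset of $\mathcal{G}$. Furthermore, if $\mathcal{T}(\mathcal{S})$ is the relative topology induced by $\mathcal{T}$ on $\mathfrak{G}_{oo}(\mathcal{S})$ and $\mathcal{A}(\mathcal{S})$ is the collection of restrictions of the maps $\Phi_{\gamma\tau}^{-1}$ to $\Phi_{\gamma\tau}(\mathcal{U}_{\gamma\tau}(\mathcal{S}))$, $\gamma\in\Gamma$, $\tau\in\{-1,1\}^\gamma$, then $(\mathfrak{G}_{oo}(\mathcal{S}),\mathcal{T}(\mathcal{S}),\mathcal{A}(\mathcal{S}))$ is a Zariski-free manifold, that is, a $2$-dimensional topological nc-manifold with respect to the Zariski-free topology on $\mathbb{M}^2$.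
   Context: **Basics.** $\mathbb{M}_n$ is the algebra of $n\times n$ complex matrices, $\mathbb{M}^d=\bigcup_{n\ge1}\mathbb{M}_n^d$ (disjoint union). Direct sums and similarities are taken componentwise. An *nc-set* is a subset of $\mathbb{M}^d$ closed under direct sums. A function $f:D\to\mathbb{M}^1$ is *graded* if $f(x)\in\mathbb{M}_n$ whenever $x\in D\cap\mathbb{M}_n^d$. An *nc-function* is a graded function $f$ on an nc-set $D$ such that $f(x\oplus y)=f(x)\oplus f(y)$, and $f(s^{-1}xs)=s^{-1}f(x)s$ whenever $x\in D\cap\mathbb{M}_n^d$, $s\in\mathbb{M}_n$ is invertible and $s^{-1}xs\in D$. An *nc-mapping* is a map between nc-sets whose components are nc-functions. A set $\mathcal{S}\subseteq\mathbb{M}^2$ is *symmetric* if $(w^1,w^2)\in\mathcal{S}\Rightarrow(w^2,w^1)\in\mathcal{S}$. **Topologies.** The *free topology* on $\mathbb{M}^d$ has as base the sets $B_\delta=\{x:\|[\delta_{ij}(x)]\|<1\}$, $\delta$ a (rectangular) matrix of free polynomials (polynomials over $\mathbb{C}$ in non-commuting variables); freely open sets are free domains. A graded function $f$ on a free domain $D$ is *freely holomorphic* if every $x\in D$ has a freely open neighborhood $U\subseteq D$ that is an nc-set on which $f$ is an nc-function, and a free neighborhood on which $f$ is bounded. A *free variety* in a free domain $D$ is a set $\{x\in D: g(x)=0\ \forall g\in E\}$, $E$ a set of freely holomorphic functions on $D$. The *Zariski-free topology* has as base the sets $D\setminus T$, $D$ a free domain and $T$ a finite union of free varieties in $D$.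 **Topological nc-manifolds.** Let $\tau$ be a topology on $\mathbb{M}^d$ having a basis of nc-sets whose intersection with each $\mathbb{M}_n^d$ is open (the Zariski-free topology is such). A $d$-dimensional topological nc-manifold with respect to $\tau$ is a triple $(X,\mathcal{T},\mathcal{A})$ where $(X,\mathcal{T})$ is a topological space and $\mathcal{A}$ is a collection of homeomorphisms $\alpha:U_\alpha\to D_\alpha$, with $U_\alpha\in\mathcal{T}$ and $D_\alpha\subseteq\mathbb{M}^d$ a $\tau$-open set (hence a union of $\tau$-open nc-sets) with the relative $\tau$-topology, such that $\bigcup_\alpha U_\alpha=X$ and, for all $\alpha,\beta\in\mathcal{A}$, $\alpha(U_\alpha\cap U_\beta)$ is a union of nc-sets and the restriction of $\beta\circ\alpha^{-1}$ to every nc-subset of $\alpha(U_\alpha\cap U_\beta)$ is an nc-mapping. **Constructions.** Let $\Gamma$ be the set of finite subsets of $\mathbb{C}\setminus\{0\}$. For each $\gamma\in\Gamma$ fix $r_\gamma>0$ with $r_\gamma<\min\{\min_{c\in\gamma}|c|,\ \tfrac14\min_{c\ne d\in\gamma}|c-d|\}$, let $\Delta_\gamma=\bigcup_{c\in\gamma}\{z:|z-c|<r_\gamma\}$, and fix a holomorphic branch $s_\gamma$ of $\sqrt z$ on $\Delta_\gamma$. For $\tau\in\{-1,1\}^\gamma$ let $\iota_{\gamma\tau}(z)=\tau(c)$ if $|z-c|<r_\gamma$, $c\in\gamma$. Let $D_\gamma=\{x\in\mathbb{M}^1:\sigma(x)\subseteq\Delta_\gamma\}$ and, via the holomorphic functional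 calculus, $I_{\gamma\tau}(x)=\iota_{\gamma\tau}(x)$ and $S_{\gamma\tau}(x)=s_\gamma(x)\iota_{\gamma\tau}(x)$ for $x\in D_\gamma$. Let $\mathcal{U}_\gamma=\{(u,x)\in\mathbb{M}^2: x\in D_\gamma,\ uI_{\gamma\tau}(x)\ne I_{\gamma\tau}(x)u$ for every nonconstant $\tau\in\{-1,1\}^\gamma\}$. For $(u,x)\in\mathcal{U}_\gamma$ put $\Phi_{\gamma\tau}(u,x)=(u,x,S_{\gamma\tau}(x)\,u\,S_{\gamma\tau}(x))$ and $\omega_{\gamma\tau}(u,x)=(u+S_{\gamma\tau}(x),u-S_{\gamma\tau}(x))$. $\mathcal{G}=\bigcup_{\gamma\in\Gamma}\bigcup_{\tau\in\{-1,1\}^\gamma}\Phi_{\gamma\tau}(\mathcal{U}_\gamma)\subseteq\mathbb{M}^3$, with the topology $\mathcal{T}$ having as base the sets $\Phi_{\gamma\tau}(U)$, $U\subseteq\mathcal{U}_\gamma$ Zariski-freely open. $\mathcal{U}_{\gamma\tau}(\mathcal{S})=\{(u,x)\in\mathcal{U}_\gamma:\omega_{\gamma\tau}(u,x)\in\mathcal{S}\}$. *)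

theory Defs
  imports
    "HOL-Complex_Analysis.Complex_Analysis"
    "HOL-Library.Poly_Mapping"
    "HOL-Library.FuncSet"
    "Jordan_Normal_Form.Gauss_Jordan_Elimination"
    "Jordan_Normal_Form.Spectral_Radius"
begin

section \<open>The nc universe\<close>

text \<open>
  A point of \<open>M\<^sup>d\<close> is a list of \<open>d\<close> complex matrices, all square of one common size \<open>n \<ge> 1\<close>.
  Functions into \<open>M\<^sup>1\<close> are \<open>complex mat\<close>-valued, that is, a list of length one is identified
  with its entry. Functions on subsets of the universe are total HOL functions, of which only the
  values on the relevant set matter.
\<close>

type_synonym ncpoint = "complex mat list"

definition Mn :: "nat \<Rightarrow> nat \<Rightarrow> ncpoint set" where
  "Mn d n = {x. length x = d \<and> (\<forall>a\<in>set x. a \<in> carrier_mat n n)}"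

definition Md :: "nat \<Rightarrow> ncpoint set" where
  "Md d = (\<Union>n\<in>{1..}. Mn d n)"

definition nc_size :: "ncpoint \<Rightarrow> nat" where
  "nc_size x = dim_row (hd x)"

definition dsum_mat :: "complex mat \<Rightarrow> complex mat \<Rightarrow> complex mat" where
  "dsum_mat A B =
     four_block_mat A (0\<^sub>m (dim_row A) (dim_col B)) (0\<^sub>m (dim_row B) (dim_col A)) B"

definition nc_dsum :: "ncpoint \<Rightarrow> ncpoint \<Rightarrow> ncpoint" where
  "nc_dsum x y = map2 dsum_mat x y"

definition mat_inv :: "complex mat \<Rightarrow> complex mat" where
  "mat_inv A = the (mat_inverse A)"

definition nc_conj :: "complex mat \<Rightarrow> ncpoint \<Rightarrow> ncpoint" where
  "nc_conj s x = map (\<lambda>a. mat_inv s * a * s) x"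

definition nc_set :: "nat \<Rightarrow> ncpoint set \<Rightarrow> bool" where
  "nc_set d D \<longleftrightarrow> D \<subseteq> Md d \<and> (\<forall>x\<in>D. \<forall>y\<in>D. nc_dsum x y \<in> D)"

definition graded_on :: "nat \<Rightarrow> ncpoint set \<Rightarrow> (ncpoint \<Rightarrow> complex mat) \<Rightarrow> bool" where
  "graded_on d D f \<longleftrightarrow> (\<forall>n\<ge>1. \<forall>x\<in>D \<inter> Mn d n. f x \<in> carrier_mat n n)"

definition nc_function :: "nat \<Rightarrow> ncpoint set \<Rightarrow> (ncpoint \<Rightarrow> complex mat) \<Rightarrow> bool" where
  "nc_function d D f \<longleftrightarrow>
     nc_set d D \<and> graded_on d D f \<and>
     (\<forall>x\<in>D. \<forall>y\<in>D. f (nc_dsum x y) = dsum_mat (f x) (f y)) \<and>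
     (\<forall>n\<ge>1. \<forall>x\<in>D \<inter> Mn d n. \<forall>s\<in>carrier_mat n n.
        invertible_mat s \<and> nc_conj s x \<in> D \<longrightarrow> f (nc_conj s x) = mat_inv s * f x * s)"

text \<open>
  The image of an nc-set under a map whose components are nc-functions is itself an nc-set, so no
  codomain has to be recorded.
\<close>

definition nc_mapping :: "nat \<Rightarrow> nat \<Rightarrow> ncpoint set \<Rightarrow> (ncpoint \<Rightarrow> ncpoint) \<Rightarrow> bool" where
  "nc_mapping d e D F \<longleftrightarrow>
     nc_set d D \<and> (\<forall>x\<in>D. F x \<in> Md e) \<and> (\<forall>k<e. nc_function d D (\<lambda>x. F x ! k))"

section \<open>Norms\<close>

definition vnorm :: "complex vec \<Rightarrow> real" where
  "vnorm v = L2_set (\<lambda>i. cmod (vec_index v i)) {..<dim_vec v}"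

definition mat_norm :: "complex mat \<Rightarrow> real" where
  "mat_norm A = (SUP v\<in>{v \<in> carrier_vec (dim_col A). vnorm v \<le> 1}. vnorm (A *\<^sub>v v))"

definition euclid_open :: "nat \<Rightarrow> nat \<Rightarrow> ncpoint set \<Rightarrow> bool" where
  "euclid_open d n V \<longleftrightarrow>
     V \<subseteq> Mn d n \<and>
     (\<forall>x\<in>V. \<exists>\<epsilon>>0. \<forall>y\<in>Mn d n. (\<forall>k<d. mat_norm (y ! k - x ! k) < \<epsilon>) \<longrightarrow> y \<in> V)"

section \<open>Free polynomials and the free topology\<close>

text \<open>
  A free polynomial in \<open>d\<close> variables is a finitely supported complex function on words in the
  letters \<open>0, \<dots>, d - 1\<close>.
\<close>

type_synonym free_poly = "nat list \<Rightarrow>\<^sub>0 complex"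

definition free_polys :: "nat \<Rightarrow> free_poly set" where
  "free_polys d = {p. \<forall>w\<in>Poly_Mapping.keys p. set w \<subseteq> {..<d}}"

definition word_at :: "ncpoint \<Rightarrow> nat list \<Rightarrow> complex mat" where
  "word_at x w = foldr (\<lambda>k A. x ! k * A) w (1\<^sub>m (nc_size x))"

definition poly_at :: "free_poly \<Rightarrow> ncpoint \<Rightarrow> complex mat" where
  "poly_at p x = mat (nc_size x) (nc_size x)
     (\<lambda>(i, j). \<Sum>w\<in>Poly_Mapping.keys p. Poly_Mapping.lookup p w * word_at x w $$ (i, j))"

text \<open>The block matrix with blocks \<open>\<delta>\<^sub>i\<^sub>j(x)\<close>.\<close>

definition poly_mat_at :: "free_poly mat \<Rightarrow> ncpoint \<Rightarrow> complex mat" where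
  "poly_mat_at \<delta> x =
     (let n = nc_size x in
      mat (dim_row \<delta> * n) (dim_col \<delta> * n)
        (\<lambda>(i, j). poly_at (\<delta> $$ (i div n, j div n)) x $$ (i mod n, j mod n)))"

definition free_ball :: "nat \<Rightarrow> free_poly mat \<Rightarrow> ncpoint set" where
  "free_ball d \<delta> = {x \<in> Md d. mat_norm (poly_mat_at \<delta> x) < 1}"

definition free_base :: "nat \<Rightarrow> ncpoint set set" where
  "free_base d = {free_ball d \<delta> | \<delta>. \<forall>i<dim_row \<delta>. \<forall>j<dim_col \<delta>. \<delta> $$ (i, j) \<in> free_polys d}"

text \<open>The topology whose open sets are exactly the unions of members of \<open>B\<close>.\<close>

definition topology_with_base :: "'a set set \<Rightarrow> 'a topology" where
  "topology_with_base B = topology (arbitrary union_of (\<lambda>U. U \<in> B))"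

definition free_topology :: "nat \<Rightarrow> ncpoint topology" where
  "free_topology d = topology_with_base (free_base d)"

definition free_domain :: "nat \<Rightarrow> ncpoint set \<Rightarrow> bool" where
  "free_domain d D \<longleftrightarrow> openin (free_topology d) D"

definition freely_holomorphic :: "nat \<Rightarrow> ncpoint set \<Rightarrow> (ncpoint \<Rightarrow> complex mat) \<Rightarrow> bool" where
  "freely_holomorphic d D f \<longleftrightarrow>
     free_domain d D \<and> graded_on d D f \<and>
     (\<forall>x\<in>D.
        (\<exists>U. free_domain d U \<and> x \<in> U \<and> U \<subseteq> D \<and> nc_function d U f) \<and>
        (\<exists>V. free_domain d V \<and> x \<in> V \<and> V \<subseteq> D \<and> (\<exists>C. \<forall>y\<in>V. mat_norm (f y) \<le> C)))"

section \<open>The Zariski-free topology\<close>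

definition free_variety :: "nat \<Rightarrow> ncpoint set \<Rightarrow> ncpoint set \<Rightarrow> bool" where
  "free_variety d D T \<longleftrightarrow>
     (\<exists>E. (\<forall>g\<in>E. freely_holomorphic d D g) \<and>
          T = {x \<in> D. \<forall>g\<in>E. g x = 0\<^sub>m (nc_size x) (nc_size x)})"

definition zariski_free_base :: "nat \<Rightarrow> ncpoint set set" where
  "zariski_free_base d =
     {D - \<Union>\<V> | D \<V>. free_domain d D \<and> finite \<V> \<and> (\<forall>T\<in>\<V>. free_variety d D T)}"

definition zariski_free_topology :: "nat \<Rightarrow> ncpoint topology" where
  "zariski_free_topology d = topology_with_base (zariski_free_base d)"

section \<open>Topological nc-manifolds\<close>

definition nc_admissible :: "nat \<Rightarrow> ncpoint topology \<Rightarrow> bool" where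
  "nc_admissible d \<tau> \<longleftrightarrow>
     topspace \<tau> = Md d \<and>
     (\<exists>B. (\<forall>N\<in>B. openin \<tau> N \<and> nc_set d N \<and> (\<forall>n\<ge>1. euclid_open d n (N \<inter> Mn d n))) \<and>
          (\<forall>W. openin \<tau> W \<longrightarrow> (\<exists>C\<subseteq>B. W = \<Union>C)))"

text \<open>A chart \<open>\<alpha> : U \<rightarrow> D\<close> is the triple \<open>(U, D, \<alpha>)\<close>.\<close>

type_synonym 'a nc_chart = "'a set \<times> ncpoint set \<times> ('a \<Rightarrow> ncpoint)"

definition topological_nc_manifold ::
  "nat \<Rightarrow> ncpoint topology \<Rightarrow> 'a set \<Rightarrow> 'a topology \<Rightarrow> 'a nc_chart set \<Rightarrow> bool" where
  "topological_nc_manifold d \<tau> X \<T> \<A> \<longleftrightarrow>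
     nc_admissible d \<tau> \<and>
     topspace \<T> = X \<and>
     (\<forall>(U, D, \<alpha>)\<in>\<A>. openin \<T> U \<and> openin \<tau> D \<and>
        homeomorphic_map (subtopology \<T> U) (subtopology \<tau> D) \<alpha>) \<and>
     (\<Union>(U, D, \<alpha>)\<in>\<A>. U) = X \<and>
     (\<forall>(U, D, \<alpha>)\<in>\<A>. \<forall>(V, E, \<beta>)\<in>\<A>.
        (\<exists>\<N>. (\<forall>N\<in>\<N>. nc_set d N) \<and> \<alpha> ` (U \<inter> V) = \<Union>\<N>) \<and>
        (\<forall>N. nc_set d N \<and> N \<subseteq> \<alpha> ` (U \<inter> V) \<longrightarrow> nc_mapping d d N (\<beta> \<circ> inv_into U \<alpha>)))"

definition zariski_free_manifold ::
  "nat \<Rightarrow> 'a set \<Rightarrow> 'a topology \<Rightarrow> 'a nc_chart set \<Rightarrow> bool" where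
  "zariski_free_manifold d X \<T> \<A> \<longleftrightarrow>
     topological_nc_manifold d (zariski_free_topology d) X \<T> \<A>"

section \<open>Holomorphic functional calculus\<close>

text \<open>
  The Riesz-Dunford integral \<open>f(x) = (2\<pi>\<i>)\<^sup>-\<^sup>1 \<integral> f(z) (z - x)\<^sup>-\<^sup>1 dz\<close>, taken entrywise over the
  union of sufficiently small positively oriented circles around the points of the spectrum;
  \<^const>\<open>residue\<close> is by definition the normalised integral over such a circle. It makes sense
  whenever \<open>f\<close> is holomorphic in a neighbourhood of the spectrum.
\<close>

definition hol_calc :: "(complex \<Rightarrow> complex) \<Rightarrow> complex mat \<Rightarrow> complex mat" where
  "hol_calc f x = mat (dim_row x) (dim_row x)
     (\<lambda>(i, j). \<Sum>l\<in>spectrum x.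
        residue (\<lambda>z. f z * mat_inv (z \<cdot>\<^sub>m 1\<^sub>m (dim_row x) - x) $$ (i, j)) l)"

section \<open>The space \<open>\<G>\<close>\<close>

definition Gam :: "complex set set" where
  "Gam = {\<gamma>. finite \<gamma> \<and> \<gamma> \<subseteq> - {0}}"

text \<open>
  The fixed choices are a radius function \<open>r\<close> and branches \<open>s\<close>, both indexed by \<open>Gam\<close>. Minima over
  empty sets are read as \<open>\<infinity>\<close>, so that the corresponding bounds are vacuous.
\<close>

definition discs :: "(complex set \<Rightarrow> real) \<Rightarrow> complex set \<Rightarrow> complex set" where
  "discs r \<gamma> = (\<Union>c\<in>\<gamma>. {z. cmod (z - c) < r \<gamma>})"

definition admissible_radii :: "(complex set \<Rightarrow> real) \<Rightarrow> bool" where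
  "admissible_radii r \<longleftrightarrow>
     (\<forall>\<gamma>\<in>Gam. r \<gamma> > 0 \<and> (\<forall>c\<in>\<gamma>. r \<gamma> < cmod c) \<and>
        (\<forall>c\<in>\<gamma>. \<forall>d\<in>\<gamma>. c \<noteq> d \<longrightarrow> r \<gamma> < 1/4 * cmod (c - d)))"

definition sqrt_branches ::
  "(complex set \<Rightarrow> real) \<Rightarrow> (complex set \<Rightarrow> complex \<Rightarrow> complex) \<Rightarrow> bool" where
  "sqrt_branches r s \<longleftrightarrow>
     (\<forall>\<gamma>\<in>Gam. s \<gamma> holomorphic_on discs r \<gamma> \<and> (\<forall>z\<in>discs r \<gamma>. (s \<gamma> z)\<^sup>2 = z))"

definition signs :: "complex set \<Rightarrow> (complex \<Rightarrow> complex) set" where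
  "signs \<gamma> = \<gamma> \<rightarrow>\<^sub>E {- 1, 1}"

definition nonconst_signs :: "complex set \<Rightarrow> (complex \<Rightarrow> complex) set" where
  "nonconst_signs \<gamma> = {\<tau> \<in> signs \<gamma>. \<exists>c\<in>\<gamma>. \<exists>d\<in>\<gamma>. \<tau> c \<noteq> \<tau> d}"

text \<open>For admissible radii the discs around the points of \<open>\<gamma>\<close> are disjoint.\<close>

definition iota ::
  "(complex set \<Rightarrow> real) \<Rightarrow> complex set \<Rightarrow> (complex \<Rightarrow> complex) \<Rightarrow> complex \<Rightarrow> complex" where
  "iota r \<gamma> \<tau> z = \<tau> (THE c. c \<in> \<gamma> \<and> cmod (z - c) < r \<gamma>)"

definition D_set :: "(complex set \<Rightarrow> real) \<Rightarrow> complex set \<Rightarrow> complex mat set" where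
  "D_set r \<gamma> = {x. \<exists>n\<ge>1. x \<in> carrier_mat n n \<and> spectrum x \<subseteq> discs r \<gamma>}"

definition I_fun ::
  "(complex set \<Rightarrow> real) \<Rightarrow> complex set \<Rightarrow> (complex \<Rightarrow> complex) \<Rightarrow> complex mat \<Rightarrow> complex mat" where
  "I_fun r \<gamma> \<tau> x = hol_calc (iota r \<gamma> \<tau>) x"

definition S_fun ::
  "(complex set \<Rightarrow> real) \<Rightarrow> (complex set \<Rightarrow> complex \<Rightarrow> complex) \<Rightarrow> complex set \<Rightarrow>
   (complex \<Rightarrow> complex) \<Rightarrow> complex mat \<Rightarrow> complex mat" where
  "S_fun r s \<gamma> \<tau> x = hol_calc (s \<gamma>) x * hol_calc (iota r \<gamma> \<tau>) x"

definition U_set :: "(complex set \<Rightarrow> real) \<Rightarrow> complex set \<Rightarrow> ncpoint set" where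
  "U_set r \<gamma> = {[u, x] | u x. [u, x] \<in> Md 2 \<and> x \<in> D_set r \<gamma> \<and>
     (\<forall>\<tau>\<in>nonconst_signs \<gamma>. u * I_fun r \<gamma> \<tau> x \<noteq> I_fun r \<gamma> \<tau> x * u)}"

definition Phi ::
  "(complex set \<Rightarrow> real) \<Rightarrow> (complex set \<Rightarrow> complex \<Rightarrow> complex) \<Rightarrow> complex set \<Rightarrow>
   (complex \<Rightarrow> complex) \<Rightarrow> ncpoint \<Rightarrow> ncpoint" where
  "Phi r s \<gamma> \<tau> p =
     (let u = p ! 0; x = p ! 1 in [u, x, S_fun r s \<gamma> \<tau> x * u * S_fun r s \<gamma> \<tau> x])"

definition omega ::
  "(complex set \<Rightarrow> real) \<Rightarrow> (complex set \<Rightarrow> complex \<Rightarrow> complex) \<Rightarrow> complex set \<Rightarrow>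
   (complex \<Rightarrow> complex) \<Rightarrow> ncpoint \<Rightarrow> ncpoint" where
  "omega r s \<gamma> \<tau> p =
     (let u = p ! 0; x = p ! 1 in [u + S_fun r s \<gamma> \<tau> x, u - S_fun r s \<gamma> \<tau> x])"

definition G_set ::
  "(complex set \<Rightarrow> real) \<Rightarrow> (complex set \<Rightarrow> complex \<Rightarrow> complex) \<Rightarrow> ncpoint set" where
  "G_set r s = (\<Union>\<gamma>\<in>Gam. \<Union>\<tau>\<in>signs \<gamma>. Phi r s \<gamma> \<tau> ` U_set r \<gamma>)"

definition G_base ::
  "(complex set \<Rightarrow> real) \<Rightarrow> (complex set \<Rightarrow> complex \<Rightarrow> complex) \<Rightarrow> ncpoint set set" where
  "G_base r s =
     {Phi r s \<gamma> \<tau> ` U | \<gamma> \<tau> U. \<gamma> \<in> Gam \<and> \<tau> \<in> signs \<gamma> \<and> U \<subseteq> U_set r \<gamma> \<and>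
        openin (zariski_free_topology 2) U}"

definition G_topology ::
  "(complex set \<Rightarrow> real) \<Rightarrow> (complex set \<Rightarrow> complex \<Rightarrow> complex) \<Rightarrow> ncpoint topology" where
  "G_topology r s = topology_with_base (G_base r s)"

section \<open>The part of \<open>\<G>\<close> over a symmetric free domain\<close>

definition nc_symmetric :: "ncpoint set \<Rightarrow> bool" where
  "nc_symmetric S \<longleftrightarrow> (\<forall>w1 w2. [w1, w2] \<in> S \<longrightarrow> [w2, w1] \<in> S)"

definition U_dom ::
  "(complex set \<Rightarrow> real) \<Rightarrow> (complex set \<Rightarrow> complex \<Rightarrow> complex) \<Rightarrow> ncpoint set \<Rightarrow> complex set \<Rightarrow>
   (complex \<Rightarrow> complex) \<Rightarrow> ncpoint set" where
  "U_dom r s S \<gamma> \<tau> = {p \<in> U_set r \<gamma>. omega r s \<gamma> \<tau> p \<in> S}"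

definition G_oo ::
  "(complex set \<Rightarrow> real) \<Rightarrow> (complex set \<Rightarrow> complex \<Rightarrow> complex) \<Rightarrow> ncpoint set \<Rightarrow> ncpoint set" where
  "G_oo r s S = (\<Union>\<gamma>\<in>Gam. \<Union>\<tau>\<in>signs \<gamma>. Phi r s \<gamma> \<tau> ` U_dom r s S \<gamma> \<tau>)"

definition G_oo_topology ::
  "(complex set \<Rightarrow> real) \<Rightarrow> (complex set \<Rightarrow> complex \<Rightarrow> complex) \<Rightarrow> ncpoint set \<Rightarrow>
   ncpoint topology" where
  "G_oo_topology r s S = subtopology (G_topology r s) (G_oo r s S)"

definition G_oo_atlas ::
  "(complex set \<Rightarrow> real) \<Rightarrow> (complex set \<Rightarrow> complex \<Rightarrow> complex) \<Rightarrow> ncpoint set \<Rightarrow>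
   ncpoint nc_chart set" where
  "G_oo_atlas r s S =
     {(Phi r s \<gamma> \<tau> ` U_dom r s S \<gamma> \<tau>, U_dom r s S \<gamma> \<tau>,
       restrict (inv_into (U_set r \<gamma>) (Phi r s \<gamma> \<tau>)) (Phi r s \<gamma> \<tau> ` U_dom r s S \<gamma> \<tau>))
      | \<gamma> \<tau>. \<gamma> \<in> Gam \<and> \<tau> \<in> signs \<gamma>}"

end

theory Submission
  imports Defs
begin

text \<open>
  For \<open>f\<close> holomorphic near \<open>\<sigma>(x)\<close> and a polynomial \<open>p\<close> with \<open>p(x) = 0\<close>, write \<open>f = q + p g\<close> with \<open>q\<close> a
  polynomial; then \<open>f(x) = q(x)\<close>, which reduces the functional calculus to polynomials. For \<open>y\<close> in a
  free neighbourhood of \<open>x\<close>, where \<open>p(y)\<close> is small, \<open>f(y) - q(y) = p(y) g(y)\<close> is small uniformly in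
  the size of \<open>y\<close>, because \<open>g(y)\<close> is a Cauchy integral over small circles around the roots of \<open>p\<close> on
  which the resolvent of \<open>y\<close> is bounded in terms of \<open>p\<close>. Hence \<open>S\<^sub>\<gamma>\<^sub>\<tau>\<close> and \<open>I\<^sub>\<gamma>\<^sub>\<tau>\<close> are local limits of
  polynomials: \<open>U\<^sub>\<gamma>\<close> is Zariski-freely open and \<open>\<omega>\<^sub>\<gamma>\<^sub>\<tau>\<close> is freely continuous.

  Two charts overlap where \<open>F u F = F' u F'\<close> for two square roots \<open>F, F'\<close> of \<open>x\<close> that are functions
  of \<open>x\<close>. Then \<open>F\<^sup>-\<^sup>1 F'\<close> is an involution commuting with \<open>u\<close>. On the discs of the index set with the
  smaller radius it is a locally constant function, that is, some \<open>I\<^sub>\<gamma>\<^sub>\<tau>(x)\<close>, so it is scalar by the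
  definition of \<open>U\<^sub>\<gamma>\<close>. The overlap is therefore the freely open condition that \<open>\<sigma>(x)\<close> lies where the
  two scalar branches agree, or where they are opposite, and the transition maps are the identity.
\<close>

section \<open>Operator norms of complex matrices\<close>

text \<open>A free neighbourhood contains points of every matrix size, so compactness or equivalence
  of norms on a single level \<open>Mn d n\<close> is of no help: each constant may depend on
  polynomials and radii, never on n. For this reason matrix-valued integrals are estimated after
  pairing with two vectors, and every polynomial estimate is proved by operator norms instead of
  entries. The Zariski-free base is a second obstacle. Its members need not be nc-sets, and openness
  on each level is not visible from their definition. They are refined to sets on which finitely
  many bounded nc-functions on one free ball do not vanish: direct sums preserve nonvanishing, and
  bounded nc-functions are continuous on each level. The overlaps rest on two scalar facts. For two
  square roots f, g of the same nonvanishing function, f = g is an open condition, being f + g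
  \<noteq> 0; and F u F is even in F, so that f = g and f = -g both lead to coincidence. The
  comparison of radii enters because a disc can be assigned one sign only if it does not meet two
  discs of the other family.\<close>

lemma vnorm_nonneg [simp]: "0 \<le> vnorm v"
  by (simp add: vnorm_def)

lemma vnorm_zero [simp]: "vnorm (0\<^sub>v n) = 0"
  by (simp add: vnorm_def L2_set_0')

lemma vnorm_eq_0: "v \<in> carrier_vec n \<Longrightarrow> vnorm v = 0 \<longleftrightarrow> v = 0\<^sub>v n"
  by (auto simp: vnorm_def L2_set_eq_0_iff intro!: eq_vecI)

lemma vnorm_smult: "vnorm (c \<cdot>\<^sub>v v) = cmod c * vnorm v"
  by (simp add: vnorm_def L2_set_right_distrib norm_mult cong: L2_set_cong_simp)

lemma vnorm_index_le: "i < dim_vec v \<Longrightarrow> cmod (vec_index v i) \<le> vnorm v"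
  unfolding vnorm_def by (rule member_le_L2_set) auto

lemma vnorm_add_le:
  assumes "v \<in> carrier_vec n" "w \<in> carrier_vec n"
  shows "vnorm (v + w) \<le> vnorm v + vnorm w"
proof -
  have "vnorm (v + w) \<le> L2_set (\<lambda>i. cmod (vec_index v i) + cmod (vec_index w i)) {..<n}"
    using assms unfolding vnorm_def by (auto intro!: L2_set_mono norm_triangle_ineq)
  also have "\<dots> \<le> vnorm v + vnorm w"
    using assms unfolding vnorm_def by (auto intro!: L2_set_triangle_ineq)
  finally show ?thesis .
qed

lemma mat_vec_index:
  "v \<in> carrier_vec (dim_col A) \<Longrightarrow> i < dim_row A \<Longrightarrow>
    vec_index (A *\<^sub>v v) i = (\<Sum>j<dim_col A. A $$ (i, j) * vec_index v j)"
  by (auto simp: scalar_prod_def atLeast0LessThan intro!: sum.cong)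

lemma zero_mat_mult_vec: "v \<in> carrier_vec n \<Longrightarrow> 0\<^sub>m m n *\<^sub>v (v :: complex vec) = 0\<^sub>v m"
  by (intro eq_vecI) (auto simp: mat_vec_index simp del: index_mult_mat_vec)

lemma mat_mult_zero_vec: "A \<in> carrier_mat m n \<Longrightarrow> A *\<^sub>v (0\<^sub>v n :: complex vec) = 0\<^sub>v m"
  by (intro eq_vecI) (auto simp: mat_vec_index simp del: index_mult_mat_vec)

text \<open>A supremum of reals is informative only over a bounded set. This crude bound through the
  moduli of the entries depends on the size and serves only to justify the supremum in
  \<open>mat_norm\<close>.\<close>

lemma vnorm_mult_bounded:
  "\<exists>K. \<forall>v\<in>carrier_vec (dim_col A). vnorm (A *\<^sub>v v) \<le> K * vnorm v"
proof (intro exI ballI)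
  fix v :: "complex vec" assume v: "v \<in> carrier_vec (dim_col A)"
  have "vnorm (A *\<^sub>v v) \<le> (\<Sum>i<dim_row A. cmod (vec_index (A *\<^sub>v v) i))"
    unfolding vnorm_def by (rule L2_set_le_sum[THEN order_trans]) auto
  also have "\<dots> \<le> (\<Sum>i<dim_row A. \<Sum>j<dim_col A. cmod (A $$ (i, j)) * vnorm v)"
  proof (rule sum_mono)
    fix i assume "i \<in> {..<dim_row A}"
    then show "cmod (vec_index (A *\<^sub>v v) i) \<le> (\<Sum>j<dim_col A. cmod (A $$ (i, j)) * vnorm v)"
      using v by (auto simp: mat_vec_index norm_mult simp del: index_mult_mat_vec
          intro!: order_trans[OF norm_sum] sum_mono mult_left_mono vnorm_index_le)
  qed
  finally show "vnorm (A *\<^sub>v v) \<le> (\<Sum>i<dim_row A. \<Sum>j<dim_col A. cmod (A $$ (i, j))) * vnorm v"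
    by (simp add: sum_distrib_right)
qed

lemma bdd_above_mat_norm:
  "bdd_above ((\<lambda>v. vnorm (A *\<^sub>v v)) ` {v \<in> carrier_vec (dim_col A). vnorm v \<le> 1})"
proof -
  obtain K where K: "\<forall>v\<in>carrier_vec (dim_col A). vnorm (A *\<^sub>v v) \<le> K * vnorm v"
    using vnorm_mult_bounded by blast
  have "vnorm (A *\<^sub>v v) \<le> \<bar>K\<bar>" if "v \<in> carrier_vec (dim_col A)" "vnorm v \<le> 1" for v
  proof -
    have "vnorm (A *\<^sub>v v) \<le> K * vnorm v" using K that by blast
    also have "\<dots> \<le> \<bar>K\<bar> * 1" using that by (intro mult_mono) auto
    finally show ?thesis by simp
  qed
  then show ?thesis by (auto intro!: bdd_aboveI)
qed

lemma mat_norm_nonneg [simp]: "0 \<le> mat_norm A"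
proof -
  have "vnorm (A *\<^sub>v 0\<^sub>v (dim_col A)) \<le> mat_norm A"
    unfolding mat_norm_def by (rule cSUP_upper[OF _ bdd_above_mat_norm]) auto
  then show ?thesis using vnorm_nonneg order_trans by blast
qed

lemma vnorm_mult_le:
  assumes "v \<in> carrier_vec (dim_col A)"
  shows "vnorm (A *\<^sub>v v) \<le> mat_norm A * vnorm v"
proof (cases "vnorm v = 0")
  case True
  then have "v = 0\<^sub>v (dim_col A)" using vnorm_eq_0[OF assms] by simp
  then have "A *\<^sub>v v = 0\<^sub>v (dim_row A)" by (auto intro!: eq_vecI)
  then show ?thesis using True by simp
next
  case False
  define c where "c = complex_of_real (1 / vnorm v)"
  have "vnorm (c \<cdot>\<^sub>v v) \<le> 1" using False by (simp add: c_def vnorm_smult norm_divide)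
  then have "vnorm (A *\<^sub>v (c \<cdot>\<^sub>v v)) \<le> mat_norm A"
    unfolding mat_norm_def using assms by (intro cSUP_upper[OF _ bdd_above_mat_norm]) auto
  also have "A *\<^sub>v (c \<cdot>\<^sub>v v) = c \<cdot>\<^sub>v (A *\<^sub>v v)" by (rule mult_mat_vec[OF _ assms]) auto
  finally have "vnorm (A *\<^sub>v v) / vnorm v \<le> mat_norm A"
    using False by (simp add: c_def vnorm_smult norm_divide)
  then show ?thesis using False vnorm_nonneg[of v] by (simp add: divide_le_eq)
qed

lemma mat_norm_le:
  assumes "0 \<le> c" "\<And>v. v \<in> carrier_vec (dim_col A) \<Longrightarrow> vnorm (A *\<^sub>v v) \<le> c * vnorm v"
  shows "mat_norm A \<le> c"
  unfolding mat_norm_def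
proof (rule cSUP_least)
  show "{v \<in> carrier_vec (dim_col A). vnorm v \<le> 1} \<noteq> {}"
    by (auto intro!: exI[of _ "0\<^sub>v (dim_col A)"])
  fix v assume "v \<in> {v \<in> carrier_vec (dim_col A). vnorm v \<le> 1}"
  then have v: "v \<in> carrier_vec (dim_col A)" "vnorm v \<le> 1" by auto
  have "vnorm (A *\<^sub>v v) \<le> c * vnorm v" using assms(2) v by blast
  also have "\<dots> \<le> c * 1" using assms(1) v by (intro mult_left_mono) auto
  finally show "vnorm (A *\<^sub>v v) \<le> c" by simp
qed

lemma mat_norm_zero [simp]: "mat_norm (0\<^sub>m m n) = 0"
proof -
  have "mat_norm (0\<^sub>m m n) \<le> 0"
  proof (rule mat_norm_le)
    fix v :: "complex vec" assume "v \<in> carrier_vec (dim_col (0\<^sub>m m n :: complex mat))"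
    then have "0\<^sub>m m n *\<^sub>v v = 0\<^sub>v m" by (auto intro!: eq_vecI)
    then show "vnorm (0\<^sub>m m n *\<^sub>v v) \<le> 0 * vnorm v" by simp
  qed simp
  then show ?thesis using mat_norm_nonneg antisym by blast
qed

lemma mat_norm_one_le: "mat_norm (1\<^sub>m n) \<le> 1"
  by (rule mat_norm_le) auto

lemma mat_norm_add_le:
  assumes "A \<in> carrier_mat m n" "B \<in> carrier_mat m n"
  shows "mat_norm (A + B) \<le> mat_norm A + mat_norm B"
proof (rule mat_norm_le)
  fix v :: "complex vec" assume "v \<in> carrier_vec (dim_col (A + B))"
  then have v: "v \<in> carrier_vec n" using assms by auto
  have "vnorm ((A + B) *\<^sub>v v) = vnorm (A *\<^sub>v v + B *\<^sub>v v)"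
    using add_mult_distrib_mat_vec[OF assms v] by simp
  also have "\<dots> \<le> vnorm (A *\<^sub>v v) + vnorm (B *\<^sub>v v)"
    using assms by (intro vnorm_add_le[of _ m] mult_mat_vec_carrier[of _ m n]) (auto simp: v)
  also have "\<dots> \<le> mat_norm A * vnorm v + mat_norm B * vnorm v"
    using assms v by (intro add_mono vnorm_mult_le) auto
  finally show "vnorm ((A + B) *\<^sub>v v) \<le> (mat_norm A + mat_norm B) * vnorm v"
    by (simp add: algebra_simps)
qed simp

lemma smult_mat_vec:
  fixes A :: "complex mat"
  shows "v \<in> carrier_vec (dim_col A) \<Longrightarrow> (c \<cdot>\<^sub>m A) *\<^sub>v v = c \<cdot>\<^sub>v (A *\<^sub>v v)"
  by (intro eq_vecI) (auto simp: mat_vec_index sum_distrib_left mult.assoc simp del: index_mult_mat_vec)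

lemma mat_norm_smult: "mat_norm (c \<cdot>\<^sub>m A) = cmod c * mat_norm A"
proof -
  have le: "mat_norm (c \<cdot>\<^sub>m A) \<le> cmod c * mat_norm A" for c and A :: "complex mat"
  proof (rule mat_norm_le)
    fix v :: "complex vec" assume "v \<in> carrier_vec (dim_col (c \<cdot>\<^sub>m A))"
    then have v: "v \<in> carrier_vec (dim_col A)" by simp
    then show "vnorm ((c \<cdot>\<^sub>m A) *\<^sub>v v) \<le> cmod c * mat_norm A * vnorm v"
      by (simp add: smult_mat_vec vnorm_smult mult.assoc mult_left_mono vnorm_mult_le)
  qed simp
  show ?thesis
  proof (cases "c = 0")
    case True
    then have "c \<cdot>\<^sub>m A = 0\<^sub>m (dim_row A) (dim_col A)" by (intro eq_matI) auto
    then show ?thesis using True by simp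
  next
    case False
    have "mat_norm A = mat_norm (inverse c \<cdot>\<^sub>m (c \<cdot>\<^sub>m A))"
      using False by (intro arg_cong[of _ _ mat_norm] eq_matI) auto
    also have "\<dots> \<le> cmod (inverse c) * mat_norm (c \<cdot>\<^sub>m A)" by (rule le)
    finally have "cmod c * mat_norm A \<le> cmod c * (inverse (cmod c) * mat_norm (c \<cdot>\<^sub>m A))"
      by (simp add: norm_inverse mult_left_mono)
    then have "cmod c * mat_norm A \<le> mat_norm (c \<cdot>\<^sub>m A)"
      using False by (simp flip: mult.assoc)
    then show ?thesis using le[of c A] by simp
  qed
qed

lemma mat_norm_diff_le:
  assumes "A \<in> carrier_mat m n" "B \<in> carrier_mat m n"
  shows "mat_norm (A - B) \<le> mat_norm A + mat_norm B"
proof -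
  have "A - B = A + (-1) \<cdot>\<^sub>m B" using assms by (intro eq_matI) auto
  then show ?thesis using mat_norm_add_le[of A m n "(-1) \<cdot>\<^sub>m B"] assms by (simp add: mat_norm_smult)
qed

lemma mat_norm_diff_commute:
  assumes "A \<in> carrier_mat m n" "B \<in> carrier_mat m n"
  shows "mat_norm (A - B) = mat_norm (B - A)"
proof -
  have "A - B = (-1) \<cdot>\<^sub>m (B - A)" using assms by (intro eq_matI) auto
  then show ?thesis by (simp add: mat_norm_smult)
qed

lemma mat_norm_triangle_sub:
  assumes "A \<in> carrier_mat m n" "B \<in> carrier_mat m n"
  shows "mat_norm A \<le> mat_norm B + mat_norm (A - B)"
proof -
  have "A = B + (A - B)" using assms by (intro eq_matI) auto
  moreover have "A - B \<in> carrier_mat m n" using assms by auto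
  ultimately show ?thesis using mat_norm_add_le[of B m n "A - B"] assms by metis
qed

lemma mat_norm_mult_le:
  assumes "A \<in> carrier_mat m n" "B \<in> carrier_mat n k"
  shows "mat_norm (A * B) \<le> mat_norm A * mat_norm B"
proof (rule mat_norm_le)
  fix v :: "complex vec" assume "v \<in> carrier_vec (dim_col (A * B))"
  then have v: "v \<in> carrier_vec k" using assms by auto
  have "vnorm ((A * B) *\<^sub>v v) = vnorm (A *\<^sub>v (B *\<^sub>v v))"
    using assoc_mult_mat_vec[OF assms v] by simp
  also have "\<dots> \<le> mat_norm A * vnorm (B *\<^sub>v v)"
    using assms v by (intro vnorm_mult_le) (auto simp: mult_mat_vec_carrier)
  also have "\<dots> \<le> mat_norm A * (mat_norm B * vnorm v)"
    using assms v by (intro mult_left_mono vnorm_mult_le) auto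
  finally show "vnorm ((A * B) *\<^sub>v v) \<le> mat_norm A * mat_norm B * vnorm v"
    by (simp add: mult.assoc)
qed simp

lemma index_mat_norm_le:
  assumes "i < dim_row A" "j < dim_col A"
  shows "cmod (A $$ (i, j)) \<le> mat_norm A"
proof -
  have u: "vnorm (unit_vec (dim_col A) j) = 1"
  proof -
    have "vnorm (unit_vec (dim_col A) j)
        = sqrt (\<Sum>i<dim_col A. if i = j then 1 else 0 :: real)"
      unfolding vnorm_def L2_set_def
      using assms by (intro arg_cong[of _ _ sqrt] sum.cong) (auto simp: unit_vec_def)
    then show ?thesis using assms by (simp add: sum.delta)
  qed
  have "A $$ (i, j) = vec_index (A *\<^sub>v unit_vec (dim_col A) j) i"
    using assms by (simp add: mat_vec_index)
  then have "cmod (A $$ (i, j)) \<le> vnorm (A *\<^sub>v unit_vec (dim_col A) j)"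
    using assms by (simp only: vnorm_index_le dim_mult_mat_vec)
  also have "\<dots> \<le> mat_norm A * 1"
    using vnorm_mult_le[of "unit_vec (dim_col A) j" A] u by simp
  finally show ?thesis by simp
qed

text \<open>Plain sums over functions of the indices replace vectors and square roots, so that index
  sets can later be regrouped into blocks inside the sums.\<close>

lemma mat_norm_le_iff:
  fixes a :: "nat \<Rightarrow> nat \<Rightarrow> complex"
  assumes "0 \<le> c"
  shows "mat_norm (mat m n (\<lambda>(i, j). a i j)) \<le> c \<longleftrightarrow>
    (\<forall>v. (\<Sum>i<m. (cmod (\<Sum>j<n. a i j * v j))\<^sup>2) \<le> c\<^sup>2 * (\<Sum>j<n. (cmod (v j))\<^sup>2))"
    (is "?l \<longleftrightarrow> ?r")
proof -
  let ?A = "mat m n (\<lambda>(i, j). a i j)"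
  have nv: "(vnorm (Matrix.vec n v))\<^sup>2 = (\<Sum>j<n. (cmod (v j))\<^sup>2)" for v
    by (simp add: vnorm_def L2_set_def sum_nonneg)
  have nA: "(vnorm (?A *\<^sub>v Matrix.vec n v))\<^sup>2 = (\<Sum>i<m. (cmod (\<Sum>j<n. a i j * v j))\<^sup>2)" for v
    by (simp add: vnorm_def L2_set_def sum_nonneg mat_vec_index del: index_mult_mat_vec)
  show ?thesis
  proof
    assume l: ?l
    show ?r
    proof
      fix v :: "nat \<Rightarrow> complex"
      have "vnorm (?A *\<^sub>v Matrix.vec n v) \<le> mat_norm ?A * vnorm (Matrix.vec n v)"
        by (rule vnorm_mult_le) auto
      also have "\<dots> \<le> c * vnorm (Matrix.vec n v)" using l by (simp add: mult_right_mono)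
      finally have "(vnorm (?A *\<^sub>v Matrix.vec n v))\<^sup>2 \<le> (c * vnorm (Matrix.vec n v))\<^sup>2"
        by (simp add: power_mono)
      then show "(\<Sum>i<m. (cmod (\<Sum>j<n. a i j * v j))\<^sup>2) \<le> c\<^sup>2 * (\<Sum>j<n. (cmod (v j))\<^sup>2)"
        by (simp only: nA nv power_mult_distrib)
    qed
  next
    assume r: ?r
    show ?l
    proof (rule mat_norm_le[OF assms])
      fix v :: "complex vec" assume "v \<in> carrier_vec (dim_col ?A)"
      then obtain w where w: "v = Matrix.vec n w" by (metis dim_col_mat(1) eq_vecI carrier_vecD dim_vec index_vec)
      have "(vnorm (?A *\<^sub>v v))\<^sup>2 \<le> (c * vnorm v)\<^sup>2"
        unfolding w by (simp only: nA nv power_mult_distrib r)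
      then show "vnorm (?A *\<^sub>v v) \<le> c * vnorm v"
        by (rule power2_le_imp_le) (simp add: assms)
    qed
  qed
qed

section \<open>Norms of block matrices and of bilinear forms\<close>

lemma vnorm_append: "(vnorm (v @\<^sub>v w))\<^sup>2 = (vnorm v)\<^sup>2 + (vnorm w)\<^sup>2"
proof -
  have s: "(\<Sum>i<m + n. f i) = (\<Sum>i<m. f i) + (\<Sum>i<n. f (m + i))" for f :: "nat \<Rightarrow> real" and m n
    by (induction n) (auto simp: algebra_simps)
  show ?thesis
    by (simp add: vnorm_def L2_set_def sum_nonneg s)
qed

text \<open>The two halves of a vector have orthogonal images, so squared norms add and a common
  bound for the two summands is enough.\<close>

lemma mat_norm_dsum_le: 
  assumes "A \<in> carrier_mat m n" "B \<in> carrier_mat k l" "mat_norm A \<le> c" "mat_norm B \<le> c"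
  shows "mat_norm (dsum_mat A B) \<le> c"
proof (rule mat_norm_le)
  show c: "0 \<le> c" using assms(3) mat_norm_nonneg order_trans by blast
  fix v :: "complex vec" assume "v \<in> carrier_vec (dim_col (dsum_mat A B))"
  then have "v \<in> carrier_vec (n + l)" using assms by (auto simp: dsum_mat_def)
  then obtain v1 v2 where v: "v = v1 @\<^sub>v v2" "v1 \<in> carrier_vec n" "v2 \<in> carrier_vec l"
    by (metis vec_first_last_append vec_first_carrier vec_last_carrier)
  have e: "dsum_mat A B *\<^sub>v v = (A *\<^sub>v v1) @\<^sub>v (B *\<^sub>v v2)"
    using assms v four_block_mat_mult_vec[of A m n "0\<^sub>m m l" l "0\<^sub>m k n" k B v1 v2]
    by (simp add: dsum_mat_def carrier_matD[OF assms(1)] carrier_matD[OF assms(2)]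
        zero_mat_mult_vec mult_mat_vec_carrier[OF assms(1)] mult_mat_vec_carrier[OF assms(2)])
  have "(vnorm (dsum_mat A B *\<^sub>v v))\<^sup>2 = (vnorm (A *\<^sub>v v1))\<^sup>2 + (vnorm (B *\<^sub>v v2))\<^sup>2"
    by (simp add: e vnorm_append)
  also have "\<dots> \<le> (c * vnorm v1)\<^sup>2 + (c * vnorm v2)\<^sup>2"
  proof (intro add_mono power_mono vnorm_nonneg)
    show "vnorm (A *\<^sub>v v1) \<le> c * vnorm v1"
      by (rule order_trans[OF vnorm_mult_le]) (use assms v in \<open>auto intro: mult_right_mono\<close>)
    show "vnorm (B *\<^sub>v v2) \<le> c * vnorm v2"
      by (rule order_trans[OF vnorm_mult_le]) (use assms v in \<open>auto intro: mult_right_mono\<close>)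
  qed
  also have "\<dots> = (c * vnorm v)\<^sup>2"
    by (simp add: v(1) vnorm_append power_mult_distrib algebra_simps)
  finally show "vnorm (dsum_mat A B *\<^sub>v v) \<le> c * vnorm v"
    by (rule power2_le_imp_le) (simp add: c)
qed

text \<open>Vectors with vanishing upper half see just the right-hand blocks. In this way the
  off-diagonal block of the value at a sheared point is bounded by the whole value.\<close>

lemma mat_norm_four_block_corner_le:
  assumes "A \<in> carrier_mat n n" "B \<in> carrier_mat n n" "C \<in> carrier_mat n n" "D \<in> carrier_mat n n"
  shows "mat_norm B \<le> mat_norm (four_block_mat A B C D)"
proof (rule mat_norm_le)
  let ?F = "four_block_mat A B C D"
  fix v :: "complex vec" assume "v \<in> carrier_vec (dim_col B)"
  then have v: "v \<in> carrier_vec n" using assms by auto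
  have e: "?F *\<^sub>v (0\<^sub>v n @\<^sub>v v) = (B *\<^sub>v v) @\<^sub>v (D *\<^sub>v v)"
    using four_block_mat_mult_vec[OF assms, of "0\<^sub>v n" v] v assms
      mult_mat_vec_carrier[of B n n v] mult_mat_vec_carrier[of D n n v]
    by (simp add: mat_mult_zero_vec)
  have "(vnorm (B *\<^sub>v v))\<^sup>2 \<le> (vnorm (?F *\<^sub>v (0\<^sub>v n @\<^sub>v v)))\<^sup>2"
    by (simp add: e vnorm_append)
  also have "\<dots> \<le> (mat_norm ?F * vnorm (0\<^sub>v n @\<^sub>v v))\<^sup>2"
    using assms v by (intro power_mono vnorm_mult_le) (auto intro: carrier_vecI)
  also have "\<dots> = (mat_norm ?F * vnorm v)\<^sup>2"
    by (simp add: power_mult_distrib vnorm_append)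
  finally show "vnorm (B *\<^sub>v v) \<le> mat_norm ?F * vnorm v"
    by (rule power2_le_imp_le) simp
qed simp

lemma mat_norm_upper_corner_le:
  assumes "B \<in> carrier_mat n n"
  shows "mat_norm (four_block_mat (0\<^sub>m n n) B (0\<^sub>m n n) (0\<^sub>m n n)) \<le> mat_norm B"
proof (rule mat_norm_le)
  let ?F = "four_block_mat (0\<^sub>m n n) B (0\<^sub>m n n) (0\<^sub>m n n)"
  fix v :: "complex vec" assume "v \<in> carrier_vec (dim_col ?F)"
  then have "v \<in> carrier_vec (n + n)" using assms by auto
  then obtain v1 v2 where v: "v = v1 @\<^sub>v v2" "v1 \<in> carrier_vec n" "v2 \<in> carrier_vec n"
    by (metis vec_first_last_append vec_first_carrier vec_last_carrier)
  have e: "?F *\<^sub>v v = (B *\<^sub>v v2) @\<^sub>v 0\<^sub>v n"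
    using four_block_mat_mult_vec[OF zero_carrier_mat assms zero_carrier_mat zero_carrier_mat v(2,3)]
      v mult_mat_vec_carrier[OF assms v(3)]
    by (simp add: zero_mat_mult_vec)
  have "(vnorm (?F *\<^sub>v v))\<^sup>2 = (vnorm (B *\<^sub>v v2))\<^sup>2" by (simp add: e vnorm_append)
  also have "\<dots> \<le> (mat_norm B * vnorm v2)\<^sup>2" 
    using assms v by (intro power_mono vnorm_mult_le) auto
  also have "\<dots> \<le> (mat_norm B * vnorm v)\<^sup>2"
    by (simp add: power_mult_distrib v(1) vnorm_append mult_left_mono)
  finally show "vnorm (?F *\<^sub>v v) \<le> mat_norm B * vnorm v"
    by (rule power2_le_imp_le) simp
qed simp

text \<open>Pairing with v and w turns a matrix-valued contour integral into a scalar one without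
  any loss in the norm, hence without a constant that depends on n.\<close>

lemma mat_norm_le_bilinear:
  assumes A: "A \<in> carrier_mat n n" and "0 \<le> c"
    and w: "\<And>v w. v \<in> carrier_vec n \<Longrightarrow> w \<in> carrier_vec n \<Longrightarrow>
      cmod (\<Sum>i<n. \<Sum>j<n. vec_index w i * A $$ (i, j) * vec_index v j) \<le> c * vnorm v * vnorm w"
  shows "mat_norm A \<le> c"
proof (rule mat_norm_le[OF \<open>0 \<le> c\<close>])
  fix v :: "complex vec" assume "v \<in> carrier_vec (dim_col A)"
  then have v: "v \<in> carrier_vec n" using A by simp
  define u where "u = A *\<^sub>v v"
  \<comment> \<open>The form carries no conjugate, so the conjugate is put into the test vector; the
    form then equals the squared norm of u.\<close>
  define w where "w = Matrix.vec n (\<lambda>i. cnj (vec_index u i))"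
  have u: "u \<in> carrier_vec n" using A v by (simp add: u_def)
  have nw: "vnorm w = vnorm u" using u by (simp add: w_def vnorm_def L2_set_def)
  have ui: "vec_index u i = (\<Sum>j<n. A $$ (i, j) * vec_index v j)" if "i < n" for i
    using A v that unfolding u_def by (subst mat_vec_index) auto
  have "(\<Sum>i<n. \<Sum>j<n. vec_index w i * A $$ (i, j) * vec_index v j) = (\<Sum>i<n. cnj (vec_index u i) * vec_index u i)"
    by (simp add: w_def ui sum_distrib_left mult.assoc)
  also have "\<dots> = (\<Sum>i<n. complex_of_real ((cmod (vec_index u i))\<^sup>2))"
    by (intro sum.cong refl) (metis complex_norm_square mult.commute)
  also have "\<dots> = complex_of_real ((vnorm u)\<^sup>2)" using u
    by (simp add: vnorm_def L2_set_def sum_nonneg)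
  finally have "(vnorm u)\<^sup>2 \<le> c * vnorm v * vnorm u"
    using w[OF v, of w] nw by (simp add: w_def norm_power)
  then show "vnorm (A *\<^sub>v v) \<le> c * vnorm v"
    unfolding u_def[symmetric]
    using \<open>0 \<le> c\<close> by (cases "vnorm u = 0") (auto simp: power2_eq_square mult_le_cancel_right less_le)
qed

section \<open>Polynomials of a matrix\<close>

text \<open>Horner's scheme, with the size of the zero and identity matrices read off x: matrices of
  all sizes share one type, which is not a ring.\<close>

definition peval :: "complex poly \<Rightarrow> complex mat \<Rightarrow> complex mat" where
  "peval q x = fold_coeffs (\<lambda>c M. c \<cdot>\<^sub>m 1\<^sub>m (dim_row x) + x * M) q (0\<^sub>m (dim_row x) (dim_row x))"

lemma peval_0: "x \<in> carrier_mat n n \<Longrightarrow> peval 0 x = 0\<^sub>m n n"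
  by (simp add: peval_def)

lemma peval_pCons:
  assumes "x \<in> carrier_mat n n"
  shows "peval (pCons c q) x = c \<cdot>\<^sub>m 1\<^sub>m n + x * peval q x"
proof (cases "c = 0 \<and> q = 0")
  \<comment> \<open>\<open>pCons 0 0\<close> collapses to the zero polynomial, which has no
    coefficient to fold over; both sides are zero.\<close>
  case True
  then show ?thesis using assms by (auto simp: peval_def intro!: eq_matI)
next
  case False
  then show ?thesis using assms by (auto simp: peval_def)
qed

lemma peval_carrier [simp]: "x \<in> carrier_mat n n \<Longrightarrow> peval q x \<in> carrier_mat n n"
proof (induction q)
  case (pCons a p)
  have "x * peval p x \<in> carrier_mat n n" using pCons by auto
  then show ?case using pCons.prems by (simp add: peval_pCons)
qed (simp add: peval_0)

lemma peval_const: "x \<in> carrier_mat n n \<Longrightarrow> peval [:c:] x = c \<cdot>\<^sub>m 1\<^sub>m n"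
  by (auto simp: peval_pCons[of x n] peval_0[of x n] intro!: eq_matI)

lemma peval_one: "x \<in> carrier_mat n n \<Longrightarrow> peval 1 x = 1\<^sub>m n"
  using peval_const[of x n 1] by (auto simp: one_pCons intro!: eq_matI)

lemma peval_linear: "x \<in> carrier_mat n n \<Longrightarrow> peval [:c, 1:] x = c \<cdot>\<^sub>m 1\<^sub>m n + x"
  by (simp add: peval_pCons[of x n] peval_one[of x n, unfolded one_pCons])
     (auto intro!: eq_matI simp: peval_pCons[of x n] peval_0[of x n])

lemma peval_add:
  assumes x: "x \<in> carrier_mat n n"
  shows "peval (p + q) x = peval p x + peval q x"
proof (induction p arbitrary: q)
  case 0
  then show ?case using x peval_carrier[OF x] by (simp add: peval_0)
next
  case (pCons a p)
  obtain b r where q: "q = pCons b r" by (cases q)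
  have xp: "x * peval p x \<in> carrier_mat n n" "x * peval r x \<in> carrier_mat n n"
    using x by auto
  have "peval (pCons a p + q) x = (a + b) \<cdot>\<^sub>m 1\<^sub>m n + x * (peval p x + peval r x)"
    by (simp add: q peval_pCons[OF x] pCons.IH)
  also have "x * (peval p x + peval r x) = x * peval p x + x * peval r x"
    by (rule mult_add_distrib_mat[OF x peval_carrier[OF x] peval_carrier[OF x]])
  finally show ?case using xp x
    by (auto simp: q peval_pCons[OF x] distrib_right carrier_matD[OF peval_carrier[OF x]] intro!: eq_matI)
qed

lemma mult_smult_one: "A \<in> carrier_mat n n \<Longrightarrow> (c \<cdot>\<^sub>m 1\<^sub>m n) * A = c \<cdot>\<^sub>m (A :: complex mat)"
  using mult_smult_assoc_mat[of "1\<^sub>m n" n n A n c] by simp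

lemma mult_smult_one_right: "A \<in> carrier_mat n n \<Longrightarrow> A * (c \<cdot>\<^sub>m 1\<^sub>m n) = c \<cdot>\<^sub>m (A :: complex mat)"
  using mult_smult_distrib[of A n n "1\<^sub>m n" n c] by simp

lemma peval_smult:
  assumes x: "x \<in> carrier_mat n n"
  shows "peval (Polynomial.smult c p) x = c \<cdot>\<^sub>m peval p x"
proof (induction p)
  case 0
  then show ?case using x by (auto simp: peval_0 intro!: eq_matI)
next
  case (pCons a p)
  have "x * (c \<cdot>\<^sub>m peval p x) = c \<cdot>\<^sub>m (x * peval p x)"
    by (rule mult_smult_distrib[OF x peval_carrier[OF x]])
  moreover have "x * peval p x \<in> carrier_mat n n" using x by auto
  ultimately show ?case
    using x by (auto simp: peval_pCons[OF x] pCons.IH distrib_left carrier_matD[OF peval_carrier[OF x]] intro!: eq_matI)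
qed

lemma peval_mult:
  assumes x: "x \<in> carrier_mat n n"
  shows "peval (p * q) x = peval p x * peval q x"
proof (induction p)
  case 0
  then show ?case using x left_mult_zero_mat[OF peval_carrier[OF x, of q], of n] by (simp add: peval_0)
next
  case (pCons a p)
  have c: "peval q x \<in> carrier_mat n n" "peval p x \<in> carrier_mat n n" "x * peval p x \<in> carrier_mat n n"
    using x by auto
  have "peval (pCons a p * q) x = a \<cdot>\<^sub>m peval q x + (0 \<cdot>\<^sub>m 1\<^sub>m n + x * (peval p x * peval q x))"
    by (simp add: peval_add[OF x] peval_smult[OF x] peval_pCons[OF x] pCons.IH)
  also have "x * (peval p x * peval q x) = (x * peval p x) * peval q x"
    using assoc_mult_mat[OF x c(2) c(1)] by simp
  also have "a \<cdot>\<^sub>m peval q x + (0 \<cdot>\<^sub>m 1\<^sub>m n + (x * peval p x) * peval q x)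
      = (a \<cdot>\<^sub>m 1\<^sub>m n) * peval q x + (x * peval p x) * peval q x"
  proof -
    have "M + (0 \<cdot>\<^sub>m 1\<^sub>m n + N) = M + N" if "M \<in> carrier_mat n n" "N \<in> carrier_mat n n" for M N :: "complex mat"
      using that by (auto intro!: eq_matI)
    from this[of "a \<cdot>\<^sub>m peval q x" "(x * peval p x) * peval q x"] show ?thesis
      using c by (simp only: mult_smult_one[OF c(1)] smult_carrier_mat mult_carrier_mat)
  qed
  also have "\<dots> = (a \<cdot>\<^sub>m 1\<^sub>m n + x * peval p x) * peval q x"
    by (rule add_mult_distrib_mat[symmetric]) (use c in auto)
  finally show ?case by (simp add: peval_pCons[OF x])
qed

lemma peval_X: "x \<in> carrier_mat n n \<Longrightarrow> peval [:0, 1:] x = x"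
  by (subst peval_linear[of x n]) (auto intro!: eq_matI)

lemma conj_mult:
  fixes P Q :: "complex mat"
  assumes c: "P \<in> carrier_mat n n" "Q \<in> carrier_mat n n" "B \<in> carrier_mat n n" "C \<in> carrier_mat n n"
    and QP: "Q * P = 1\<^sub>m n"
  shows "(P * B * Q) * (P * C * Q) = P * (B * C) * Q"
proof -
  note [simp] = assoc_mult_mat[where ?n\<^sub>1.0 = n and ?n\<^sub>2.0 = n and ?n\<^sub>3.0 = n and ?n\<^sub>4.0 = n] mult_carrier_mat[where n = n and nr = n and nc = n]
  have "(P * B * Q) * (P * C * Q) = P * (B * ((Q * P) * (C * Q)))" using c by simp
  also have "\<dots> = P * (B * C) * Q" using c QP by (simp add: left_mult_one_mat[of _ n n])
  finally show ?thesis .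
qed

lemma peval_similar:
  assumes c: "B \<in> carrier_mat n n" "P \<in> carrier_mat n n" "Q \<in> carrier_mat n n"
    and QP: "Q * P = 1\<^sub>m n" and PQ: "P * Q = 1\<^sub>m n"
  shows "peval q (P * B * Q) = P * peval q B * Q"
proof (induction q)
  case 0
  have "P * B * Q \<in> carrier_mat n n" using c by auto
  then show ?case using c by (simp add: peval_0)
next
  case (pCons a p)
  have x: "P * B * Q \<in> carrier_mat n n" using c by auto
  have M: "peval p B \<in> carrier_mat n n" using c by auto
  have 1: "(P * B * Q) * (P * peval p B * Q) = P * (B * peval p B) * Q"
    by (rule conj_mult[OF c(2,3,1) M QP])
  have 2: "P * (a \<cdot>\<^sub>m 1\<^sub>m n) * Q = a \<cdot>\<^sub>m 1\<^sub>m n"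
    using c PQ by (simp add: mult_smult_one_right mult_smult_assoc_mat[OF c(2,3)])
  have BM: "B * peval p B \<in> carrier_mat n n" using c(1) M by (rule mult_carrier_mat)
  have 3: "P * (a \<cdot>\<^sub>m 1\<^sub>m n + B * peval p B) * Q
     = P * (a \<cdot>\<^sub>m 1\<^sub>m n) * Q + P * (B * peval p B) * Q"
    using c BM
    by (simp add: mult_add_distrib_mat[of P n n _ n] add_mult_distrib_mat[of _ n n _ Q n] del: assoc_mult_mat)
  show ?case using 1 2 3 by (simp only: peval_pCons[OF x] peval_pCons[OF c(1)] pCons.IH)
qed

section \<open>Direct sums, similarity and the spectrum\<close>

lemma dsum_carrier [simp]:
  "A \<in> carrier_mat n n \<Longrightarrow> B \<in> carrier_mat m m \<Longrightarrow> dsum_mat A B \<in> carrier_mat (n + m) (n + m)"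
  by (simp add: dsum_mat_def)

lemma dsum_mult:
  assumes "A \<in> carrier_mat n n" "B \<in> carrier_mat m m" "C \<in> carrier_mat n n" "D \<in> carrier_mat m m"
  shows "dsum_mat A B * dsum_mat C D = dsum_mat (A * C) (B * D)"
proof -
  have "A * C \<in> carrier_mat n n" "B * D \<in> carrier_mat m m" using assms by auto
  then show ?thesis using assms mult_four_block_mat[of A n n "0\<^sub>m n m" m "0\<^sub>m m n" m B C n "0\<^sub>m n m" m "0\<^sub>m m n" D]
    by (simp add: dsum_mat_def)
qed

lemma dsum_add:
  assumes "A \<in> carrier_mat n n" "B \<in> carrier_mat m m" "C \<in> carrier_mat n n" "D \<in> carrier_mat m m"
  shows "dsum_mat A B + dsum_mat C D = dsum_mat (A + C) (B + D)"
  using assms by (auto simp: dsum_mat_def intro!: eq_matI)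

lemma dsum_diff:
  assumes "A \<in> carrier_mat n n" "B \<in> carrier_mat m m" "C \<in> carrier_mat n n" "D \<in> carrier_mat m m"
  shows "dsum_mat A B - dsum_mat C D = dsum_mat (A - C) (B - D)"
  using assms by (auto simp: dsum_mat_def intro!: eq_matI)

lemma dsum_smult:
  assumes "A \<in> carrier_mat n n" "B \<in> carrier_mat m m"
  shows "c \<cdot>\<^sub>m dsum_mat A B = dsum_mat (c \<cdot>\<^sub>m A) (c \<cdot>\<^sub>m B)"
  using assms by (auto simp: dsum_mat_def intro!: eq_matI)

lemma dsum_zero: "dsum_mat (0\<^sub>m n n) (0\<^sub>m m m) = 0\<^sub>m (n + m) (n + m)"
  by (auto simp: dsum_mat_def intro!: eq_matI)

lemma dsum_one: "dsum_mat (1\<^sub>m n) (1\<^sub>m m) = 1\<^sub>m (n + m)"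
  by (auto simp: dsum_mat_def intro!: eq_matI)

lemma dsum_inject:
  assumes "A \<in> carrier_mat n n" "B \<in> carrier_mat m m" "C \<in> carrier_mat n n" "D \<in> carrier_mat m m"
  shows "dsum_mat A B = dsum_mat C D \<longleftrightarrow> A = C \<and> B = D"
proof
  assume e: "dsum_mat A B = dsum_mat C D"
  have "A $$ (i, j) = C $$ (i, j)" if "i < n" "j < n" for i j
    using arg_cong[OF e, of "\<lambda>M. M $$ (i, j)"] that assms by (simp add: dsum_mat_def)
  moreover have "B $$ (i, j) = D $$ (i, j)" if "i < m" "j < m" for i j
    using arg_cong[OF e, of "\<lambda>M. M $$ (n + i, n + j)"] that assms by (simp add: dsum_mat_def)
  ultimately show "A = C \<and> B = D" using assms by (auto intro!: eq_matI)
qed simp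

lemma peval_dsum:
  assumes "A \<in> carrier_mat n n" "B \<in> carrier_mat m m"
  shows "peval q (dsum_mat A B) = dsum_mat (peval q A) (peval q B)"
proof (induction q)
  case 0
  then show ?case using assms dsum_carrier[OF assms] by (simp add: peval_0 dsum_zero)
next
  case (pCons a p)
  have c: "A * peval p A \<in> carrier_mat n n" "B * peval p B \<in> carrier_mat m m" using assms by auto
  have "a \<cdot>\<^sub>m 1\<^sub>m (n + m) = dsum_mat (a \<cdot>\<^sub>m 1\<^sub>m n) (a \<cdot>\<^sub>m 1\<^sub>m m)"
    by (simp add: dsum_smult[of _ n _ m] flip: dsum_one)
  then show ?case using assms c
    by (simp add: peval_pCons[OF dsum_carrier[OF assms]] peval_pCons[OF assms(1)] peval_pCons[OF assms(2)]
        pCons.IH dsum_mult[of _ n _ m] dsum_add[of _ n _ m])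
qed

lemma spectrum_similar:
  fixes B :: "complex mat"
  assumes c: "B \<in> carrier_mat n n" "P \<in> carrier_mat n n" "Q \<in> carrier_mat n n"
    and QP: "Q * P = 1\<^sub>m n" and PQ: "P * Q = 1\<^sub>m n"
  shows "spectrum (P * B * Q) = spectrum B"
proof -
  have x: "P * B * Q \<in> carrier_mat n n" using c by auto
  then have "similar_mat_wit (P * B * Q) B P Q"
    using assms by (auto simp: similar_mat_wit_def Let_def)
  then have "char_poly (P * B * Q) = char_poly B"
    by (intro char_poly_similar) (auto simp: similar_mat_def)
  then show ?thesis by (simp add: spectrum_root_char_poly[OF x] spectrum_root_char_poly[OF c(1)])
qed

lemma spectrum_dsum:
  assumes "A \<in> carrier_mat n n" "B \<in> carrier_mat m m"
  shows "spectrum (dsum_mat A B) = spectrum A \<union> spectrum B"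
proof -
  have "eigenvalue (dsum_mat A B) k \<longleftrightarrow> eigenvalue A k \<or> eigenvalue B k" for k
  proof -
    have "char_matrix (dsum_mat A B) k = four_block_mat (char_matrix A k) (0\<^sub>m n m) (0\<^sub>m m n) (char_matrix B k)"
      using assms by (auto simp: dsum_mat_def char_matrix_def intro!: eq_matI)
    then have "det (char_matrix (dsum_mat A B) k) = det (char_matrix A k) * det (char_matrix B k)"
      using assms by (simp add: det_four_block_mat_upper_right_zero[of _ n _ m])
    then show ?thesis
      using assms by (simp add: eigenvalue_det[of _ n] eigenvalue_det[of _ m] eigenvalue_det[OF dsum_carrier[OF assms]])
  qed
  then show ?thesis by (auto simp: spectrum_def)
qed

section \<open>Spectral bounds and annihilating polynomials\<close>

lemma peval_eigenvector:
  assumes x: "x \<in> carrier_mat n n" and v: "v \<in> carrier_vec n" and e: "x *\<^sub>v v = l \<cdot>\<^sub>v v"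
  shows "peval q x *\<^sub>v v = poly q l \<cdot>\<^sub>v v"
proof (induction q)
  case 0
  then show ?case using x v by (simp add: peval_0 zero_mat_mult_vec) (auto intro!: eq_vecI)
next
  case (pCons a p)
  have "peval (pCons a p) x *\<^sub>v v = (a \<cdot>\<^sub>m 1\<^sub>m n) *\<^sub>v v + (x * peval p x) *\<^sub>v v"
    unfolding peval_pCons[OF x] by (rule add_mult_distrib_mat_vec[of _ n n]) (use x v in auto)
  also have "(x * peval p x) *\<^sub>v v = x *\<^sub>v (poly p l \<cdot>\<^sub>v v)"
    using x v by (simp add: pCons.IH assoc_mult_mat_vec[of _ n n _ n])
  also have "\<dots> = poly p l \<cdot>\<^sub>v (l \<cdot>\<^sub>v v)" by (simp add: mult_mat_vec[OF x v] e)
  also have "(a \<cdot>\<^sub>m 1\<^sub>m n) *\<^sub>v v = a \<cdot>\<^sub>v v" using v by (simp add: smult_mat_vec)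
  finally show ?case using v by (auto intro!: eq_vecI simp: algebra_simps)
qed

text \<open>An eigenvector of x for l is one of q(x) for q(l). Smallness of q(x) therefore confines
  the spectrum to the vicinity of the roots of q, for matrices of any size.\<close>

lemma spectrum_bound:
  assumes x: "x \<in> carrier_mat n n" and l: "l \<in> spectrum x"
  shows "cmod (poly q l) \<le> mat_norm (peval q x)"
proof -
  obtain v where v: "v \<in> carrier_vec n" "v \<noteq> 0\<^sub>v n" "x *\<^sub>v v = l \<cdot>\<^sub>v v"
    using l x by (auto simp: spectrum_def eigenvalue_def eigenvector_def)
  have pos: "vnorm v > 0" using v vnorm_eq_0[OF v(1)] by (simp add: less_le)
  have "cmod (poly q l) * vnorm v = vnorm (peval q x *\<^sub>v v)"
    by (simp add: peval_eigenvector[OF x v(1,3)] vnorm_smult)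
  also have "\<dots> \<le> mat_norm (peval q x) * vnorm v"
    using v peval_carrier[OF x, of q] by (intro vnorm_mult_le) auto
  finally show ?thesis using pos by simp
qed

text \<open>Cayley-Hamilton along the standard flag: the factor with root \<open>B $$ (k, k)\<close>
  maps the span of the first k + 1 basis vectors into that of the first k, which the remaining
  factors kill by induction.\<close>

lemma triangular_annihilator:
  assumes B: "B \<in> carrier_mat n n" and ut: "upper_triangular B"
  shows "k \<le> n \<Longrightarrow> v \<in> carrier_vec n \<Longrightarrow> (\<And>i. k \<le> i \<Longrightarrow> i < n \<Longrightarrow> vec_index v i = 0) \<Longrightarrow>
    peval (\<Prod>a\<leftarrow>take k (diag_mat B). [:- a, 1:]) B *\<^sub>v v = 0\<^sub>v n"
proof (induction k arbitrary: v)
  case 0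
  then have "v = 0\<^sub>v n" by (auto intro!: eq_vecI)
  then show ?case using B mat_mult_zero_vec[OF peval_carrier[OF B]] by simp
next
  case (Suc k)
  let ?P = "peval (\<Prod>a\<leftarrow>take k (diag_mat B). [:- a, 1:]) B"
  let ?b = "B $$ (k, k)"
  have k: "k < n" using Suc by simp
  have "take (Suc k) (diag_mat B) = take k (diag_mat B) @ [?b]"
    using k B by (simp add: take_Suc_conv_app_nth diag_mat_def)
  then have e: "peval (\<Prod>a\<leftarrow>take (Suc k) (diag_mat B). [:- a, 1:]) B = ?P * ((- ?b) \<cdot>\<^sub>m 1\<^sub>m n + B)"
    by (simp add: peval_mult[OF B] peval_linear[OF B] del: mult_pCons_right)
  define w where "w = ((- ?b) \<cdot>\<^sub>m 1\<^sub>m n + B) *\<^sub>v v"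
  have w: "w \<in> carrier_vec n" using B by (auto simp: w_def intro!: carrier_vecI)
  have "vec_index w i = 0" if "k \<le> i" "i < n" for i
  proof -
    have "vec_index w i = (\<Sum>j<n. ((if i = j then - ?b else 0) + B $$ (i, j)) * vec_index v j)"
      unfolding w_def using B Suc.prems that by (subst mat_vec_index) (auto intro!: sum.cong)
    also have "\<dots> = 0"
    proof (rule sum.neutral, rule ballI)
      fix j assume "j \<in> {..<n}"
      then have "j < n" by simp
      consider "j > k" | "j < i" | "j = i" "i = k" using \<open>k \<le> i\<close> by linarith
      then show "((if i = j then - ?b else 0) + B $$ (i, j)) * vec_index v j = 0"
      proof cases
        case 1 then show ?thesis using Suc.prems(3)[of j] \<open>j < n\<close> by simp
      next
        case 2 then show ?thesis using ut B that by (auto simp: upper_triangular_def)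
      qed simp
    qed
    finally show ?thesis .
  qed
  then have "?P *\<^sub>v w = 0\<^sub>v n" using Suc.IH[of w] k w by simp
  moreover have "(?P * ((- ?b) \<cdot>\<^sub>m 1\<^sub>m n + B)) *\<^sub>v v = ?P *\<^sub>v w"
    unfolding w_def by (rule assoc_mult_mat_vec[of _ n n _ n]) (use B Suc.prems in auto)
  ultimately show ?case by (simp add: e)
qed

lemma mat_eq_0I:
  assumes A: "A \<in> carrier_mat m n" and z: "\<And>v. v \<in> carrier_vec n \<Longrightarrow> A *\<^sub>v v = 0\<^sub>v m"
  shows "A = (0\<^sub>m m n :: complex mat)"
proof (rule eq_matI)
  fix i j assume ij: "i < dim_row (0\<^sub>m m n :: complex mat)" "j < dim_col (0\<^sub>m m n :: complex mat)"
  then have "A $$ (i, j) = vec_index (A *\<^sub>v unit_vec n j) i"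
    using A by (simp add: mat_vec_index)
  then show "A $$ (i, j) = 0\<^sub>m m n $$ (i, j)" using ij z[of "unit_vec n j"] by simp
qed (use A in auto)

text \<open>Schur triangularisation reduces this to the triangular case. A product of linear factors
  with roots exactly in the spectrum is wanted: division by it goes root by root, and it has no zero
  off the spectrum.\<close>

lemma annihilating_polynomial:
  assumes x: "x \<in> carrier_mat n n"
  obtains as where "set as = spectrum x" "peval (\<Prod>a\<leftarrow>as. [:- a, 1:]) x = 0\<^sub>m n n"
proof -
  obtain es where "char_poly x = (\<Prod>a\<leftarrow>es. [:- a, 1:])"
    using char_poly_factorized[OF x] by blast
  then obtain B where B: "B \<in> carrier_mat n n" "upper_triangular B" "similar_mat x B"
    using schur_decomposition_exists[OF x] by blast
  obtain P Q where "similar_mat_wit x B P Q" using B(3) by (auto simp: similar_mat_def)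
  then have c: "P \<in> carrier_mat n n" "Q \<in> carrier_mat n n" "P * Q = 1\<^sub>m n" "Q * P = 1\<^sub>m n" "x = P * B * Q"
    using x by (auto simp: similar_mat_wit_def Let_def)
  let ?as = "diag_mat B"
  let ?p = "\<Prod>a\<leftarrow>?as. [:- a, 1:]"
  have "peval ?p B = 0\<^sub>m n n"
  proof (rule mat_eq_0I)
    fix v :: "complex vec" assume "v \<in> carrier_vec n"
    then have "peval (\<Prod>a\<leftarrow>take n ?as. [:- a, 1:]) B *\<^sub>v v = 0\<^sub>v n"
      by (intro triangular_annihilator[OF B(1,2)]) auto
    then show "peval ?p B *\<^sub>v v = 0\<^sub>v n" using B(1) by (simp add: diag_mat_def)
  qed (use B in auto)
  then have "peval ?p x = 0\<^sub>m n n"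
    using peval_similar[OF B(1) c(1,2,4,3), of ?p] c by simp
  moreover have "set ?as = spectrum x"
    unfolding spectrum_root_char_poly[OF x] char_poly_similar[OF B(3)]
      char_poly_upper_triangular[OF B(1,2)]
    by (auto simp: poly_prod_list o_def prod_list_zero_iff)
  ultimately show ?thesis using that by blast
qed

section \<open>The resolvent\<close>

lemma mat_inv_eqI:
  assumes A: "A \<in> carrier_mat n n" and B: "B \<in> carrier_mat n n" and AB: "A * B = 1\<^sub>m n"
  shows "mat_inv A = B"
proof -
  have "det A * det B = 1" using det_mult[OF A B] AB by simp
  then have "det A \<noteq> 0" by auto
  then have "A \<in> Units (ring_mat TYPE(complex) n ())" by (rule det_non_zero_imp_unit[OF A])
  then obtain C where C: "mat_inverse A = Some C" using mat_inverse(1)[OF A, of "()"] by (cases "mat_inverse A") auto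
  have CA: "C * A = 1\<^sub>m n" "C \<in> carrier_mat n n" using mat_inverse(2)[OF A C] by auto
  have "C = C * (A * B)" using AB CA by simp
  also have "\<dots> = B" using assoc_mult_mat[OF CA(2) A B] CA(1) left_mult_one_mat[OF B] by simp
  finally show ?thesis by (simp add: mat_inv_def C)
qed

lemma mat_inv_nonsing:
  assumes A: "A \<in> carrier_mat n n" and d: "det A \<noteq> 0"
  shows "mat_inv A \<in> carrier_mat n n" "A * mat_inv A = 1\<^sub>m n" "mat_inv A * A = 1\<^sub>m n"
proof -
  have "A \<in> Units (ring_mat TYPE(complex) n ())" by (rule det_non_zero_imp_unit[OF A d])
  then obtain C where C: "mat_inverse A = Some C" using mat_inverse(1)[OF A, of "()"] by (cases "mat_inverse A") auto
  show "mat_inv A \<in> carrier_mat n n" "A * mat_inv A = 1\<^sub>m n" "mat_inv A * A = 1\<^sub>m n"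
    using mat_inverse(2)[OF A C] by (auto simp: mat_inv_def C)
qed

lemma mat_inv_invertible:
  assumes A: "A \<in> carrier_mat n n" and i: "invertible_mat A"
  shows "mat_inv A \<in> carrier_mat n n" "A * mat_inv A = 1\<^sub>m n" "mat_inv A * A = 1\<^sub>m n"
proof -
  obtain B where B: "A * B = 1\<^sub>m n" "B * A = 1\<^sub>m (dim_row B)"
    using A i by (auto simp: invertible_mat_def inverts_mat_def)
  have "dim_col B = n" using arg_cong[OF B(1), of dim_col] by simp
  moreover have "dim_row B = n" using arg_cong[OF B(2), of dim_col] A by simp
  ultimately have Bc: "B \<in> carrier_mat n n" by auto
  have "det A * det B = 1" using det_mult[OF A Bc] B by simp
  then have "det A \<noteq> 0" by auto
  then show "mat_inv A \<in> carrier_mat n n" "A * mat_inv A = 1\<^sub>m n" "mat_inv A * A = 1\<^sub>m n"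
    using mat_inv_nonsing[OF A] by blast+
qed

definition resolvent :: "complex mat \<Rightarrow> complex \<Rightarrow> complex mat" where
  "resolvent x z = mat_inv (z \<cdot>\<^sub>m 1\<^sub>m (dim_row x) - x)"

lemma resolvent:
  assumes x: "x \<in> carrier_mat n n" and z: "z \<notin> spectrum x"
  shows "resolvent x z \<in> carrier_mat n n"
    "(z \<cdot>\<^sub>m 1\<^sub>m n - x) * resolvent x z = 1\<^sub>m n" "resolvent x z * (z \<cdot>\<^sub>m 1\<^sub>m n - x) = 1\<^sub>m n"
proof -
  let ?A = "z \<cdot>\<^sub>m 1\<^sub>m n - x"
  have A: "?A \<in> carrier_mat n n" using x by auto
  have "?A = (-1) \<cdot>\<^sub>m char_matrix x z"
    using x by (auto simp: char_matrix_def intro!: eq_matI)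
  moreover have "det (char_matrix x z) \<noteq> 0"
    using z eigenvalue_det[OF x] by (auto simp: spectrum_def)
  ultimately have "det ?A \<noteq> 0" by (simp add: det_smult)
  then show "resolvent x z \<in> carrier_mat n n"
    "?A * resolvent x z = 1\<^sub>m n" "resolvent x z * ?A = 1\<^sub>m n"
    using mat_inv_nonsing[OF A] x by (auto simp: resolvent_def)
qed

section \<open>Divided differences and the resolvent\<close>

lemma poly_bounded_on_ball: "\<exists>M. \<forall>z::complex. cmod z \<le> R \<longrightarrow> cmod (poly q z) \<le> M"
proof -
  have "compact (poly q ` cball 0 R)" by (intro compact_continuous_image continuous_intros) auto
  then have "bounded (poly q ` cball 0 R)" by (rule compact_imp_bounded)
  then obtain M where "\<And>z. z \<in> cball 0 R \<Longrightarrow> cmod (poly q z) \<le> M"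
    unfolding bounded_iff by blast
  then show ?thesis by (intro exI[of _ M]) auto
qed

text \<open>For scalar z one has z q(z) - x q(x) = q(z) (z - x) + x (q(z) - q(x)), which is the
  recursion for N. The bound in the last clause depends on q and R but not on the size of x, as free
  neighbourhoods require.\<close>

lemma divided_difference:
  fixes q :: "complex poly"
  obtains N :: "complex \<Rightarrow> complex mat \<Rightarrow> complex mat" where
    "\<And>n x z. x \<in> carrier_mat n n \<Longrightarrow> N z x \<in> carrier_mat n n"
    "\<And>n x z. x \<in> carrier_mat n n \<Longrightarrow> poly q z \<cdot>\<^sub>m 1\<^sub>m n - peval q x = N z x * (z \<cdot>\<^sub>m 1\<^sub>m n - x)"
    "\<And>n x i j. x \<in> carrier_mat n n \<Longrightarrow> i < n \<Longrightarrow> j < n \<Longrightarrow> (\<lambda>z. N z x $$ (i, j)) holomorphic_on UNIV"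
    "\<And>R. \<exists>K. \<forall>n x z. x \<in> carrier_mat n n \<longrightarrow> mat_norm x \<le> R \<longrightarrow> cmod z \<le> R \<longrightarrow> mat_norm (N z x) \<le> K"
proof (induction q arbitrary: thesis)
  case 0
  show ?case
    by (rule 0[of "\<lambda>z x. 0\<^sub>m (dim_row x) (dim_row x)"]) (auto simp: peval_0 intro!: eq_matI)
next
  case (pCons c q)
  obtain N where N: "\<And>n x z. x \<in> carrier_mat n n \<Longrightarrow> N z x \<in> carrier_mat n n"
    "\<And>n x z. x \<in> carrier_mat n n \<Longrightarrow> poly q z \<cdot>\<^sub>m 1\<^sub>m n - peval q x = N z x * (z \<cdot>\<^sub>m 1\<^sub>m n - x)"
    "\<And>n x i j. x \<in> carrier_mat n n \<Longrightarrow> i < n \<Longrightarrow> j < n \<Longrightarrow> (\<lambda>z. N z x $$ (i, j)) holomorphic_on UNIV"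
    "\<And>R. \<exists>K. \<forall>n x z. x \<in> carrier_mat n n \<longrightarrow> mat_norm x \<le> R \<longrightarrow> cmod z \<le> R \<longrightarrow> mat_norm (N z x) \<le> K"
    using pCons.IH by blast
  define N' where "N' = (\<lambda>z x. poly q z \<cdot>\<^sub>m 1\<^sub>m (dim_row x) + x * N z x)"
  have xN: "x * N z x \<in> carrier_mat n n" if "x \<in> carrier_mat n n" for n x z using that N(1)[OF that] by auto
  show ?case
  proof (rule pCons.prems[of N'])
    show N'c: "N' z x \<in> carrier_mat n n" if "x \<in> carrier_mat n n" for n x z
      using that xN[OF that] by (simp add: N'_def)
    show "poly (pCons c q) z \<cdot>\<^sub>m 1\<^sub>m n - peval (pCons c q) x = N' z x * (z \<cdot>\<^sub>m 1\<^sub>m n - x)"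
      if x: "x \<in> carrier_mat n n" for n x z
    proof -
      let ?Z = "z \<cdot>\<^sub>m 1\<^sub>m n - x" and ?Q = "peval q x"
      have Z: "?Z \<in> carrier_mat n n" and Q: "?Q \<in> carrier_mat n n" using x by auto
      have "N' z x * ?Z = (poly q z \<cdot>\<^sub>m 1\<^sub>m n) * ?Z + (x * N z x) * ?Z"
        unfolding N'_def using x xN[OF x] Z by (simp add: add_mult_distrib_mat[of _ n n _ _ n])
      also have "(x * N z x) * ?Z = x * (poly q z \<cdot>\<^sub>m 1\<^sub>m n - ?Q)"
        using assoc_mult_mat[OF x N(1)[OF x] Z] by (simp add: N(2)[OF x])
      also have "\<dots> = poly q z \<cdot>\<^sub>m x - x * ?Q"
        using mult_minus_distrib_mat[OF x _ Q, of "poly q z \<cdot>\<^sub>m 1\<^sub>m n"] mult_smult_one_right[OF x]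
        by simp
      also have "(poly q z \<cdot>\<^sub>m 1\<^sub>m n) * ?Z = poly q z \<cdot>\<^sub>m ?Z" by (rule mult_smult_one[OF Z])
      finally show ?thesis unfolding peval_pCons[OF x] using x Q
        by (auto intro!: eq_matI simp: algebra_simps carrier_matD[OF Q])
    qed
    show "(\<lambda>z. N' z x $$ (i, j)) holomorphic_on UNIV" if x: "x \<in> carrier_mat n n" "i < n" "j < n" for n x i j
    proof -
      have "N' z x $$ (i, j) = poly q z * (1\<^sub>m n $$ (i, j)) + (\<Sum>k<n. x $$ (i, k) * N z x $$ (k, j))" for z
        using x N(1)[OF x(1), of z] by (auto simp: N'_def scalar_prod_def atLeast0LessThan)
      moreover have "(\<lambda>z. poly q z * (1\<^sub>m n $$ (i, j)) + (\<Sum>k<n. x $$ (i, k) * N z x $$ (k, j))) holomorphic_on UNIV"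
        using x by (intro holomorphic_intros N(3)[OF x(1)]) auto
      ultimately show ?thesis by simp
    qed
    fix R
    obtain K where K: "\<And>n x z. x \<in> carrier_mat n n \<Longrightarrow> mat_norm x \<le> R \<Longrightarrow> cmod z \<le> R \<Longrightarrow> mat_norm (N z x) \<le> K"
      using N(4)[of R] by blast
    obtain M where M: "\<And>z. cmod z \<le> R \<Longrightarrow> cmod (poly q z) \<le> M" using poly_bounded_on_ball by blast
    show "\<exists>K. \<forall>n x z. x \<in> carrier_mat n n \<longrightarrow> mat_norm x \<le> R \<longrightarrow> cmod z \<le> R \<longrightarrow> mat_norm (N' z x) \<le> K"
    proof (intro exI allI impI)
      fix n x z assume x: "x \<in> carrier_mat n n" "mat_norm x \<le> R" "cmod z \<le> R"
      have "mat_norm (N' z x) \<le> mat_norm (poly q z \<cdot>\<^sub>m 1\<^sub>m (dim_row x)) + mat_norm (x * N z x)"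
        unfolding N'_def using x xN[OF x(1)] by (intro mat_norm_add_le[of _ n n]) auto
      also have "\<dots> \<le> M * 1 + R * K"
      proof (intro add_mono)
        show "mat_norm (poly q z \<cdot>\<^sub>m 1\<^sub>m (dim_row x)) \<le> M * 1"
          unfolding mat_norm_smult using M[OF x(3)] mat_norm_one_le
          by (intro mult_mono) (auto intro: order_trans[OF norm_ge_zero])
        have "mat_norm (x * N z x) \<le> mat_norm x * mat_norm (N z x)"
          by (rule mat_norm_mult_le[OF x(1) N(1)[OF x(1)]])
        also have "\<dots> \<le> R * K" using x K[OF x]
          by (intro mult_mono) (auto intro: order_trans[OF norm_ge_zero])
        finally show "mat_norm (x * N z x) \<le> R * K" .
      qed
      finally show "mat_norm (N' z x) \<le> M * 1 + R * K" .
    qed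
  qed
qed

lemma divided_difference_resolvent:
  assumes x: "x \<in> carrier_mat n n" and z: "z \<notin> spectrum x" and N: "N \<in> carrier_mat n n"
    and e: "c \<cdot>\<^sub>m 1\<^sub>m n - Q = N * (z \<cdot>\<^sub>m 1\<^sub>m n - x)" and Q: "Q \<in> carrier_mat n n"
  shows "c \<cdot>\<^sub>m resolvent x z = Q * resolvent x z + N"
proof -
  let ?R = "resolvent x z" and ?Z = "z \<cdot>\<^sub>m 1\<^sub>m n - x"
  note R = resolvent[OF x z]
  have Z: "?Z \<in> carrier_mat n n" using x by auto
  have "N = N * (?Z * ?R)" using R N by simp
  also have "\<dots> = (c \<cdot>\<^sub>m 1\<^sub>m n - Q) * ?R" using assoc_mult_mat[OF N Z R(1)] e by simp
  also have "\<dots> = c \<cdot>\<^sub>m ?R - Q * ?R"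
    using minus_mult_distrib_mat[of "c \<cdot>\<^sub>m 1\<^sub>m n" n n Q ?R n] Q R(1) mult_smult_one[OF R(1)] by simp
  finally have "N = c \<cdot>\<^sub>m ?R - Q * ?R" .
  moreover have "c \<cdot>\<^sub>m ?R = Q * ?R + (c \<cdot>\<^sub>m ?R - Q * ?R)"
    using R(1) Q by (auto intro!: eq_matI simp: carrier_matD[OF R(1)])
  ultimately show ?thesis by simp
qed

lemma finite_spectrum: "x \<in> carrier_mat n n \<Longrightarrow> finite (spectrum (x :: complex mat))"
  by (rule card_finite_spectrum(1))

text \<open>If p(x) = 0, then p(z) times the resolvent is the divided difference of p, so each entry
  of the resolvent is an entire function divided by p(z).\<close>

lemma holomorphic_resolvent:
  assumes x: "x \<in> carrier_mat n n" and ij: "i < n" "j < n"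
  shows "(\<lambda>z. resolvent x z $$ (i, j)) holomorphic_on - spectrum x"
proof -
  obtain as where as: "set as = spectrum x" "peval (\<Prod>a\<leftarrow>as. [:- a, 1:]) x = 0\<^sub>m n n"
    by (rule annihilating_polynomial[OF x])
  let ?p = "\<Prod>a\<leftarrow>as. [:- a, 1:]"
  obtain N where N: "\<And>z. N z x \<in> carrier_mat n n"
    "\<And>z. poly ?p z \<cdot>\<^sub>m 1\<^sub>m n - peval ?p x = N z x * (z \<cdot>\<^sub>m 1\<^sub>m n - x)"
    "\<And>i j. i < n \<Longrightarrow> j < n \<Longrightarrow> (\<lambda>z. N z x $$ (i, j)) holomorphic_on UNIV"
    using divided_difference[of ?p] x by metis
  have p: "poly ?p z \<noteq> 0" if "z \<notin> spectrum x" for z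
    using that as(1) by (auto simp: poly_prod_list o_def prod_list_zero_iff)
  have "resolvent x z $$ (i, j) = N z x $$ (i, j) / poly ?p z" if z: "z \<notin> spectrum x" for z
  proof -
    have "poly ?p z \<cdot>\<^sub>m resolvent x z = 0\<^sub>m n n * resolvent x z + N z x"
      using divided_difference_resolvent[OF x z N(1) N(2)] as(2) by simp
    also have "\<dots> = N z x" using resolvent(1)[OF x z] N(1) by simp
    finally have "poly ?p z * resolvent x z $$ (i, j) = N z x $$ (i, j)"
      using ij resolvent(1)[OF x z] by (metis carrier_matD index_smult_mat(1))
    then show ?thesis using p[OF z] by (simp add: field_simps)
  qed
  moreover have "(\<lambda>z. N z x $$ (i, j) / poly ?p z) holomorphic_on - spectrum x"
    using p by (intro holomorphic_on_divide holomorphic_on_subset[OF N(3)] ij) (auto intro!: holomorphic_intros)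
  ultimately show ?thesis by (metis (no_types, lifting) Compl_iff holomorphic_cong)
qed

section \<open>Residues of functions times the resolvent\<close>

lemma residue_sum:
  assumes "open s" "z \<in> s" "finite K" "\<And>k. k \<in> K \<Longrightarrow> F k holomorphic_on s - {z}"
  shows "residue (\<lambda>z. \<Sum>k\<in>K. c k * F k z) z = (\<Sum>k\<in>K. c k * residue (F k) z)"
  using assms(3,4)
proof (induction K)
  case empty
  then show ?case by (simp add: residue_const)
next
  case (insert k K)
  have "residue (\<lambda>z. c k * F k z + (\<Sum>k\<in>K. c k * F k z)) z
      = residue (\<lambda>z. c k * F k z) z + residue (\<lambda>z. \<Sum>k\<in>K. c k * F k z) z"
    using insert by (intro residue_add[OF assms(1,2)] holomorphic_intros) auto
  then show ?case using insert by (simp add: residue_lmul[OF assms(1,2)])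
qed

text \<open>With R the resolvent, the divided differences N of q and P of p give q(z) R = q(x) R + N
  and p(z) R = P. Hence f R = q(x) R + (N + g P), where the bracket is holomorphic on A and
  contributes no residue.\<close>

lemma residue_hol_calc_entry:
  assumes x: "x \<in> carrier_mat n n" and A: "open A" "spectrum x \<subseteq> A" and g: "g holomorphic_on A"
    and p: "peval p x = 0\<^sub>m n n" and f: "\<And>z. z \<in> A \<Longrightarrow> f z = poly q z + poly p z * g z"
    and l: "l \<in> spectrum x" and ij: "i < n" "j < n"
  shows "residue (\<lambda>z. f z * resolvent x z $$ (i, j)) l
    = (\<Sum>k<n. peval q x $$ (i, k) * residue (\<lambda>z. resolvent x z $$ (k, j)) l)"
proof -
  obtain N where N: "\<And>z. N z x \<in> carrier_mat n n"
    "\<And>z. poly q z \<cdot>\<^sub>m 1\<^sub>m n - peval q x = N z x * (z \<cdot>\<^sub>m 1\<^sub>m n - x)"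
    "\<And>i j. i < n \<Longrightarrow> j < n \<Longrightarrow> (\<lambda>z. N z x $$ (i, j)) holomorphic_on UNIV"
    using divided_difference[of q] x by metis
  obtain P where P: "\<And>z. P z x \<in> carrier_mat n n"
    "\<And>z. poly p z \<cdot>\<^sub>m 1\<^sub>m n - peval p x = P z x * (z \<cdot>\<^sub>m 1\<^sub>m n - x)"
    "\<And>i j. i < n \<Longrightarrow> j < n \<Longrightarrow> (\<lambda>z. P z x $$ (i, j)) holomorphic_on UNIV"
    using divided_difference[of p] x by metis
  define h where "h = (\<lambda>z. N z x $$ (i, j) + g z * P z x $$ (i, j))"
  have hh: "h holomorphic_on A"
    unfolding h_def using ij g by (intro holomorphic_intros holomorphic_on_subset[OF N(3)] holomorphic_on_subset[OF P(3)]) auto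
  \<comment> \<open>The other eigenvalues are removed, so that l is the only singularity
    left.\<close>
  define B where "B = A - (spectrum x - {l})"
  have B: "open B" "l \<in> B" "B - {l} = A - spectrum x" "B \<subseteq> A"
    using A l finite_spectrum[OF x] by (auto simp: B_def intro!: open_Diff finite_imp_closed)
  have eq: "f z * resolvent x z $$ (i, j)
      = (\<Sum>k<n. peval q x $$ (i, k) * resolvent x z $$ (k, j)) + h z" if z: "z \<in> B - {l}" for z
  proof -
    have zs: "z \<notin> spectrum x" "z \<in> A" using z B by auto
    let ?R = "resolvent x z"
    note R = resolvent(1)[OF x zs(1)]
    have Q: "peval q x \<in> carrier_mat n n" using x by simp
    have "poly q z \<cdot>\<^sub>m ?R = peval q x * ?R + N z x"
      by (rule divided_difference_resolvent[OF x zs(1) N(1) N(2)]) (use x in simp)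
    from arg_cong[OF this, of "\<lambda>M. M $$ (i, j)"]
    have 1: "poly q z * ?R $$ (i, j) = (\<Sum>k<n. peval q x $$ (i, k) * ?R $$ (k, j)) + N z x $$ (i, j)"
      using ij R N(1)[of z] carrier_matD[OF Q] by (simp add: scalar_prod_def atLeast0LessThan)
    have "poly p z \<cdot>\<^sub>m ?R = 0\<^sub>m n n * ?R + P z x"
      using divided_difference_resolvent[OF x zs(1) P(1) P(2)] p by simp
    also have "\<dots> = P z x" using R P(1) by simp
    finally have 2: "poly p z * ?R $$ (i, j) = P z x $$ (i, j)"
      using ij R by (metis carrier_matD index_smult_mat(1))
    have "f z * ?R $$ (i, j) = poly q z * ?R $$ (i, j) + g z * (poly p z * ?R $$ (i, j))"
      by (simp add: f[OF zs(2)] algebra_simps)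
    then show ?thesis unfolding 1 2 h_def by simp
  qed
  have hR: "(\<lambda>z. resolvent x z $$ (k, j)) holomorphic_on B - {l}" if "k < n" for k
    using holomorphic_on_subset[OF holomorphic_resolvent[OF x that ij(2)]] B by auto
  have "residue (\<lambda>z. f z * resolvent x z $$ (i, j)) l
      = residue (\<lambda>z. (\<Sum>k<n. peval q x $$ (i, k) * resolvent x z $$ (k, j)) + h z) l"
  proof (rule residue_cong)
    show "\<forall>\<^sub>F z in at l. f z * resolvent x z $$ (i, j)
        = (\<Sum>k<n. peval q x $$ (i, k) * resolvent x z $$ (k, j)) + h z"
      unfolding eventually_at_topological using B eq by blast
  qed simp
  also have "\<dots> = residue (\<lambda>z. \<Sum>k<n. peval q x $$ (i, k) * resolvent x z $$ (k, j)) l + residue h l"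
    using hR hh B by (intro residue_add[OF B(1,2)] holomorphic_intros) (auto intro: holomorphic_on_subset)
  also have "residue h l = 0"
    by (rule residue_holo[OF B(1,2)]) (use hh B in \<open>auto intro: holomorphic_on_subset\<close>)
  also have "residue (\<lambda>z. \<Sum>k<n. peval q x $$ (i, k) * resolvent x z $$ (k, j)) l
      = (\<Sum>k<n. peval q x $$ (i, k) * residue (\<lambda>z. resolvent x z $$ (k, j)) l)"
    by (rule residue_sum[OF B(1,2)]) (use hR in auto)
  finally show ?thesis by simp
qed

lemma residue_theorem_circle:
  assumes r: "0 < r" "r < R" and h: "h holomorphic_on ball c R - pts" and pts: "finite pts" "pts \<subseteq> ball c r"
  shows "contour_integral (circlepath c r) h = 2 * pi * \<i> * (\<Sum>p\<in>pts. residue h p)"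
proof -
  have "contour_integral (circlepath c r) h
      = 2 * pi * \<i> * (\<Sum>p\<in>pts. winding_number (circlepath c r) p * residue h p)"
  proof (rule Residue_theorem[OF _ _ pts(1) h])
    show "path_image (circlepath c r) \<subseteq> ball c R - pts"
      using r pts by (auto simp: path_image_circlepath)
    show "\<forall>z. z \<notin> ball c R \<longrightarrow> winding_number (circlepath c r) z = 0"
      using r by (auto intro!: winding_number_zero_outside[of _ "cball c r"] simp: path_image_circlepath)
  qed auto
  also have "(\<Sum>p\<in>pts. winding_number (circlepath c r) p * residue h p) = (\<Sum>p\<in>pts. residue h p)"
  proof (intro sum.cong refl)
    fix p assume "p \<in> pts"
    then have "cmod (p - c) < r" using pts(2) by (auto simp: dist_norm norm_minus_commute)
    then show "winding_number (circlepath c r) p * residue h p = residue h p"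
      by (simp add: winding_number_circlepath)
  qed
  finally show ?thesis .
qed

lemma residue_theorem_circle_bound:
  assumes r: "0 < r" "r < R" and h: "h holomorphic_on ball c R - pts" and pts: "finite pts" "pts \<subseteq> ball c r"
    and B: "0 \<le> B" "\<And>z. cmod (z - c) = r \<Longrightarrow> cmod (h z) \<le> B"
  shows "cmod (\<Sum>p\<in>pts. residue h p) \<le> B * r"
proof -
  have "h contour_integrable_on circlepath c r"
  proof (rule contour_integrable_holomorphic_simple)
    show "h holomorphic_on ball c R - pts" by (rule h)
    show "open (ball c R - pts)" using pts by (auto intro!: open_Diff finite_imp_closed)
  qed (use r pts in \<open>auto simp: path_image_circlepath\<close>)
  then have "cmod (contour_integral (circlepath c r) h) \<le> B * (2 * pi * r)"
    using has_contour_integral_bound_circlepath[OF has_contour_integral_integral] r B by simp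
  then have "2 * pi * cmod (\<Sum>p\<in>pts. residue h p) \<le> 2 * pi * (B * r)"
    by (simp add: residue_theorem_circle[OF r h pts] norm_mult mult.commute)
  then show ?thesis by simp
qed

section \<open>The holomorphic functional calculus\<close>

text \<open>A substitute for the Neumann series: u = R v satisfies z u = v + x u, hence (|z| -
  ||x||) ||u|| <= ||v||.\<close>

lemma resolvent_norm_le:
  assumes x: "x \<in> carrier_mat n n" and z: "mat_norm x < cmod z"
  shows "z \<notin> spectrum x" "mat_norm (resolvent x z) \<le> 1 / (cmod z - mat_norm x)"
proof -
  show zs: "z \<notin> spectrum x"
    using spectrum_bound[OF x, of z "[:0, 1:]"] z by (auto simp: peval_X[OF x])
  let ?R = "resolvent x z"
  note R = resolvent[OF x zs]
  show "mat_norm ?R \<le> 1 / (cmod z - mat_norm x)"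
  proof (rule mat_norm_le)
    show "0 \<le> 1 / (cmod z - mat_norm x)" using z by simp
    fix v :: "complex vec" assume "v \<in> carrier_vec (dim_col ?R)"
    then have v: "v \<in> carrier_vec n" using R(1) by simp
    define u where "u = ?R *\<^sub>v v"
    have u: "u \<in> carrier_vec n" using R(1) v by (simp add: u_def)
    have Z: "z \<cdot>\<^sub>m 1\<^sub>m n - x \<in> carrier_mat n n" using x by auto
    have "v = (z \<cdot>\<^sub>m 1\<^sub>m n - x) *\<^sub>v u"
      using assoc_mult_mat_vec[OF Z R(1) v] R(2) v by (simp add: u_def)
    also have "\<dots> = z \<cdot>\<^sub>v u - x *\<^sub>v u"
      using minus_mult_distrib_mat_vec[of "z \<cdot>\<^sub>m 1\<^sub>m n" n n x u] x u by (simp add: smult_mat_vec)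
    finally have vz: "v = z \<cdot>\<^sub>v u - x *\<^sub>v u" .
    have "z \<cdot>\<^sub>v u = (z \<cdot>\<^sub>v u - x *\<^sub>v u) + x *\<^sub>v u" using u x by (intro eq_vecI) auto
    then have "z \<cdot>\<^sub>v u = v + x *\<^sub>v u" by (simp only: vz[symmetric])
    then have "cmod z * vnorm u \<le> vnorm v + vnorm (x *\<^sub>v u)"
      using vnorm_add_le[OF v, of "x *\<^sub>v u"] x u by (metis mult_mat_vec_carrier vnorm_smult)
    also have "vnorm (x *\<^sub>v u) \<le> mat_norm x * vnorm u" using x u by (intro vnorm_mult_le) auto
    finally have "(cmod z - mat_norm x) * vnorm u \<le> vnorm v" by (simp add: algebra_simps)
    then show "vnorm (?R *\<^sub>v v) \<le> 1 / (cmod z - mat_norm x) * vnorm v"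
      using z by (simp add: u_def[symmetric] pos_le_divide_eq mult.commute)
  qed
qed

text \<open>The residues of \<open>R(z) = 1/z + x R(z)/z\<close> add up to \<open>1\<close>, since the second summand is
  \<open>O(z\<^sup>-\<^sup>2)\<close>.\<close>

lemma sum_residue_resolvent:
  assumes x: "x \<in> carrier_mat n n" and ij: "i < n" "j < n"
  shows "(\<Sum>l\<in>spectrum x. residue (\<lambda>z. resolvent x z $$ (i, j)) l) = (if i = j then 1 else 0)"
proof -
  \<comment> \<open>Division by z in \<open>h\<close> may create a pole at 0, whether or not 0 is an
    eigenvalue.\<close>
  define T where "T = insert 0 (spectrum x)"
  define a where "a = mat_norm x"
  define d :: complex where "d = (if i = j then 1 else 0)"
  define h where "h = (\<lambda>z. (\<Sum>k<n. x $$ (i, k) * resolvent x z $$ (k, j)) / z)"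
  have fT: "finite T" using finite_spectrum[OF x] by (simp add: T_def)
  have a0: "0 \<le> a" by (simp add: a_def)
  have holR: "(\<lambda>z. resolvent x z $$ (k, j)) holomorphic_on - T" if "k < n" for k
    by (rule holomorphic_on_subset[OF holomorphic_resolvent[OF x that ij(2)]]) (auto simp: T_def)
  have holh: "h holomorphic_on - T"
    unfolding h_def by (intro holomorphic_intros holR) (auto simp: T_def)
  have Tball: "T \<subseteq> cball 0 a"
    using spectrum_bound[OF x, of _ "[:0, 1:]"] a0 by (auto simp: T_def a_def peval_X[OF x])
  have bound: "cmod (\<Sum>l\<in>T. residue h l) \<le> a / (\<rho> - a)" if \<rho>: "\<rho> > a" for \<rho>
  proof -
    have "cmod (\<Sum>l\<in>T. residue h l) \<le> (a / (\<rho> - a) / \<rho>) * \<rho>"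
    proof (rule residue_theorem_circle_bound[where c = 0 and R = "\<rho> + 1"])
      show "h holomorphic_on ball 0 (\<rho> + 1) - T" by (rule holomorphic_on_subset[OF holh]) auto
      show "0 \<le> a / (\<rho> - a) / \<rho>" using \<rho> a0 by simp
      fix z assume "cmod (z - 0) = \<rho>"
      then have z: "cmod z = \<rho>" by simp
      note R = resolvent_norm_le[OF x, of z]
      have zs: "z \<notin> spectrum x" using R \<rho> z by (simp add: a_def)
      note Rc = resolvent(1)[OF x zs]
      have "(\<Sum>k<n. x $$ (i, k) * resolvent x z $$ (k, j)) = (x * resolvent x z) $$ (i, j)"
        using x Rc ij by (simp add: scalar_prod_def atLeast0LessThan)
      then have "cmod (\<Sum>k<n. x $$ (i, k) * resolvent x z $$ (k, j)) \<le> mat_norm (x * resolvent x z)"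
        using index_mat_norm_le[of i "x * resolvent x z" j] x Rc ij by simp
      also have "\<dots> \<le> a * mat_norm (resolvent x z)"
        unfolding a_def by (rule mat_norm_mult_le[OF x Rc])
      also have "\<dots> \<le> a * (1 / (\<rho> - a))"
        using R(2) \<rho> z a0 by (intro mult_left_mono) (auto simp: a_def)
      finally show "cmod (h z) \<le> a / (\<rho> - a) / \<rho>"
        using z a0 \<rho> divide_right_mono[of _ "a / (\<rho> - a)" \<rho>] by (simp add: h_def norm_divide)
    qed (use \<rho> a0 fT Tball in auto)
    then show ?thesis using \<rho> a0 by simp
  qed
  have sum0: "(\<Sum>l\<in>T. residue h l) = 0"
  proof (rule ccontr)
    define S where "S = cmod (\<Sum>l\<in>T. residue h l)"
    assume "(\<Sum>l\<in>T. residue h l) \<noteq> 0"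
    then have S: "S > 0" by (simp add: S_def)
    \<comment> \<open>At this radius the bound equals S a / (a + 1), which is less than S.\<close>
    have "a + (a + 1) / S > a" using S a0 by simp
    from bound[OF this] have "S \<le> a / (a + (a + 1) / S - a)" by (simp only: S_def)
    also have "\<dots> = S * (a / (a + 1))" using S by simp
    also have "\<dots> < S * 1" using S a0 by (intro mult_strict_left_mono) auto
    finally show False by simp
  qed
  have "(\<Sum>l\<in>spectrum x. residue (\<lambda>z. resolvent x z $$ (i, j)) l)
      = (\<Sum>l\<in>T. residue (\<lambda>z. resolvent x z $$ (i, j)) l)"
  proof (rule sum.mono_neutral_left[OF fT])
    show "\<forall>l\<in>T - spectrum x. residue (\<lambda>z. resolvent x z $$ (i, j)) l = 0"
      using finite_spectrum[OF x]
      by (intro ballI residue_holo[OF _ _ holomorphic_resolvent[OF x ij]])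
         (auto intro: finite_imp_closed)
  qed (auto simp: T_def)
  also have "\<dots> = (\<Sum>l\<in>T. residue (\<lambda>z. d / z) l + residue h l)"
  proof (rule sum.cong[OF refl])
    fix l assume l: "l \<in> T"
    define B where "B = - (T - {l})"
    have "closed (T - {l})" using fT by (intro finite_imp_closed) auto
    then have B: "open B" "l \<in> B" "B - {l} = - T"
      using l unfolding B_def by (simp_all only: open_Compl) auto
    have "resolvent x z $$ (i, j) = d / z + h z" if "z \<in> B - {l}" for z
    proof -
      have z: "z \<notin> spectrum x" "z \<noteq> 0" using that B by (auto simp: T_def)
      note R = resolvent[OF x z(1)]
      have "z \<cdot>\<^sub>m resolvent x z = x * resolvent x z + 1\<^sub>m n"
        using minus_mult_distrib_mat[of "z \<cdot>\<^sub>m 1\<^sub>m n" n n x "resolvent x z" n]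
          divided_difference_resolvent[OF x z(1) one_carrier_mat _ x, of z] x by auto
      from arg_cong[OF this, of "\<lambda>M. M $$ (i, j)"]
      have "z * resolvent x z $$ (i, j) = (\<Sum>k<n. x $$ (i, k) * resolvent x z $$ (k, j)) + d"
        using ij R x by (simp add: scalar_prod_def atLeast0LessThan d_def)
      then show ?thesis using z by (simp add: h_def field_simps)
    qed
    then have "residue (\<lambda>z. resolvent x z $$ (i, j)) l = residue (\<lambda>z. d / z + h z) l"
      using B by (intro residue_cong refl) (auto simp: eventually_at_topological intro!: exI[of _ B])
    also have "\<dots> = residue (\<lambda>z. d / z) l + residue h l"
      using holh B(3) by (intro residue_add[OF B(1,2)]) (auto simp: T_def intro!: holomorphic_intros)
    finally show "residue (\<lambda>z. resolvent x z $$ (i, j)) l = residue (\<lambda>z. d / z) l + residue h l" .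
  qed
  also have "\<dots> = (\<Sum>l\<in>T. residue (\<lambda>z. d / z) l)" by (simp add: sum.distrib sum0)
  also have "\<dots> = (\<Sum>l\<in>{0}. residue (\<lambda>z. d / z) l)"
  proof (rule sum.mono_neutral_right[OF fT])
    show "\<forall>l\<in>T - {0}. residue (\<lambda>z. d / z) l = 0"
      by (intro ballI residue_holo[of "- {0}"]) (auto intro!: holomorphic_intros)
  qed (auto simp: T_def)
  also have "\<dots> = d" using residue_simple[of UNIV 0 "\<lambda>_. d"] by simp
  finally show ?thesis by (simp add: d_def)
qed

lemma hol_calc_carrier [simp]: "x \<in> carrier_mat n n \<Longrightarrow> hol_calc f x \<in> carrier_mat n n"
  by (simp add: hol_calc_def)

text \<open>Each residue of f times the resolvent is q(x) times the residue of the resolvent, and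
  these residues add up to the identity. The algebraic rules for \<open>hol_calc\<close> are derived
  from this reduction.\<close>

theorem hol_calc_eq_peval:
  assumes x: "x \<in> carrier_mat n n" and A: "open A" "spectrum x \<subseteq> A" and g: "g holomorphic_on A"
    and p: "peval p x = 0\<^sub>m n n" and f: "\<And>z. z \<in> A \<Longrightarrow> f z = poly q z + poly p z * g z"
  shows "hol_calc f x = peval q x"
proof (rule eq_matI)
  have Q: "peval q x \<in> carrier_mat n n" using x by simp
  show "dim_row (hol_calc f x) = dim_row (peval q x)" "dim_col (hol_calc f x) = dim_col (peval q x)"
    using carrier_matD[OF Q] x by (auto simp: hol_calc_def)
  fix i j assume "i < dim_row (peval q x)" "j < dim_col (peval q x)"
  then have ij: "i < n" "j < n" using Q by auto
  have "hol_calc f x $$ (i, j) = (\<Sum>l\<in>spectrum x. residue (\<lambda>z. f z * resolvent x z $$ (i, j)) l)"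
    using x ij by (simp add: hol_calc_def resolvent_def)
  also have "\<dots> = (\<Sum>l\<in>spectrum x. \<Sum>k<n. peval q x $$ (i, k) * residue (\<lambda>z. resolvent x z $$ (k, j)) l)"
    by (intro sum.cong refl residue_hol_calc_entry[OF x A g p f _ ij])
  also have "\<dots> = (\<Sum>k<n. peval q x $$ (i, k) * (\<Sum>l\<in>spectrum x. residue (\<lambda>z. resolvent x z $$ (k, j)) l))"
    unfolding sum_distrib_left by (rule sum.swap)
  also have "\<dots> = (\<Sum>k<n. if k = j then peval q x $$ (i, k) else 0)"
    by (intro sum.cong refl) (simp add: sum_residue_resolvent[OF x _ ij(2)])
  also have "\<dots> = peval q x $$ (i, j)" using ij by simp
  finally show "hol_calc f x $$ (i, j) = peval q x $$ (i, j)" .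
qed

text \<open>The roots are divided out one at a time, (f(z) - f(a)) / (z - a) having a removable
  singularity at a. If a lies outside A, the quotient is holomorphic on A in any case.\<close>

lemma holomorphic_division:
  assumes A: "open A" and f: "f holomorphic_on A"
  obtains q g where "g holomorphic_on A" "\<And>z. z \<in> A \<Longrightarrow> f z = poly q z + poly (\<Prod>a\<leftarrow>as. [:- a, 1:]) z * g z"
  using f
proof (induction as arbitrary: f thesis)
  case Nil
  show ?case by (rule Nil(1)[of f 0]) (use Nil in auto)
next
  case (Cons a as)
  let ?h = "\<lambda>z. if z = a then deriv f a else (f z - f a) / (z - a)"
  obtain q g where g: "g holomorphic_on A"
    "\<And>z. z \<in> A \<Longrightarrow> ?h z = poly q z + poly (\<Prod>a\<leftarrow>as. [:- a, 1:]) z * g z"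
    using Cons.IH[OF _ pole_lemma_open[OF Cons.prems(2) A]] by blast
  show ?case
  proof (rule Cons.prems(1)[OF g(1), of "[:f a:] + [:- a, 1:] * q"])
    fix z assume z: "z \<in> A"
    have "f z = f a + (z - a) * ?h z" by auto
    then show "f z = poly ([:f a:] + [:- a, 1:] * q) z + poly (\<Prod>a\<leftarrow>a # as. [:- a, 1:]) z * g z"
      unfolding g(2)[OF z] by (simp add: algebra_simps)
  qed
qed

text \<open>Modulo holomorphic multiples of p, the functions f and g are polynomials q1 and q2. The
  cofactor for the product is read off from f g - q1 q2 = f (g - q2) + (f - q1) q2.\<close>

lemma hol_calc_mult:
  assumes x: "x \<in> carrier_mat n n" and A: "open A" "spectrum x \<subseteq> A"
    and f: "f holomorphic_on A" and g: "g holomorphic_on A"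
  shows "hol_calc (\<lambda>z. f z * g z) x = hol_calc f x * hol_calc g x"
proof -
  obtain as where "peval (\<Prod>a\<leftarrow>as. [:- a, 1:]) x = 0\<^sub>m n n" by (rule annihilating_polynomial[OF x])
  moreover define p where "p = (\<Prod>a\<leftarrow>as. [:- a, 1:])"
  ultimately have p: "peval p x = 0\<^sub>m n n" by simp
  obtain q1 g1 where 1: "g1 holomorphic_on A" "\<And>z. z \<in> A \<Longrightarrow> f z = poly q1 z + poly p z * g1 z"
    by (rule holomorphic_division[OF A(1) f, of as, folded p_def]) (rule that)
  obtain q2 g2 where 2: "g2 holomorphic_on A" "\<And>z. z \<in> A \<Longrightarrow> g z = poly q2 z + poly p z * g2 z"
    by (rule holomorphic_division[OF A(1) g, of as, folded p_def]) (rule that)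
  have "hol_calc (\<lambda>z. f z * g z) x = peval (q1 * q2) x"
  proof (rule hol_calc_eq_peval[OF x A _ p])
    show "(\<lambda>z. g1 z * poly q2 z + f z * g2 z) holomorphic_on A"
      using 1 2 f by (intro holomorphic_intros) auto
    show "f z * g z = poly (q1 * q2) z + poly p z * (g1 z * poly q2 z + f z * g2 z)" if "z \<in> A" for z
      using 1(2)[OF that] 2(2)[OF that] by (simp add: algebra_simps)
  qed
  then show ?thesis
    using hol_calc_eq_peval[OF x A 1(1) p 1(2)] hol_calc_eq_peval[OF x A 2(1) p 2(2)]
    by (simp add: peval_mult[OF x])
qed

lemma hol_calc_poly:
  assumes x: "x \<in> carrier_mat n n" and A: "open A" "spectrum x \<subseteq> A" and f: "\<And>z. z \<in> A \<Longrightarrow> f z = poly q z"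
  shows "hol_calc f x = peval q x"
  by (rule hol_calc_eq_peval[OF x A, of "\<lambda>_. 0" 0]) (use x f in \<open>auto simp: peval_0\<close>)

lemma hol_calc_cong:
  assumes x: "x \<in> carrier_mat n n" and A: "open A" "spectrum x \<subseteq> A" and f: "f holomorphic_on A"
    and fg: "\<And>z. z \<in> A \<Longrightarrow> g z = f z"
  shows "hol_calc g x = hol_calc f x"
proof -
  obtain as where p: "peval (\<Prod>a\<leftarrow>as. [:- a, 1:]) x = 0\<^sub>m n n" by (rule annihilating_polynomial[OF x])
  obtain q h where q: "h holomorphic_on A" "\<And>z. z \<in> A \<Longrightarrow> f z = poly q z + poly (\<Prod>a\<leftarrow>as. [:- a, 1:]) z * h z"
    by (rule holomorphic_division[OF A(1) f, of as]) (rule that)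
  show ?thesis
    using hol_calc_eq_peval[OF x A q(1) p q(2)] hol_calc_eq_peval[OF x A q(1) p, of g q] fg q(2) by simp
qed

lemma hol_calc_uminus:
  assumes x: "x \<in> carrier_mat n n" and A: "open A" "spectrum x \<subseteq> A" and f: "f holomorphic_on A"
  shows "hol_calc (\<lambda>z. - f z) x = - hol_calc f x"
proof -
  have "hol_calc (\<lambda>z. (- 1) * f z) x = hol_calc (\<lambda>z. - 1) x * hol_calc f x"
    by (rule hol_calc_mult[OF x A _ f]) simp
  also have "hol_calc (\<lambda>z. - 1) x = (- 1) \<cdot>\<^sub>m 1\<^sub>m n"
    using hol_calc_poly[OF x A, of "\<lambda>_. - 1" "[:- 1:]"] by (simp add: peval_const[OF x])
  also have "((- 1) \<cdot>\<^sub>m 1\<^sub>m n) * hol_calc f x = - hol_calc f x"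
    using x by (simp add: mult_smult_one[of _ n]) (auto intro!: eq_matI)
  finally show ?thesis by simp
qed

text \<open>A polynomial that annihilates x \<oplus> y annihilates both summands, so a single
  remainder q computes all three values.\<close>

lemma hol_calc_dsum:
  assumes x: "x \<in> carrier_mat n n" and y: "y \<in> carrier_mat m m"
    and A: "open A" "spectrum x \<subseteq> A" "spectrum y \<subseteq> A" and f: "f holomorphic_on A"
  shows "hol_calc f (dsum_mat x y) = dsum_mat (hol_calc f x) (hol_calc f y)"
proof -
  have s: "spectrum (dsum_mat x y) \<subseteq> A" using A by (simp add: spectrum_dsum[OF x y])
  obtain as where p: "peval (\<Prod>a\<leftarrow>as. [:- a, 1:]) (dsum_mat x y) = 0\<^sub>m (n + m) (n + m)"
    by (rule annihilating_polynomial[OF dsum_carrier[OF x y]])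
  let ?p = "\<Prod>a\<leftarrow>as. [:- a, 1:]"
  have "dsum_mat (peval ?p x) (peval ?p y) = dsum_mat (0\<^sub>m n n) (0\<^sub>m m m)"
    using p by (simp add: peval_dsum[OF x y] dsum_zero)
  then have px: "peval ?p x = 0\<^sub>m n n" and py: "peval ?p y = 0\<^sub>m m m"
    using x y dsum_inject[of _ n _ m] by auto
  obtain q h where q: "h holomorphic_on A" "\<And>z. z \<in> A \<Longrightarrow> f z = poly q z + poly ?p z * h z"
    by (rule holomorphic_division[OF A(1) f, of as]) (rule that)
  show ?thesis
    using hol_calc_eq_peval[OF dsum_carrier[OF x y] A(1) s q(1) p q(2)]
      hol_calc_eq_peval[OF x A(1,2) q(1) px q(2)] hol_calc_eq_peval[OF y A(1,3) q(1) py q(2)]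
    by (simp add: peval_dsum[OF x y])
qed

lemma hol_calc_similar:
  assumes c: "B \<in> carrier_mat n n" "P \<in> carrier_mat n n" "Q \<in> carrier_mat n n"
    and QP: "Q * P = 1\<^sub>m n" and PQ: "P * Q = 1\<^sub>m n"
    and A: "open A" "spectrum B \<subseteq> A" and f: "f holomorphic_on A"
  shows "hol_calc f (P * B * Q) = P * hol_calc f B * Q"
proof -
  have x: "P * B * Q \<in> carrier_mat n n" using c by auto
  have s: "spectrum (P * B * Q) \<subseteq> A" using A by (simp add: spectrum_similar[OF c QP PQ])
  obtain as where p: "peval (\<Prod>a\<leftarrow>as. [:- a, 1:]) B = 0\<^sub>m n n"
    by (rule annihilating_polynomial[OF c(1)])
  let ?p = "\<Prod>a\<leftarrow>as. [:- a, 1:]"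
  have px: "peval ?p (P * B * Q) = 0\<^sub>m n n"
    unfolding peval_similar[OF c QP PQ] p using c by simp
  obtain q h where q: "h holomorphic_on A" "\<And>z. z \<in> A \<Longrightarrow> f z = poly q z + poly ?p z * h z"
    by (rule holomorphic_division[OF A(1) f, of as]) (rule that)
  show ?thesis
    using hol_calc_eq_peval[OF x A(1) s q(1) px q(2)] hol_calc_eq_peval[OF c(1) A q(1) p q(2)]
    by (simp add: peval_similar[OF c QP PQ])
qed

section \<open>Bounds for the functional calculus, uniform in the matrix size\<close>

text \<open>The doubled radius leaves room around each closed disc for the residue theorem. The
  factor 4 makes the doubled discs disjoint, so that a circle about one centre stays away from the
  spectrum gathered at the others.\<close>

lemma separating_radius:
  assumes C: "finite (C :: complex set)" "C \<subseteq> A" and A: "open A"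
  obtains \<rho> where "\<rho> > 0" "\<And>c. c \<in> C \<Longrightarrow> ball c (2 * \<rho>) \<subseteq> A"
    "\<And>c d. c \<in> C \<Longrightarrow> d \<in> C \<Longrightarrow> c \<noteq> d \<Longrightarrow> 4 * \<rho> \<le> dist c d"
proof -
  have "\<exists>e>0. ball c (2 * e) \<subseteq> A \<and> (\<forall>d\<in>C. d \<noteq> c \<longrightarrow> 4 * e \<le> dist c d)" if c: "c \<in> C" for c
  proof -
    obtain e1 where e1: "e1 > 0" "ball c e1 \<subseteq> A" using A C c by (meson openE subsetD)
    obtain e2 where e2: "e2 > 0" "\<forall>d\<in>C. d \<noteq> c \<longrightarrow> e2 \<le> dist c d"
      using finite_set_avoid[OF C(1)] by blast
    show ?thesis using e1 e2 by (intro exI[of _ "min e1 e2 / 4"]) auto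
  qed
  then obtain e where e: "\<And>c. c \<in> C \<Longrightarrow> e c > 0 \<and> ball c (2 * e c) \<subseteq> A \<and> (\<forall>d\<in>C. d \<noteq> c \<longrightarrow> 4 * e c \<le> dist c d)"
    by metis
  define \<rho> where "\<rho> = Min (insert 1 (e ` C))"
  have "\<rho> > 0" using C e by (auto simp: \<rho>_def)
  moreover have le: "\<rho> \<le> e c" if "c \<in> C" for c using C that by (auto simp: \<rho>_def intro!: Min_le)
  moreover have "ball c (2 * \<rho>) \<subseteq> A" if "c \<in> C" for c
    using e[OF that] le[OF that] subset_ball[of "2 * \<rho>" "2 * e c" c] by auto
  moreover have "4 * \<rho> \<le> dist c d" if "c \<in> C" "d \<in> C" "c \<noteq> d" for c d
    using e[OF that(1)] le[OF that(1)] that by fastforce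
  ultimately show ?thesis using that[of \<rho>] by blast
qed

lemma cmod_poly_roots_ge:
  assumes "0 \<le> \<rho>" "\<And>a. a \<in> set as \<Longrightarrow> \<rho> \<le> cmod (z - a)"
  shows "\<rho> ^ length as \<le> cmod (poly (\<Prod>a\<leftarrow>as. [:- a, 1:]) z)"
  using assms(2)
proof (induction as)
  case (Cons a as)
  have "\<rho> * \<rho> ^ length as \<le> cmod (z - a) * cmod (poly (\<Prod>a\<leftarrow>as. [:- a, 1:]) z)"
    using Cons assms(1) by (intro mult_mono) auto
  then show ?case by (simp add: norm_mult[symmetric] algebra_simps)
qed simp

text \<open>In p(z) R = p(y) R + N, with R the resolvent, the first term on the right has at most
  half the norm of the left-hand side and is absorbed.\<close>

lemma resolvent_norm_le_poly:
  assumes y: "y \<in> carrier_mat n n" and z: "z \<notin> spectrum y"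
    and N: "N \<in> carrier_mat n n" "poly p z \<cdot>\<^sub>m 1\<^sub>m n - peval p y = N * (z \<cdot>\<^sub>m 1\<^sub>m n - y)" "mat_norm N \<le> K"
    and e: "0 < e" "2 * e \<le> cmod (poly p z)" "mat_norm (peval p y) \<le> e"
  shows "mat_norm (resolvent y z) \<le> K / e"
proof -
  let ?R = "resolvent y z"
  note R = resolvent(1)[OF y z]
  have Q: "peval p y \<in> carrier_mat n n" using y by simp
  have "poly p z \<cdot>\<^sub>m ?R = peval p y * ?R + N"
    by (rule divided_difference_resolvent[OF y z N(1,2) Q])
  then have "cmod (poly p z) * mat_norm ?R = mat_norm (peval p y * ?R + N)"
    by (simp flip: mat_norm_smult)
  also have "\<dots> \<le> mat_norm (peval p y * ?R) + mat_norm N"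
    using mult_carrier_mat[OF Q R] N(1) by (rule mat_norm_add_le)
  also have "\<dots> \<le> e * mat_norm ?R + K"
    using mat_norm_mult_le[OF Q R] mult_right_mono[OF e(3) mat_norm_nonneg[of ?R]] N(3) by linarith
  finally have "cmod (poly p z) * mat_norm ?R \<le> e * mat_norm ?R + K" .
  moreover have "2 * e * mat_norm ?R \<le> cmod (poly p z) * mat_norm ?R"
    using e by (intro mult_right_mono) auto
  ultimately have "e * mat_norm ?R \<le> K" by linarith
  then show ?thesis using e by (simp add: pos_le_divide_eq mult.commute)
qed

lemma cmod_scalar_prod_le:
  assumes "u \<in> carrier_vec n" "w \<in> carrier_vec n"
  shows "cmod (\<Sum>i<n. vec_index w i * vec_index u i) \<le> vnorm w * vnorm u"
proof -
  have "cmod (\<Sum>i<n. vec_index w i * vec_index u i) \<le> (\<Sum>i<n. \<bar>cmod (vec_index w i)\<bar> * \<bar>cmod (vec_index u i)\<bar>)"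
    by (rule order_trans[OF norm_sum]) (simp add: norm_mult)
  also have "\<dots> \<le> vnorm w * vnorm u"
    using assms L2_set_mult_ineq[of "\<lambda>i. cmod (vec_index w i)" "\<lambda>i. cmod (vec_index u i)" "{..<n}"]
    by (simp add: vnorm_def)
  finally show ?thesis .
qed

lemma bilinear_le_mat_norm:
  assumes A: "A \<in> carrier_mat n n" and v: "v \<in> carrier_vec n" and w: "w \<in> carrier_vec n"
  shows "cmod (\<Sum>i<n. \<Sum>j<n. vec_index w i * A $$ (i, j) * vec_index v j) \<le> mat_norm A * vnorm v * vnorm w"
proof -
  have "(\<Sum>i<n. \<Sum>j<n. vec_index w i * A $$ (i, j) * vec_index v j)
      = (\<Sum>i<n. vec_index w i * vec_index (A *\<^sub>v v) i)"
    using A v by (auto simp: mat_vec_index sum_distrib_left mult.assoc simp del: index_mult_mat_vec intro!: sum.cong)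
  also have "cmod \<dots> \<le> vnorm w * vnorm (A *\<^sub>v v)"
    by (rule cmod_scalar_prod_le) (use A v w in auto)
  also have "\<dots> \<le> vnorm w * (mat_norm A * vnorm v)"
    using A v by (intro mult_left_mono vnorm_mult_le) auto
  finally show ?thesis by (simp add: algebra_simps)
qed

text \<open>Once the spectrum of y is confined to the discs, g(y) is given by integrals over circles
  that do not depend on y, where g is bounded by compactness. The threshold e comes before R: only
  the bound C may grow with the norm of y.\<close>

lemma hol_calc_bounded:
  assumes A: "open A" and g: "g holomorphic_on A" and as: "set as \<subseteq> A"
  obtains e where "e > 0"
    "\<And>n y. y \<in> carrier_mat n n \<Longrightarrow> mat_norm (peval (\<Prod>a\<leftarrow>as. [:- a, 1:]) y) \<le> e \<Longrightarrow> spectrum y \<subseteq> A"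
    "\<And>R. \<exists>C. \<forall>n y. y \<in> carrier_mat n n \<longrightarrow> mat_norm y \<le> R \<longrightarrow>
       mat_norm (peval (\<Prod>a\<leftarrow>as. [:- a, 1:]) y) \<le> e \<longrightarrow> mat_norm (hol_calc g y) \<le> C"
proof -
  let ?p = "\<Prod>a\<leftarrow>as. [:- a, 1:]" and ?C = "set as"
  obtain \<rho> where \<rho>: "\<rho> > 0" "\<And>c. c \<in> ?C \<Longrightarrow> ball c (2 * \<rho>) \<subseteq> A"
    "\<And>c d. c \<in> ?C \<Longrightarrow> d \<in> ?C \<Longrightarrow> c \<noteq> d \<Longrightarrow> 4 * \<rho> \<le> dist c d"
    using separating_radius[of ?C A] as A by blast
  \<comment> \<open>A point at distance at least \<open>\<rho>\<close> from all roots has |p| at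
    least \<open>\<rho> ^ length as\<close>, that is 2 e, while |p| is at most e at the eigenvalues
    of y. The gap separates the circles from the spectrum and also bounds the resolvent.\<close>
  define e where "e = \<rho> ^ length as / 2"
  have e: "e > 0" using \<rho> by (simp add: e_def)
  obtain N where N: "\<And>n y z. y \<in> carrier_mat n n \<Longrightarrow> N z y \<in> carrier_mat n n"
    "\<And>n y z. y \<in> carrier_mat n n \<Longrightarrow> poly ?p z \<cdot>\<^sub>m 1\<^sub>m n - peval ?p y = N z y * (z \<cdot>\<^sub>m 1\<^sub>m n - y)"
    "\<And>R. \<exists>K. \<forall>n y z. y \<in> carrier_mat n n \<longrightarrow> mat_norm y \<le> R \<longrightarrow> cmod z \<le> R \<longrightarrow> mat_norm (N z y) \<le> K"
    by (rule divided_difference[of ?p]) blast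
  have far: "2 * e \<le> cmod (poly ?p z)" if "\<And>a. a \<in> ?C \<Longrightarrow> \<rho> \<le> cmod (z - a)" for z
    using cmod_poly_roots_ge[of \<rho> as z] that \<rho>(1) by (simp add: e_def)
  have spec: "spectrum y \<subseteq> (\<Union>c\<in>?C. ball c \<rho>)"
    if y: "y \<in> carrier_mat n n" "mat_norm (peval ?p y) \<le> e" for n y
  proof
    fix l assume "l \<in> spectrum y"
    then have "cmod (poly ?p l) \<le> e" using spectrum_bound[OF y(1)] y(2) order_trans by blast
    then have "\<exists>a\<in>?C. cmod (l - a) < \<rho>" using far[of l] e by fastforce
    then show "l \<in> (\<Union>c\<in>?C. ball c \<rho>)" by (auto simp: dist_norm norm_minus_commute)
  qed
  have sphere: "sphere c \<rho> \<subseteq> A" "\<And>z a. z \<in> sphere c \<rho> \<Longrightarrow> a \<in> ?C \<Longrightarrow> \<rho> \<le> cmod (z - a)"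
    if c: "c \<in> ?C" for c
  proof -
    show "sphere c \<rho> \<subseteq> A" using \<rho>(1) \<rho>(2)[OF c] by (auto simp: subset_eq)
    fix z a assume z: "z \<in> sphere c \<rho>" and a: "a \<in> ?C"
    show "\<rho> \<le> cmod (z - a)"
    proof (cases "a = c")
      case False
      have "dist c a \<le> dist c z + dist z a" by (rule dist_triangle)
      then show ?thesis using \<rho>(1) \<rho>(3)[OF c a] False z by (auto simp: dist_norm)
    qed (use z in \<open>auto simp: dist_norm norm_minus_commute\<close>)
  qed
  have "compact (\<Union>c\<in>?C. sphere c \<rho>)" by (intro compact_UN) auto
  moreover have "(\<Union>c\<in>?C. sphere c \<rho>) \<subseteq> A" using sphere(1) by blast
  ultimately have "compact (g ` (\<Union>c\<in>?C. sphere c \<rho>))"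
    using g by (intro compact_continuous_image) (auto intro: holomorphic_on_imp_continuous_on continuous_on_subset)
  then have "bounded (g ` (\<Union>c\<in>?C. sphere c \<rho>))" by (rule compact_imp_bounded)
  then obtain M where Mb: "\<forall>w\<in>g ` (\<Union>c\<in>?C. sphere c \<rho>). cmod w \<le> M"
    unfolding bounded_iff ..
  \<comment> \<open>The maximum keeps the bound nonnegative even when \<open>as\<close> is empty and
    M is arbitrary.\<close>
  have M: "cmod (g z) \<le> max M 0" if "c \<in> ?C" "z \<in> sphere c \<rho>" for c z
  proof -
    have "g z \<in> g ` (\<Union>c\<in>?C. sphere c \<rho>)" using that by blast
    with Mb have "cmod (g z) \<le> M" ..
    then show ?thesis by (rule max.coboundedI1)
  qed
  have bnd: "\<exists>C. \<forall>n y. y \<in> carrier_mat n n \<longrightarrow> mat_norm y \<le> R \<longrightarrow>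
       mat_norm (peval ?p y) \<le> e \<longrightarrow> mat_norm (hol_calc g y) \<le> C" for R
  proof -
    \<comment> \<open>The bound on divided differences uses one radius for both arguments, so
      \<open>R'\<close> must dominate the norm of y and every point of the circles.\<close>
    define R' where "R' = \<bar>R\<bar> + (\<Sum>c\<in>?C. cmod c) + \<rho>"
    obtain K0 where K0: "\<And>n y z. y \<in> carrier_mat n n \<Longrightarrow> mat_norm y \<le> R' \<Longrightarrow> cmod z \<le> R' \<Longrightarrow> mat_norm (N z y) \<le> K0"
      using N(3)[of R'] by blast
    define K where "K = max K0 0 / e"
    have K: "0 \<le> K" using e by (simp add: K_def)
    define B where "B = real (card ?C) * (max M 0 * K * \<rho>)"
    have "mat_norm (hol_calc g y) \<le> B"
      if y: "y \<in> carrier_mat n n" "mat_norm y \<le> R" "mat_norm (peval ?p y) \<le> e" for n y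
    proof (rule mat_norm_le_bilinear[OF hol_calc_carrier[OF y(1)]])
      show "0 \<le> B" using K \<rho> by (simp add: B_def)
      fix v w :: "complex vec" assume v: "v \<in> carrier_vec n" and w: "w \<in> carrier_vec n"
      \<comment> \<open>Paired with v and w, the integrand is a single scalar function, accessible
        to the residue theorem.\<close>
      define h where "h = (\<lambda>z. g z * (\<Sum>i<n. \<Sum>j<n. vec_index w i * resolvent y z $$ (i, j) * vec_index v j))"
      note S = spec[OF y(1,3)]
      have SA: "spectrum y \<subseteq> A" using S \<rho>(1,2) by fastforce
      have hR: "(\<lambda>z. resolvent y z $$ (i, j)) holomorphic_on A - spectrum y" if "i < n" "j < n" for i j
        by (rule holomorphic_on_subset[OF holomorphic_resolvent[OF y(1) that]]) auto
      have hg: "g holomorphic_on A - spectrum y" using g by (rule holomorphic_on_subset) auto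
      have hh: "h holomorphic_on A - spectrum y"
        unfolding h_def by (intro holomorphic_intros hR hg) auto
      let ?P = "{..<n} \<times> {..<n}"
      have "(\<Sum>i<n. \<Sum>j<n. vec_index w i * hol_calc g y $$ (i, j) * vec_index v j)
          = (\<Sum>(i, j)\<in>?P. \<Sum>l\<in>spectrum y. vec_index w i * vec_index v j * residue (\<lambda>z. g z * resolvent y z $$ (i, j)) l)"
        using y by (simp add: sum.cartesian_product[symmetric] hol_calc_def resolvent_def sum_distrib_left sum_distrib_right mult_ac)
      also have "\<dots> = (\<Sum>l\<in>spectrum y. \<Sum>(i, j)\<in>?P. vec_index w i * vec_index v j * residue (\<lambda>z. g z * resolvent y z $$ (i, j)) l)"
        by (subst sum.swap) (simp add: case_prod_unfold)
      also have "\<dots> = (\<Sum>l\<in>spectrum y. residue h l)"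
      proof (rule sum.cong[OF refl])
        fix l assume l: "l \<in> spectrum y"
        define B where "B = A - (spectrum y - {l})"
        have B: "open B" "l \<in> B" "B - {l} = A - spectrum y"
          using A l finite_spectrum[OF y(1)] SA by (auto simp: B_def intro!: open_Diff finite_imp_closed)
        have "residue (\<lambda>z. \<Sum>ij\<in>?P. (vec_index w (fst ij) * vec_index v (snd ij)) * (g z * resolvent y z $$ (fst ij, snd ij))) l
          = (\<Sum>ij\<in>?P. (vec_index w (fst ij) * vec_index v (snd ij)) * residue (\<lambda>z. g z * resolvent y z $$ (fst ij, snd ij)) l)"
          by (rule residue_sum[OF B(1,2)]) (auto simp: B(3) intro!: holomorphic_intros hg hR)
        moreover have "(\<lambda>z. \<Sum>ij\<in>?P. (vec_index w (fst ij) * vec_index v (snd ij)) * (g z * resolvent y z $$ (fst ij, snd ij))) = h"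
          by (rule ext) (simp add: h_def sum.cartesian_product' sum_distrib_left mult_ac case_prod_unfold)
        ultimately show "(\<Sum>(i, j)\<in>?P. vec_index w i * vec_index v j * residue (\<lambda>z. g z * resolvent y z $$ (i, j)) l) = residue h l"
          by (simp add: case_prod_unfold)
      qed
      \<comment> \<open>The eigenvalues are sorted by the disc that contains them; as the discs are
        disjoint, none is counted twice.\<close>
      also have "\<dots> = (\<Sum>l\<in>(\<Union>c\<in>?C. spectrum y \<inter> ball c \<rho>). residue h l)"
        using S by (intro arg_cong2[of _ _ _ _ sum] refl) blast
      also have "\<dots> = (\<Sum>c\<in>?C. \<Sum>l\<in>spectrum y \<inter> ball c \<rho>. residue h l)"
      proof (rule sum.UNION_disjoint)
        show "\<forall>c\<in>?C. \<forall>d\<in>?C. c \<noteq> d \<longrightarrow> (spectrum y \<inter> ball c \<rho>) \<inter> (spectrum y \<inter> ball d \<rho>) = {}"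
        proof (intro ballI impI)
          fix c d assume cd: "c \<in> ?C" "d \<in> ?C" "c \<noteq> d"
          have "ball c \<rho> \<inter> ball d \<rho> = {}" using \<rho>(1) \<rho>(3)[OF cd] by (intro disjoint_ballI) simp
          then show "(spectrum y \<inter> ball c \<rho>) \<inter> (spectrum y \<inter> ball d \<rho>) = {}" by blast
        qed
      qed (use finite_spectrum[OF y(1)] in auto)
      finally have eq: "(\<Sum>i<n. \<Sum>j<n. vec_index w i * hol_calc g y $$ (i, j) * vec_index v j)
          = (\<Sum>c\<in>?C. \<Sum>l\<in>spectrum y \<inter> ball c \<rho>. residue h l)" .
      have "cmod (\<Sum>l\<in>spectrum y \<inter> ball c \<rho>. residue h l) \<le> max M 0 * K * vnorm v * vnorm w * \<rho>"
        if c: "c \<in> ?C" for c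
      proof (rule residue_theorem_circle_bound[where c = c and R = "2 * \<rho>"])
        have "ball c (2 * \<rho>) - spectrum y \<inter> ball c \<rho> \<subseteq> A - spectrum y"
        proof
          fix z assume z: "z \<in> ball c (2 * \<rho>) - spectrum y \<inter> ball c \<rho>"
          have "z \<notin> spectrum y"
          proof
            assume zs: "z \<in> spectrum y"
            then obtain d where d: "d \<in> ?C" "z \<in> ball d \<rho>" using S by blast
            then have "d \<noteq> c" using z zs by auto
            have "dist c d \<le> dist c z + dist z d" by (rule dist_triangle)
            moreover have "4 * \<rho> \<le> dist c d" using \<rho>(3)[OF c d(1)] \<open>d \<noteq> c\<close> by blast
            moreover have "dist c z < 2 * \<rho>" using z by simp
            moreover have "dist z d < \<rho>" using d(2) by (simp add: dist_commute)
            ultimately show False using \<rho>(1) by linarith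
          qed
          then show "z \<in> A - spectrum y" using z \<rho>(2)[OF c] by auto
        qed
        then show "h holomorphic_on ball c (2 * \<rho>) - spectrum y \<inter> ball c \<rho>"
          by (rule holomorphic_on_subset[OF hh])
        show "0 \<le> max M 0 * K * vnorm v * vnorm w" by (intro mult_nonneg_nonneg K vnorm_nonneg) auto
        fix z assume "cmod (z - c) = \<rho>"
        then have z: "z \<in> sphere c \<rho>" by (simp add: dist_norm norm_minus_commute)
        have zs: "z \<notin> spectrum y"
          using S sphere(2)[OF c z] by (fastforce simp: dist_norm norm_minus_commute)
        have zR: "cmod z \<le> R'"
        proof -
          have "cmod z \<le> cmod c + cmod (z - c)" by (metis add.commute diff_add_cancel norm_triangle_ineq)
          also have "\<dots> \<le> (\<Sum>c\<in>?C. cmod c) + \<rho>"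
            using z c by (intro add_mono member_le_sum) (auto simp: dist_norm norm_minus_commute)
          finally show ?thesis by (simp add: R'_def)
        qed
        have yR: "mat_norm y \<le> R'" using y(2) \<rho>(1) sum_nonneg[of ?C cmod] by (simp add: R'_def)
        have "mat_norm (resolvent y z) \<le> K"
          unfolding K_def
          by (rule resolvent_norm_le_poly[OF y(1) zs N(1,2)[OF y(1)] _ e far y(3)])
             (use K0[OF y(1) yR zR] sphere(2)[OF c z] in auto)
        then have "cmod (\<Sum>i<n. \<Sum>j<n. vec_index w i * resolvent y z $$ (i, j) * vec_index v j) \<le> K * vnorm v * vnorm w"
          using bilinear_le_mat_norm[OF resolvent(1)[OF y(1) zs] v w]
          by (meson mult_right_mono order_trans vnorm_nonneg)
        then have "cmod (h z) \<le> max M 0 * (K * vnorm v * vnorm w)"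
          unfolding h_def norm_mult using M[OF c z] by (intro mult_mono) auto
        then show "cmod (h z) \<le> max M 0 * K * vnorm v * vnorm w" by (simp only: mult.assoc)
      qed (use \<rho> finite_spectrum[OF y(1)] in auto)
      then have "cmod (\<Sum>c\<in>?C. \<Sum>l\<in>spectrum y \<inter> ball c \<rho>. residue h l)
          \<le> (\<Sum>c\<in>?C. max M 0 * K * vnorm v * vnorm w * \<rho>)"
        by - (rule order_trans[OF norm_sum], rule sum_mono)
      then show "cmod (\<Sum>i<n. \<Sum>j<n. vec_index w i * hol_calc g y $$ (i, j) * vec_index v j) \<le> B * vnorm v * vnorm w"
        unfolding eq by (simp add: B_def mult_ac)
    qed
    then show ?thesis by blast
  qed
  show ?thesis
  proof (rule that[OF e _ bnd])
    fix n and y :: "complex mat"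
    assume "y \<in> carrier_mat n n" "mat_norm (peval ?p y) \<le> e"
    from spec[OF this] show "spectrum y \<subseteq> A" using \<rho>(1,2) by fastforce
  qed
qed

text \<open>If \<open>f = q + p g\<close> with \<open>p(x) = 0\<close>, then \<open>f(y) - q(y) = p(y) g(y)\<close> is small as soon as \<open>p(y)\<close> is,
  uniformly in the size of \<open>y\<close>.\<close>

theorem hol_calc_approx:
  assumes x: "x \<in> carrier_mat n n" and A: "open A" "spectrum x \<subseteq> A" and f: "f holomorphic_on A"
  obtains p q where "peval p x = 0\<^sub>m n n" "hol_calc f x = peval q x"
    "\<And>R e. e > 0 \<Longrightarrow> \<exists>d>0. \<forall>m y. y \<in> carrier_mat m m \<longrightarrow> mat_norm y \<le> R \<longrightarrow> mat_norm (peval p y) \<le> d \<longrightarrow>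
       spectrum y \<subseteq> A \<and> mat_norm (hol_calc f y - peval q y) < e"
proof -
  obtain as where as: "set as = spectrum x" "peval (\<Prod>a\<leftarrow>as. [:- a, 1:]) x = 0\<^sub>m n n"
    by (rule annihilating_polynomial[OF x])
  let ?p = "\<Prod>a\<leftarrow>as. [:- a, 1:]"
  obtain q g where g: "g holomorphic_on A" "\<And>z. z \<in> A \<Longrightarrow> f z = poly q z + poly ?p z * g z"
    by (rule holomorphic_division[OF A(1) f, of as]) (rule that)
  obtain b where b: "b > 0"
    "\<And>n y. y \<in> carrier_mat n n \<Longrightarrow> mat_norm (peval ?p y) \<le> b \<Longrightarrow> spectrum y \<subseteq> A"
    "\<And>R. \<exists>C. \<forall>n y. y \<in> carrier_mat n n \<longrightarrow> mat_norm y \<le> R \<longrightarrow>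
       mat_norm (peval ?p y) \<le> b \<longrightarrow> mat_norm (hol_calc g y) \<le> C"
    using A as(1) by (elim hol_calc_bounded[OF A(1) g(1), of as, rotated]) auto
  have fy: "hol_calc f y - peval q y = peval ?p y * hol_calc g y"
    if y: "y \<in> carrier_mat m m" and s: "spectrum y \<subseteq> A" for m y
  proof -
    \<comment> \<open>A polynomial annihilating y itself is divided out of g. With remainder q', f
      is q + p q' modulo that polynomial, so that f(y) - q(y) = p(y) q'(y) = p(y) g(y).\<close>
    obtain bs where py: "peval (\<Prod>a\<leftarrow>bs. [:- a, 1:]) y = 0\<^sub>m m m" by (rule annihilating_polynomial[OF y])
    obtain q' g' where g': "g' holomorphic_on A" "\<And>z. z \<in> A \<Longrightarrow> g z = poly q' z + poly (\<Prod>a\<leftarrow>bs. [:- a, 1:]) z * g' z"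
      by (rule holomorphic_division[OF A(1) g(1), of bs]) (rule that)
    have gy: "hol_calc g y = peval q' y" by (rule hol_calc_eq_peval[OF y A(1) s g'(1) py g'(2)])
    have "hol_calc f y = peval (q + ?p * q') y"
    proof (rule hol_calc_eq_peval[OF y A(1) s _ py])
      show "(\<lambda>z. poly ?p z * g' z) holomorphic_on A" by (intro holomorphic_intros g')
      show "f z = poly (q + ?p * q') z + poly (\<Prod>a\<leftarrow>bs. [:- a, 1:]) z * (poly ?p z * g' z)" if "z \<in> A" for z
        by (simp add: g(2)[OF that] g'(2)[OF that] algebra_simps)
    qed
    then have "hol_calc f y = peval q y + peval ?p y * hol_calc g y"
      by (simp add: peval_add[OF y] peval_mult[OF y] gy)
    moreover have "(M + N) - M = N" if "M \<in> carrier_mat m m" "N \<in> carrier_mat m m" for M N :: "complex mat"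
      using that by (auto intro!: eq_matI)
    moreover have "peval ?p y * hol_calc g y \<in> carrier_mat m m"
      using peval_carrier[OF y] hol_calc_carrier[OF y] by (rule mult_carrier_mat)
    ultimately show ?thesis using peval_carrier[OF y] by metis
  qed
  show ?thesis
  proof (rule that[OF as(2) hol_calc_eq_peval[OF x A g(1) as(2) g(2)]])
    fix R e :: real assume e: "e > 0"
    obtain C where C: "\<And>n y. y \<in> carrier_mat n n \<Longrightarrow> mat_norm y \<le> R \<Longrightarrow>
       mat_norm (peval ?p y) \<le> b \<Longrightarrow> mat_norm (hol_calc g y) \<le> C"
      using b(3)[of R] by blast
    \<comment> \<open>\<open>\<bar>C\<bar> + 1\<close> is positive for every real C, and the factor
      2 makes the final inequality strict.\<close>
    define d where "d = min b (e / (2 * (\<bar>C\<bar> + 1)))"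
    show "\<exists>d>0. \<forall>m y. y \<in> carrier_mat m m \<longrightarrow> mat_norm y \<le> R \<longrightarrow> mat_norm (peval ?p y) \<le> d \<longrightarrow>
       spectrum y \<subseteq> A \<and> mat_norm (hol_calc f y - peval q y) < e"
    proof (intro exI[of _ d] conjI allI impI)
      show "d > 0" using b e by (simp add: d_def)
      fix m y assume y: "y \<in> carrier_mat m m" "mat_norm y \<le> R" "mat_norm (peval ?p y) \<le> d"
      then have yb: "mat_norm (peval ?p y) \<le> b" "mat_norm (peval ?p y) \<le> e / (2 * (\<bar>C\<bar> + 1))"
        by (simp_all add: d_def)
      show s: "spectrum y \<subseteq> A" by (rule b(2)[OF y(1) yb(1)])
      have "mat_norm (hol_calc f y - peval q y) \<le> mat_norm (peval ?p y) * mat_norm (hol_calc g y)"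
        unfolding fy[OF y(1) s] using peval_carrier[OF y(1)] hol_calc_carrier[OF y(1)] by (rule mat_norm_mult_le)
      also have "\<dots> \<le> e / (2 * (\<bar>C\<bar> + 1)) * (\<bar>C\<bar> + 1)"
        using yb(2) C[OF y(1,2) yb(1)] e by (intro mult_mono) auto
      also have "\<dots> = e / 2" by (simp add: field_simps)
      also have "\<dots> < e" using e by simp
      finally show "mat_norm (hol_calc f y - peval q y) < e" .
    qed
  qed
qed

section \<open>Free polynomials\<close>

lemma MnD: "x \<in> Mn d n \<Longrightarrow> k < d \<Longrightarrow> x ! k \<in> carrier_mat n n"
  by (auto simp: Mn_def)

lemma nc_size_eq: "x \<in> Mn d n \<Longrightarrow> 0 < d \<Longrightarrow> nc_size x = n"
  by (cases x) (auto simp: Mn_def nc_size_def)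

lemma MdE:
  assumes "x \<in> Md d" "0 < d"
  shows "x \<in> Mn d (nc_size x)" "1 \<le> nc_size x"
  using assms nc_size_eq[of x d] by (auto simp: Md_def)

lemma Md_nth: "x \<in> Md d \<Longrightarrow> k < d \<Longrightarrow> x ! k \<in> carrier_mat (nc_size x) (nc_size x)"
  using MdE(1)[of x d] MnD[of x d "nc_size x" k] by simp

lemma MnI: "length x = d \<Longrightarrow> (\<And>k. k < d \<Longrightarrow> x ! k \<in> carrier_mat n n) \<Longrightarrow> x \<in> Mn d n"
  by (auto simp: Mn_def in_set_conv_nth)

lemma Mn_Md: "x \<in> Mn d n \<Longrightarrow> 1 \<le> n \<Longrightarrow> x \<in> Md d"
  by (auto simp: Md_def)

lemma nc_dsum_Mn: "x \<in> Mn d n \<Longrightarrow> y \<in> Mn d m \<Longrightarrow> nc_dsum x y \<in> Mn d (n + m)"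
  by (rule MnI) (auto simp: nc_dsum_def Mn_def)

lemma nc_dsum_nth: "x \<in> Mn d n \<Longrightarrow> y \<in> Mn d m \<Longrightarrow> k < d \<Longrightarrow> nc_dsum x y ! k = dsum_mat (x ! k) (y ! k)"
  by (auto simp: nc_dsum_def Mn_def)

lemma nc_dsum_Md:
  assumes "x \<in> Md d" "y \<in> Md d"
  shows "nc_dsum x y \<in> Md d"
proof -
  obtain n m where nm: "1 \<le> n" "1 \<le> m" "x \<in> Mn d n" "y \<in> Mn d m" using assms by (auto simp: Md_def)
  show ?thesis by (rule Mn_Md[OF nc_dsum_Mn[OF nm(3,4)]]) (use nm in simp)
qed

lemma nc_size_dsum: "x \<in> Md d \<Longrightarrow> y \<in> Md d \<Longrightarrow> 0 < d \<Longrightarrow> nc_size (nc_dsum x y) = nc_size x + nc_size y"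
  using MdE nc_dsum_Mn nc_size_eq by metis

lemma word_at_Nil [simp]: "word_at x [] = 1\<^sub>m (nc_size x)"
  by (simp add: word_at_def)

lemma word_at_Cons [simp]: "word_at x (k # w) = x ! k * word_at x w"
  by (simp add: word_at_def)

lemma word_at_carrier:
  "x \<in> Md d \<Longrightarrow> set w \<subseteq> {..<d} \<Longrightarrow> word_at x w \<in> carrier_mat (nc_size x) (nc_size x)"
proof (induction w)
  case (Cons k w)
  then have "x ! k \<in> carrier_mat (nc_size x) (nc_size x)" using Md_nth[of x d k] by simp
  then show ?case using Cons by (auto intro!: mult_carrier_mat)
qed simp

lemma word_at_append:
  assumes x: "x \<in> Md d" and v: "set v \<subseteq> {..<d}"
  shows "set w \<subseteq> {..<d} \<Longrightarrow> word_at x (w @ v) = word_at x w * word_at x v"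
proof (induction w)
  case Nil
  then show ?case using left_mult_one_mat[OF word_at_carrier[OF x v]] by simp
next
  case (Cons k w)
  then have "x ! k \<in> carrier_mat (nc_size x) (nc_size x)" "set w \<subseteq> {..<d}" using Md_nth[OF x, of k] by auto
  then show ?case
    using Cons assoc_mult_mat[OF _ word_at_carrier[OF x, of w] word_at_carrier[OF x v]] by simp
qed

lemma word_at_dsum:
  assumes x: "x \<in> Md d" and y: "y \<in> Md d" and d: "0 < d"
  shows "set w \<subseteq> {..<d} \<Longrightarrow> word_at (nc_dsum x y) w = dsum_mat (word_at x w) (word_at y w)"
proof (induction w)
  case Nil
  then show ?case by (simp add: nc_size_dsum[OF x y d] dsum_one)
next
  case (Cons k w)
  then have k: "k < d" and w: "set w \<subseteq> {..<d}" by auto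
  have "nc_dsum x y ! k = dsum_mat (x ! k) (y ! k)"
    by (rule nc_dsum_nth[OF MdE(1)[OF x d] MdE(1)[OF y d] k])
  then show ?case
    using Cons.IH[OF w] dsum_mult[OF Md_nth[OF x k] Md_nth[OF y k] word_at_carrier[OF x w] word_at_carrier[OF y w]]
    by simp
qed

lemma poly_at_carrier [simp]: "poly_at p x \<in> carrier_mat (nc_size x) (nc_size x)"
  by (simp add: poly_at_def)

lemma poly_at_index:
  assumes "finite K" "Poly_Mapping.keys p \<subseteq> K" "i < nc_size x" "j < nc_size x"
  shows "poly_at p x $$ (i, j) = (\<Sum>w\<in>K. Poly_Mapping.lookup p w * word_at x w $$ (i, j))"
  unfolding poly_at_def using assms
  by (auto simp: in_keys_iff intro!: sum.mono_neutral_left)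

lemma dsum_index:
  assumes "A \<in> carrier_mat n n" "B \<in> carrier_mat m m" "i < n + m" "j < n + m"
  shows "dsum_mat A B $$ (i, j) =
    (if i < n then if j < n then A $$ (i, j) else 0 else if j < n then 0 else B $$ (i - n, j - n))"
  using assms by (auto simp: dsum_mat_def)

lemma poly_at_dsum:
  assumes x: "x \<in> Md d" and y: "y \<in> Md d" and d: "0 < d" and p: "p \<in> free_polys d"
  shows "poly_at p (nc_dsum x y) = dsum_mat (poly_at p x) (poly_at p y)"
proof (rule eq_matI)
  let ?n = "nc_size x" and ?m = "nc_size y"
  have W: "word_at (nc_dsum x y) w = dsum_mat (word_at x w) (word_at y w)" 
    "word_at x w \<in> carrier_mat ?n ?n" "word_at y w \<in> carrier_mat ?m ?m" if "w \<in> Poly_Mapping.keys p" for w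
    using word_at_dsum[OF x y d, of w] word_at_carrier[OF x, of w] word_at_carrier[OF y, of w] p that
    by (auto simp: free_polys_def)
  have c: "dsum_mat (poly_at p x) (poly_at p y) \<in> carrier_mat (?n + ?m) (?n + ?m)" by simp
  fix i j assume "i < dim_row (dsum_mat (poly_at p x) (poly_at p y))" "j < dim_col (dsum_mat (poly_at p x) (poly_at p y))"
  then have ij: "i < ?n + ?m" "j < ?n + ?m" using c by auto
  have "poly_at p (nc_dsum x y) $$ (i, j)
    = (\<Sum>w\<in>Poly_Mapping.keys p. Poly_Mapping.lookup p w * word_at (nc_dsum x y) w $$ (i, j))"
    using ij by (simp add: poly_at_def nc_size_dsum[OF x y d])
  also have "\<dots> = (\<Sum>w\<in>Poly_Mapping.keys p. Poly_Mapping.lookup p w * dsum_mat (word_at x w) (word_at y w) $$ (i, j))"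
    by (intro sum.cong refl) (simp add: W)
  also have "\<dots> = (\<Sum>w\<in>Poly_Mapping.keys p. Poly_Mapping.lookup p w *
      (if i < ?n then if j < ?n then word_at x w $$ (i, j) else 0
       else if j < ?n then 0 else word_at y w $$ (i - ?n, j - ?n)))"
    by (intro sum.cong refl) (simp add: dsum_index[OF W(2,3) ij])
  also have "\<dots> = dsum_mat (poly_at p x) (poly_at p y) $$ (i, j)"
    unfolding dsum_index[OF poly_at_carrier poly_at_carrier ij] using ij by (auto simp: poly_at_def)
  finally show "poly_at p (nc_dsum x y) $$ (i, j) = dsum_mat (poly_at p x) (poly_at p y) $$ (i, j)" .
qed (auto simp: dsum_mat_def poly_at_def nc_size_dsum[OF x y d])

section \<open>Functions given by free polynomials\<close>

text \<open>Free polynomials are handled through the functions that they define on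
  \<open>Md d\<close>. Closure under sums, products and substitution then concerns matrix values,
  and no algebra of coefficient maps has to be set up.\<close>

definition polyfun :: "nat \<Rightarrow> (ncpoint \<Rightarrow> complex mat) \<Rightarrow> bool" where
  "polyfun d F \<longleftrightarrow> (\<exists>p\<in>free_polys d. \<forall>x\<in>Md d. poly_at p x = F x)"

lemma polyfun_carrier: "polyfun d F \<Longrightarrow> x \<in> Md d \<Longrightarrow> F x \<in> carrier_mat (nc_size x) (nc_size x)"
  unfolding polyfun_def using poly_at_carrier by metis

lemma polyfun_cong: "polyfun d F \<Longrightarrow> (\<And>x. x \<in> Md d \<Longrightarrow> G x = F x) \<Longrightarrow> polyfun d G"
  by (auto simp: polyfun_def)

lemma polyfun_poly_at: "p \<in> free_polys d \<Longrightarrow> polyfun d (poly_at p)"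
  by (auto simp: polyfun_def)

lemma polyfun_word:
  assumes w: "set w \<subseteq> {..<d}"
  shows "polyfun d (\<lambda>x. c \<cdot>\<^sub>m word_at x w)"
  unfolding polyfun_def
proof (intro bexI[of _ "Poly_Mapping.single w c"] ballI)
  show "Poly_Mapping.single w c \<in> free_polys d" using w by (auto simp: free_polys_def)
  fix x assume x: "x \<in> Md d"
  show "poly_at (Poly_Mapping.single w c) x = c \<cdot>\<^sub>m word_at x w"
    using word_at_carrier[OF x w] poly_at_index[of "{w}" "Poly_Mapping.single w c"]
    by (intro eq_matI) (auto simp: poly_at_def)
qed

lemma polyfun_add:
  assumes "polyfun d F" "polyfun d G"
  shows "polyfun d (\<lambda>x. F x + G x)"
proof -
  obtain p q where p: "p \<in> free_polys d" "\<And>x. x \<in> Md d \<Longrightarrow> poly_at p x = F x"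
    and q: "q \<in> free_polys d" "\<And>x. x \<in> Md d \<Longrightarrow> poly_at q x = G x"
    using assms by (auto simp: polyfun_def)
  have "p + q \<in> free_polys d"
    using p(1) q(1) Poly_Mapping.keys_add[of p q] by (auto simp: free_polys_def)
  moreover have "poly_at (p + q) x = poly_at p x + poly_at q x" for x
  proof (rule eq_matI)
    let ?K = "Poly_Mapping.keys p \<union> Poly_Mapping.keys q"
    fix i j assume "i < dim_row (poly_at p x + poly_at q x)" "j < dim_col (poly_at p x + poly_at q x)"
    then have ij: "i < nc_size x" "j < nc_size x" by (auto simp: poly_at_def)
    show "poly_at (p + q) x $$ (i, j) = (poly_at p x + poly_at q x) $$ (i, j)"
      using ij poly_at_index[of ?K p i x j] poly_at_index[of ?K q i x j] poly_at_index[of ?K "p + q" i x j]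
        Poly_Mapping.keys_add[of p q] carrier_matD[OF poly_at_carrier[of q x]]
      by (simp add: lookup_add distrib_right sum.distrib)
  qed (auto simp: poly_at_def)
  ultimately show ?thesis using p q by (auto simp: polyfun_def intro!: bexI[of _ "p + q"])
qed

text \<open>The sum is taken entrywise with the size supplied by x, because the empty sum has to be
  a zero matrix of that size.\<close>

lemma polyfun_sum:
  assumes "finite I" "\<And>i. i \<in> I \<Longrightarrow> polyfun d (F i)"
  shows "polyfun d (\<lambda>x. mat (nc_size x) (nc_size x) (\<lambda>(a, b). \<Sum>i\<in>I. F i x $$ (a, b)))"
  using assms
proof (induction I)
  case empty
  have "polyfun d (\<lambda>x. 0 \<cdot>\<^sub>m word_at x [])" by (rule polyfun_word) simp
  then show ?case by (rule polyfun_cong) (auto intro!: eq_matI)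
next
  case (insert i I)
  have "polyfun d (\<lambda>x. F i x + mat (nc_size x) (nc_size x) (\<lambda>(a, b). \<Sum>i\<in>I. F i x $$ (a, b)))"
    by (intro polyfun_add insert.IH insert.prems) simp_all
  then show ?case
  proof (rule polyfun_cong)
    fix x assume x: "x \<in> Md d"
    show "mat (nc_size x) (nc_size x) (\<lambda>(a, b). \<Sum>i\<in>insert i I. F i x $$ (a, b))
        = F i x + mat (nc_size x) (nc_size x) (\<lambda>(a, b). \<Sum>i\<in>I. F i x $$ (a, b))"
      using insert polyfun_carrier[of d "F i" x] x by (intro eq_matI) auto
  qed
qed

text \<open>Words multiply by concatenation. The sum runs over pairs of words, so pairs with the
  same concatenation need not be collected.\<close>

lemma polyfun_mult:
  assumes "polyfun d F" "polyfun d G"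
  shows "polyfun d (\<lambda>x. F x * G x)"
proof -
  obtain p q where p: "p \<in> free_polys d" "\<And>x. x \<in> Md d \<Longrightarrow> poly_at p x = F x"
    and q: "q \<in> free_polys d" "\<And>x. x \<in> Md d \<Longrightarrow> poly_at q x = G x"
    using assms by (auto simp: polyfun_def)
  let ?p = "Poly_Mapping.lookup p" and ?q = "Poly_Mapping.lookup q"
  let ?I = "Poly_Mapping.keys p \<times> Poly_Mapping.keys q"
  have "polyfun d (\<lambda>x. mat (nc_size x) (nc_size x) (\<lambda>(a, b). \<Sum>wv\<in>?I. ((?p (fst wv) * ?q (snd wv)) \<cdot>\<^sub>m word_at x (fst wv @ snd wv)) $$ (a, b)))"
    using p(1) q(1) by (intro polyfun_sum polyfun_word) (auto simp: free_polys_def)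
  then show ?thesis
  proof (rule polyfun_cong)
    fix x assume x: "x \<in> Md d"
    let ?n = "nc_size x"
    have W: "word_at x w \<in> carrier_mat ?n ?n" "set w \<subseteq> {..<d}" if "w \<in> Poly_Mapping.keys p \<or> w \<in> Poly_Mapping.keys q" for w
      using that p(1) q(1) word_at_carrier[OF x, of w] by (auto simp: free_polys_def)
    have "poly_at p x * poly_at q x
      = mat ?n ?n (\<lambda>(a, b). \<Sum>wv\<in>?I. ((?p (fst wv) * ?q (snd wv)) \<cdot>\<^sub>m word_at x (fst wv @ snd wv)) $$ (a, b))"
    proof (rule eq_matI, unfold dim_row_mat dim_col_mat)
      fix a b assume ab: "a < ?n" "b < ?n"
      have "(poly_at p x * poly_at q x) $$ (a, b) = (\<Sum>k<?n. poly_at p x $$ (a, k) * poly_at q x $$ (k, b))"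
        using ab carrier_matD[OF poly_at_carrier[of p x]] carrier_matD[OF poly_at_carrier[of q x]]
        by (simp add: scalar_prod_def atLeast0LessThan)
      also have "\<dots> = (\<Sum>k<?n. \<Sum>(w, v)\<in>?I. ?p w * word_at x w $$ (a, k) * (?q v * word_at x v $$ (k, b)))"
        using ab by (intro sum.cong refl) (simp add: poly_at_def sum_product sum.cartesian_product)
      also have "\<dots> = (\<Sum>(w, v)\<in>?I. \<Sum>k<?n. ?p w * word_at x w $$ (a, k) * (?q v * word_at x v $$ (k, b)))"
        by (subst sum.swap) (simp add: case_prod_unfold)
      also have "\<dots> = (\<Sum>wv\<in>?I. ((?p (fst wv) * ?q (snd wv)) \<cdot>\<^sub>m word_at x (fst wv @ snd wv)) $$ (a, b))"
      proof (intro sum.cong refl, clarify)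
        fix w v assume wv: "w \<in> Poly_Mapping.keys p" "v \<in> Poly_Mapping.keys q"
        have "word_at x (w @ v) = word_at x w * word_at x v"
          by (rule word_at_append[OF x W(2) W(2)]) (use wv in auto)
        moreover have "(word_at x w * word_at x v) $$ (a, b) = (\<Sum>k<?n. word_at x w $$ (a, k) * word_at x v $$ (k, b))"
          using ab W(1)[of w] W(1)[of v] wv by (simp add: scalar_prod_def atLeast0LessThan)
        ultimately show "(\<Sum>k<?n. ?p w * word_at x w $$ (a, k) * (?q v * word_at x v $$ (k, b)))
            = ((?p (fst (w, v)) * ?q (snd (w, v))) \<cdot>\<^sub>m word_at x (fst (w, v) @ snd (w, v))) $$ (a, b)"
          using ab W(1)[of w] W(1)[of v] wv by (simp add: sum_distrib_left mult_ac)
      qed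
      finally show "(poly_at p x * poly_at q x) $$ (a, b)
        = mat ?n ?n (\<lambda>(a, b). \<Sum>wv\<in>?I. ((?p (fst wv) * ?q (snd wv)) \<cdot>\<^sub>m word_at x (fst wv @ snd wv)) $$ (a, b)) $$ (a, b)"
        using ab by simp
    qed (auto simp: poly_at_def)
    then show "F x * G x = mat ?n ?n (\<lambda>(a, b). \<Sum>wv\<in>?I. ((?p (fst wv) * ?q (snd wv)) \<cdot>\<^sub>m word_at x (fst wv @ snd wv)) $$ (a, b))"
      using p(2)[OF x] q(2)[OF x] by simp
  qed
qed

lemma polyfun_const: "polyfun d (\<lambda>x. c \<cdot>\<^sub>m 1\<^sub>m (nc_size x))"
  using polyfun_word[of "[]" d c] by simp

lemma polyfun_smult:
  assumes "polyfun d F"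
  shows "polyfun d (\<lambda>x. c \<cdot>\<^sub>m F x)"
  using polyfun_mult[OF polyfun_const[of d c] assms]
  by (rule polyfun_cong) (use mult_smult_one[OF polyfun_carrier[OF assms]] in auto)

lemma polyfun_diff:
  assumes "polyfun d F" "polyfun d G"
  shows "polyfun d (\<lambda>x. F x - G x)"
  using polyfun_add[OF assms(1) polyfun_smult[OF assms(2), of "-1"]]
  by (rule polyfun_cong) (use polyfun_carrier[OF assms(1)] polyfun_carrier[OF assms(2)] in \<open>auto intro!: eq_matI\<close>)

lemma polyfun_nth:
  assumes k: "k < d"
  shows "polyfun d (\<lambda>x. x ! k)"
proof (rule polyfun_cong[OF polyfun_word[of "[k]" d 1]])
  fix x assume "x \<in> Md d"
  from right_mult_one_mat[OF Md_nth[OF this k]] show "x ! k = 1 \<cdot>\<^sub>m word_at x [k]"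
    by (auto intro!: eq_matI)
qed (use k in simp)

lemma polyfun_peval:
  assumes "polyfun d F"
  shows "polyfun d (\<lambda>x. peval q (F x))"
proof (induction q)
  case 0
  show ?case using polyfun_const[of d 0]
    by (rule polyfun_cong) (auto simp: peval_0[OF polyfun_carrier[OF assms]] intro!: eq_matI)
next
  case (pCons a q)
  have "polyfun d (\<lambda>x. a \<cdot>\<^sub>m 1\<^sub>m (nc_size x) + F x * peval q (F x))"
    by (intro polyfun_add polyfun_const polyfun_mult assms pCons.IH)
  then show ?case by (rule polyfun_cong) (use peval_pCons[OF polyfun_carrier[OF assms]] in auto)
qed

text \<open>Substitution into a free polynomial. It is applied to polynomial approximations of
  \<open>omega\<close>, to see that a free ball pulls back to a free ball.\<close>

lemma polyfun_comp:
  assumes p: "p \<in> free_polys e" and F: "\<And>x k. x \<in> Md d \<Longrightarrow> k < e \<Longrightarrow> F x ! k = G k x"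
    "\<And>k. k < e \<Longrightarrow> polyfun d (G k)" "\<And>x. x \<in> Md d \<Longrightarrow> nc_size (F x) = nc_size x"
  shows "polyfun d (\<lambda>x. poly_at p (F x))"
proof -
  have w: "polyfun d (\<lambda>x. word_at (F x) w)" if "set w \<subseteq> {..<e}" for w
    using that
  proof (induction w)
    case Nil
    show ?case using polyfun_const[of d 1]
      by (rule polyfun_cong) (auto simp: F(3) intro!: eq_matI)
  next
    case (Cons k w)
    have "polyfun d (\<lambda>x. G k x * word_at (F x) w)" using Cons by (intro polyfun_mult F(2)) auto
    then show ?case by (rule polyfun_cong) (use Cons F(1) in auto)
  qed
  have "polyfun d (\<lambda>x. mat (nc_size x) (nc_size x)
      (\<lambda>(a, b). \<Sum>w\<in>Poly_Mapping.keys p. (Poly_Mapping.lookup p w \<cdot>\<^sub>m word_at (F x) w) $$ (a, b)))"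
    using p by (intro polyfun_sum polyfun_smult w) (auto simp: free_polys_def)
  then show ?thesis
  proof (rule polyfun_cong)
    fix x assume x: "x \<in> Md d"
    have "word_at (F x) u \<in> carrier_mat (nc_size x) (nc_size x)" if "u \<in> Poly_Mapping.keys p" for u
      using polyfun_carrier[OF w x, of u] p that by (auto simp: free_polys_def)
    then have "dim_row (word_at (F x) u) = nc_size x" "dim_col (word_at (F x) u) = nc_size x"
      if "u \<in> Poly_Mapping.keys p" for u using that by auto
    then show "poly_at p (F x) = mat (nc_size x) (nc_size x)
      (\<lambda>(a, b). \<Sum>w\<in>Poly_Mapping.keys p. (Poly_Mapping.lookup p w \<cdot>\<^sub>m word_at (F x) w) $$ (a, b))"
      unfolding poly_at_def F(3)[OF x] by (intro eq_matI) (auto intro!: sum.cong)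
  qed
qed

section \<open>Lipschitz bounds, uniform in the matrix size\<close>

lemma mat_norm_sum_le:
  assumes "finite I" "\<And>i. i \<in> I \<Longrightarrow> M i \<in> carrier_mat n n"
  shows "mat_norm (mat n n (\<lambda>(a, b). \<Sum>i\<in>I. c i * M i $$ (a, b))) \<le> (\<Sum>i\<in>I. cmod (c i) * mat_norm (M i))"
  using assms
proof (induction I)
  case empty
  have "mat n n (\<lambda>(a, b). \<Sum>i\<in>{}. c i * M i $$ (a, b)) = 0\<^sub>m n n" by (intro eq_matI) auto
  then have "mat_norm (mat n n (\<lambda>(a, b). \<Sum>i\<in>{}. c i * M i $$ (a, b))) = 0" by (simp only: mat_norm_zero)
  then show ?case by (simp only: sum.empty order.refl)
next
  case (insert i I)
  let ?S = "mat n n (\<lambda>(a, b). \<Sum>i\<in>I. c i * M i $$ (a, b))"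
  have Mi: "M i \<in> carrier_mat n n" using insert by simp
  have "mat n n (\<lambda>(a, b). \<Sum>i\<in>insert i I. c i * M i $$ (a, b)) = c i \<cdot>\<^sub>m M i + ?S"
    using insert.hyps carrier_matD[OF Mi] by (intro eq_matI) auto
  also have "mat_norm \<dots> \<le> mat_norm (c i \<cdot>\<^sub>m M i) + mat_norm ?S"
    using Mi by (intro mat_norm_add_le[of _ n n]) auto
  also have "\<dots> \<le> cmod (c i) * mat_norm (M i) + (\<Sum>i\<in>I. cmod (c i) * mat_norm (M i))"
    unfolding mat_norm_smult by (intro add_left_mono insert.IH insert.prems) simp
  finally show ?case by (simp only: sum.insert[OF insert.hyps])
qed

text \<open>Induction on the word by a X - b Y = a (X - Y) + (a - b) Y. As R is at least 1, powers
  of R may be raised until both terms fit the same bound.\<close>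

lemma word_at_lipschitz:
  fixes R e :: real
  assumes x: "x \<in> Mn d n" and y: "y \<in> Mn d n" and d: "0 < d" and n: "1 \<le> n" and R: "1 \<le> R" and e: "0 \<le> e"
    and xR: "\<And>k. k < d \<Longrightarrow> mat_norm (x ! k) \<le> R" and yR: "\<And>k. k < d \<Longrightarrow> mat_norm (y ! k) \<le> R"
    and xy: "\<And>k. k < d \<Longrightarrow> mat_norm (x ! k - y ! k) \<le> e"
  shows "set w \<subseteq> {..<d} \<Longrightarrow> mat_norm (word_at y w) \<le> R ^ length w \<and>
    mat_norm (word_at x w - word_at y w) \<le> length w * R ^ length w * e"
proof (induction w)
  case Nil
  have "1\<^sub>m n - 1\<^sub>m n = (0\<^sub>m n n :: complex mat)" by (intro eq_matI) auto
  then have "mat_norm (1\<^sub>m n - 1\<^sub>m n) = 0" by (simp only: mat_norm_zero)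
  then show ?case using mat_norm_one_le by (simp add: nc_size_eq[OF x d] nc_size_eq[OF y d])
next
  case (Cons k w)
  then have k: "k < d" and w: "set w \<subseteq> {..<d}" by auto
  note nx = nc_size_eq[OF x d] and ny = nc_size_eq[OF y d]
  let ?X = "word_at x w" and ?Y = "word_at y w"
  have X: "?X \<in> carrier_mat n n" "?Y \<in> carrier_mat n n"
    using word_at_carrier[OF Mn_Md[OF x n] w] word_at_carrier[OF Mn_Md[OF y n] w] nx ny by auto
  note xk = MnD[OF x k] and yk = MnD[OF y k]
  have IH: "mat_norm ?Y \<le> R ^ length w" "mat_norm (?X - ?Y) \<le> length w * R ^ length w * e"
    using Cons.IH[OF w] by auto
  have "mat_norm (y ! k * ?Y) \<le> mat_norm (y ! k) * mat_norm ?Y" by (rule mat_norm_mult_le[OF yk X(2)])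
  also have "\<dots> \<le> R * R ^ length w" using IH yR[OF k] R by (intro mult_mono) auto
  finally have 1: "mat_norm (y ! k * ?Y) \<le> R ^ length (k # w)" by simp
  have "x ! k * ?X - y ! k * ?Y = x ! k * (?X - ?Y) + (x ! k - y ! k) * ?Y"
  proof -
    have A: "x ! k * (?X - ?Y) = x ! k * ?X - x ! k * ?Y" by (rule mult_minus_distrib_mat[OF xk X])
    have B: "(x ! k - y ! k) * ?Y = x ! k * ?Y - y ! k * ?Y" by (rule minus_mult_distrib_mat[OF xk yk X(2)])
    have C: "P - Q = (P - S) + (S - Q)" if "P \<in> carrier_mat n n" "Q \<in> carrier_mat n n" "S \<in> carrier_mat n n" for P Q S :: "complex mat"
      using that by (intro eq_matI) auto
    show ?thesis unfolding A B by (rule C) (rule mult_carrier_mat xk yk X)+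
  qed
  also have "mat_norm \<dots> \<le> mat_norm (x ! k * (?X - ?Y)) + mat_norm ((x ! k - y ! k) * ?Y)"
    by (rule mat_norm_add_le[of _ n n]) (use xk yk X in auto)
  also have "\<dots> \<le> mat_norm (x ! k) * mat_norm (?X - ?Y) + mat_norm (x ! k - y ! k) * mat_norm ?Y"
    by (intro add_mono mat_norm_mult_le[of _ n n _ n]) (use xk yk X in auto)
  also have "\<dots> \<le> R * (length w * R ^ length w * e) + e * R ^ length w"
    using IH xR[OF k] xy[OF k] R e by (intro add_mono mult_mono) auto
  also have "\<dots> \<le> R * (length w * R ^ length w * e) + e * (R * R ^ length w)"
    using R e by (intro add_left_mono mult_left_mono) auto
  also have "\<dots> = length (k # w) * R ^ length (k # w) * e" by (simp add: algebra_simps)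
  finally show ?case using 1 by simp
qed

lemma poly_at_lipschitz:
  assumes d: "0 < d" and p: "p \<in> free_polys d"
  obtains K where "0 \<le> K" "\<And>n x y e. x \<in> Mn d n \<Longrightarrow> y \<in> Mn d n \<Longrightarrow> 1 \<le> n \<Longrightarrow> 0 \<le> e \<Longrightarrow>
    (\<And>k. k < d \<Longrightarrow> mat_norm (x ! k) \<le> R) \<Longrightarrow> (\<And>k. k < d \<Longrightarrow> mat_norm (y ! k) \<le> R) \<Longrightarrow>
    (\<And>k. k < d \<Longrightarrow> mat_norm (x ! k - y ! k) \<le> e) \<Longrightarrow> mat_norm (poly_at p x - poly_at p y) \<le> K * e"
proof -
  define S where "S = max R 1"
  define K where "K = (\<Sum>w\<in>Poly_Mapping.keys p. cmod (Poly_Mapping.lookup p w) * (length w * S ^ length w))"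
  show ?thesis
  proof (rule that[of K])
    show "0 \<le> K" by (auto simp: K_def S_def intro!: sum_nonneg mult_nonneg_nonneg)
    fix n x y and e :: real
    assume x: "x \<in> Mn d n" and y: "y \<in> Mn d n" and n: "1 \<le> n" and e: "0 \<le> e"
      and xR: "\<And>k. k < d \<Longrightarrow> mat_norm (x ! k) \<le> R" and yR: "\<And>k. k < d \<Longrightarrow> mat_norm (y ! k) \<le> R"
      and xy: "\<And>k. k < d \<Longrightarrow> mat_norm (x ! k - y ! k) \<le> e"
    note nx = nc_size_eq[OF x d] and ny = nc_size_eq[OF y d]
    have W: "word_at x w \<in> carrier_mat n n" "word_at y w \<in> carrier_mat n n"
      "mat_norm (word_at x w - word_at y w) \<le> length w * S ^ length w * e" if "w \<in> Poly_Mapping.keys p" for w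
    proof -
      have w: "set w \<subseteq> {..<d}" using that p by (auto simp: free_polys_def)
      show "word_at x w \<in> carrier_mat n n" "word_at y w \<in> carrier_mat n n"
        using word_at_carrier[OF Mn_Md[OF x n] w] word_at_carrier[OF Mn_Md[OF y n] w] nx ny by auto
      have "mat_norm (x ! k) \<le> S" "mat_norm (y ! k) \<le> S" if "k < d" for k
        using xR[OF that] yR[OF that] by (auto simp: S_def)
      then show "mat_norm (word_at x w - word_at y w) \<le> length w * S ^ length w * e"
        using word_at_lipschitz[OF x y d n _ e _ _ xy w, of S] by (auto simp: S_def)
    qed
    have "poly_at p x - poly_at p y = mat n n (\<lambda>(a, b). \<Sum>w\<in>Poly_Mapping.keys p.
        Poly_Mapping.lookup p w * (word_at x w - word_at y w) $$ (a, b))"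
    proof (rule eq_matI, unfold dim_row_mat dim_col_mat)
      fix a b assume ab: "a < n" "b < n"
      have "(word_at x w - word_at y w) $$ (a, b) = word_at x w $$ (a, b) - word_at y w $$ (a, b)"
        if "w \<in> Poly_Mapping.keys p" for w using W(1,2)[OF that] ab by auto
      then show "(poly_at p x - poly_at p y) $$ (a, b) = mat n n (\<lambda>(a, b). \<Sum>w\<in>Poly_Mapping.keys p.
        Poly_Mapping.lookup p w * (word_at x w - word_at y w) $$ (a, b)) $$ (a, b)"
        using ab nx ny by (simp add: poly_at_def sum_subtractf[symmetric] right_diff_distrib)
    qed (auto simp: poly_at_def nx ny)
    also have "mat_norm \<dots> \<le> (\<Sum>w\<in>Poly_Mapping.keys p. cmod (Poly_Mapping.lookup p w) * mat_norm (word_at x w - word_at y w))"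
    proof (rule mat_norm_sum_le)
      fix w assume "w \<in> Poly_Mapping.keys p"
      from W(1,2)[OF this] show "word_at x w - word_at y w \<in> carrier_mat n n" by auto
    qed simp
    also have "\<dots> \<le> (\<Sum>w\<in>Poly_Mapping.keys p. cmod (Poly_Mapping.lookup p w) * (length w * S ^ length w * e))"
      by (intro sum_mono mult_left_mono W(3)) auto
    also have "\<dots> = K * e" by (simp add: K_def sum_distrib_right mult.assoc)
    finally show "mat_norm (poly_at p x - poly_at p y) \<le> K * e" .
  qed
qed

section \<open>Block matrices\<close>

text \<open>The shape of \<open>poly_mat_at\<close> with arbitrary blocks. Blocks form a function of
  the two block indices, so that rearranging blocks means changing this function.\<close>

definition blk :: "nat \<Rightarrow> nat \<Rightarrow> nat \<Rightarrow> (nat \<Rightarrow> nat \<Rightarrow> complex mat) \<Rightarrow> complex mat" where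
  "blk r s n F = mat (r * n) (s * n) (\<lambda>(i, j). F (i div n) (j div n) $$ (i mod n, j mod n))"

lemma poly_mat_at_blk:
  "poly_mat_at \<delta> x = blk (dim_row \<delta>) (dim_col \<delta>) (nc_size x) (\<lambda>I J. poly_at (\<delta> $$ (I, J)) x)"
  by (simp add: poly_mat_at_def blk_def Let_def)

lemma blk_carrier [simp]: "blk r s n F \<in> carrier_mat (r * n) (s * n)"
  by (simp add: blk_def)

lemma div_mod_less: "i < r * n \<Longrightarrow> i div n < r \<and> i mod n < n" for i r n :: nat
  by (metis less_mult_imp_div_less mod_less_divisor mult_0_right not_gr_zero not_less0)

lemma blk_cong:
  assumes "\<And>I J a b. I < r \<Longrightarrow> J < s \<Longrightarrow> a < n \<Longrightarrow> b < n \<Longrightarrow> F I J $$ (a, b) = G I J $$ (a, b)"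
  shows "blk r s n F = blk r s n G"
  unfolding blk_def using div_mod_less by (intro eq_matI) (auto intro!: assms)

lemma sum_blocks:
  fixes f :: "nat \<Rightarrow> nat \<Rightarrow> 'a :: comm_monoid_add"
  assumes "0 < n"
  shows "(\<Sum>i<r * n. f (i div n) (i mod n)) = (\<Sum>I<r. \<Sum>a<n. f I a)"
proof -
  have "(\<Sum>i<r * n. f (i div n) (i mod n)) = (\<Sum>I<r. \<Sum>i = I * n..<I * n + n. f (i div n) (i mod n))"
    by (rule sum.nat_group[symmetric])
  also have "\<dots> = (\<Sum>I<r. \<Sum>a<n. f I a)"
  proof (rule sum.cong[OF refl])
    fix I
    have "(\<Sum>i = I * n..<I * n + n. f (i div n) (i mod n))
        = (\<Sum>a = 0..<n. f ((a + I * n) div n) ((a + I * n) mod n))"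
      using sum.shift_bounds_nat_ivl[of "\<lambda>i. f (i div n) (i mod n)" 0 "I * n" n] by (simp add: add.commute)
    then show "(\<Sum>i = I * n..<I * n + n. f (i div n) (i mod n)) = (\<Sum>a<n. f I a)"
      using assms by (simp add: atLeast0LessThan)
  qed
  finally show ?thesis .
qed

text \<open>Testing on doubly indexed vectors makes \<open>div\<close> and \<open>mod\<close>
  disappear. Regrouping blocks, including the shuffle that relates \<delta>(x \<oplus> y) to
  \<delta>(x) \<oplus> \<delta>(y), becomes a matter of splitting sums.\<close>

lemma blk_norm_le_iff:
  assumes n: "0 < n" and c: "0 \<le> c"
  shows "mat_norm (blk r s n F) \<le> c \<longleftrightarrow>
    (\<forall>v. (\<Sum>I<r. \<Sum>a<n. (cmod (\<Sum>J<s. \<Sum>b<n. F I J $$ (a, b) * v J b))\<^sup>2)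
       \<le> c\<^sup>2 * (\<Sum>J<s. \<Sum>b<n. (cmod (v J b))\<^sup>2))" (is "_ \<longleftrightarrow> (\<forall>v. ?P v)")
proof -
  have L: "mat_norm (blk r s n F) \<le> c \<longleftrightarrow> (\<forall>w::nat \<Rightarrow> complex.
    (\<Sum>i<r * n. (cmod (\<Sum>j<s * n. F (i div n) (j div n) $$ (i mod n, j mod n) * w j))\<^sup>2)
      \<le> c\<^sup>2 * (\<Sum>j<s * n. (cmod (w j))\<^sup>2))" (is "_ \<longleftrightarrow> (\<forall>w. ?Q w)")
    unfolding blk_def by (rule mat_norm_le_iff[OF c])
  have QP: "?Q (\<lambda>j. v (j div n) (j mod n)) \<longleftrightarrow> ?P v" for v
  proof -
    have "(\<Sum>j<s * n. F I (j div n) $$ (a, j mod n) * v (j div n) (j mod n)) = (\<Sum>J<s. \<Sum>b<n. F I J $$ (a, b) * v J b)" for I a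
      by (rule sum_blocks[OF n, of "\<lambda>J b. F I J $$ (a, b) * v J b"])
    moreover have "(\<Sum>j<s * n. (cmod (v (j div n) (j mod n)))\<^sup>2) = (\<Sum>J<s. \<Sum>b<n. (cmod (v J b))\<^sup>2)"
      by (rule sum_blocks[OF n, of "\<lambda>J b. (cmod (v J b))\<^sup>2"])
    moreover have "(\<Sum>i<r * n. (cmod (\<Sum>J<s. \<Sum>b<n. F (i div n) J $$ (i mod n, b) * v J b))\<^sup>2)
        = (\<Sum>I<r. \<Sum>a<n. (cmod (\<Sum>J<s. \<Sum>b<n. F I J $$ (a, b) * v J b))\<^sup>2)"
      by (rule sum_blocks[OF n, of "\<lambda>I a. (cmod (\<Sum>J<s. \<Sum>b<n. F I J $$ (a, b) * v J b))\<^sup>2"])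
    ultimately show ?thesis by simp
  qed
  have "(\<forall>w. ?Q w) \<longleftrightarrow> (\<forall>v. ?P v)"
  proof
    assume Q: "\<forall>w. ?Q w"
    show "\<forall>v. ?P v" by (rule allI, rule iffD1[OF QP], rule spec[OF Q])
  next
    assume P: "\<forall>v. ?P v"
    show "\<forall>w. ?Q w"
    proof
      fix w :: "nat \<Rightarrow> complex"
      \<comment> \<open>Every flat vector w comes from a doubly indexed one, because
        \<open>(j div n) * n + j mod n\<close> is j.\<close>
      have "?Q (\<lambda>j. w ((j div n) * n + j mod n))"
        by (rule iffD2[OF QP[of "\<lambda>J b. w (J * n + b)"]], rule spec[OF P])
      then show "?Q w" by (simp only: div_mult_mod_eq)
    qed
  qed
  then show ?thesis using L by simp
qed

lemma sum_lessThan_add: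
  fixes f :: "nat \<Rightarrow> 'a :: comm_monoid_add"
  shows "(\<Sum>i<m + n. f i) = (\<Sum>i<m. f i) + (\<Sum>i<n. f (m + i))"
  by (induction n) (auto simp: algebra_simps)

text \<open>Up to permutations of rows and columns, a block matrix of direct sums is the direct sum
  of two block matrices. The permutations appear here as splitting the inner index at n.\<close>

lemma blk_norm_dsum_le:
  assumes n: "0 < n" and m: "0 < m"
    and F: "\<And>I J. I < r \<Longrightarrow> J < s \<Longrightarrow> F I J \<in> carrier_mat n n"
    and G: "\<And>I J. I < r \<Longrightarrow> J < s \<Longrightarrow> G I J \<in> carrier_mat m m"
    and le: "mat_norm (blk r s n F) \<le> c" "mat_norm (blk r s m G) \<le> c"
  shows "mat_norm (blk r s (n + m) (\<lambda>I J. dsum_mat (F I J) (G I J))) \<le> c"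
proof -
  have c: "0 \<le> c" using le(1) mat_norm_nonneg order_trans by blast
  have nm: "0 < n + m" using n by simp
  show ?thesis
    unfolding blk_norm_le_iff[OF nm c]
  proof
    fix v :: "nat \<Rightarrow> nat \<Rightarrow> complex"
    let ?w = "\<lambda>J b. v J (n + b)"
    note ix = dsum_index[OF F G]
    have 1: "(\<Sum>J<s. \<Sum>b<n + m. dsum_mat (F I J) (G I J) $$ (a, b) * v J b) = (\<Sum>J<s. \<Sum>b<n. F I J $$ (a, b) * v J b)"
      if "I < r" "a < n" for I a
    proof (rule sum.cong[OF refl])
      fix J assume "J \<in> {..<s}"
      then have "(\<Sum>b<n. dsum_mat (F I J) (G I J) $$ (a, b) * v J b) = (\<Sum>b<n. F I J $$ (a, b) * v J b)"
        "(\<Sum>b<m. dsum_mat (F I J) (G I J) $$ (a, n + b) * v J (n + b)) = 0"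
        using that ix[of I J I J a] by (auto intro!: sum.cong sum.neutral)
      then show "(\<Sum>b<n + m. dsum_mat (F I J) (G I J) $$ (a, b) * v J b) = (\<Sum>b<n. F I J $$ (a, b) * v J b)"
        by (simp add: sum_lessThan_add)
    qed
    have 2: "(\<Sum>J<s. \<Sum>b<n + m. dsum_mat (F I J) (G I J) $$ (n + a, b) * v J b) = (\<Sum>J<s. \<Sum>b<m. G I J $$ (a, b) * ?w J b)"
      if "I < r" "a < m" for I a
    proof (rule sum.cong[OF refl])
      fix J assume "J \<in> {..<s}"
      then have "(\<Sum>b<n. dsum_mat (F I J) (G I J) $$ (n + a, b) * v J b) = 0"
        "(\<Sum>b<m. dsum_mat (F I J) (G I J) $$ (n + a, n + b) * v J (n + b)) = (\<Sum>b<m. G I J $$ (a, b) * ?w J b)"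
        using that ix[of I J I J "n + a"] by (auto intro!: sum.cong sum.neutral)
      then show "(\<Sum>b<n + m. dsum_mat (F I J) (G I J) $$ (n + a, b) * v J b) = (\<Sum>b<m. G I J $$ (a, b) * ?w J b)"
        by (simp add: sum_lessThan_add)
    qed
    have "(\<Sum>I<r. \<Sum>a<n + m. (cmod (\<Sum>J<s. \<Sum>b<n + m. dsum_mat (F I J) (G I J) $$ (a, b) * v J b))\<^sup>2)
      = (\<Sum>I<r. \<Sum>a<n. (cmod (\<Sum>J<s. \<Sum>b<n. F I J $$ (a, b) * v J b))\<^sup>2)
        + (\<Sum>I<r. \<Sum>a<m. (cmod (\<Sum>J<s. \<Sum>b<m. G I J $$ (a, b) * ?w J b))\<^sup>2)"
      unfolding sum.distrib[symmetric]
    proof (rule sum.cong[OF refl])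
      fix I assume "I \<in> {..<r}"
      then have I: "I < r" by simp
      show "(\<Sum>a<n + m. (cmod (\<Sum>J<s. \<Sum>b<n + m. dsum_mat (F I J) (G I J) $$ (a, b) * v J b))\<^sup>2)
        = (\<Sum>a<n. (cmod (\<Sum>J<s. \<Sum>b<n. F I J $$ (a, b) * v J b))\<^sup>2)
          + (\<Sum>a<m. (cmod (\<Sum>J<s. \<Sum>b<m. G I J $$ (a, b) * ?w J b))\<^sup>2)"
        unfolding sum_lessThan_add[where f = "\<lambda>a. (cmod (\<Sum>J<s. \<Sum>b<n + m. dsum_mat (F I J) (G I J) $$ (a, b) * v J b))\<^sup>2"]
        by (intro arg_cong2[of _ _ _ _ "(+)"] sum.cong refl) (simp_all only: 1[OF I] 2[OF I] lessThan_iff)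
    qed
    also have "\<dots> \<le> c\<^sup>2 * (\<Sum>J<s. \<Sum>b<n. (cmod (v J b))\<^sup>2) + c\<^sup>2 * (\<Sum>J<s. \<Sum>b<m. (cmod (?w J b))\<^sup>2)"
      using le[unfolded blk_norm_le_iff[OF n c] blk_norm_le_iff[OF m c]]
      by (intro add_mono) (erule spec[where x = v], erule spec[where x = ?w])
    also have "\<dots> = c\<^sup>2 * (\<Sum>J<s. \<Sum>b<n + m. (cmod (v J b))\<^sup>2)"
      by (simp add: sum_lessThan_add sum.distrib distrib_left)
    finally show "(\<Sum>I<r. \<Sum>a<n + m. (cmod (\<Sum>J<s. \<Sum>b<n + m. dsum_mat (F I J) (G I J) $$ (a, b) * v J b))\<^sup>2)
      \<le> c\<^sup>2 * (\<Sum>J<s. \<Sum>b<n + m. (cmod (v J b))\<^sup>2)" .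
  qed
qed

text \<open>The two diagonal parts act on separate coordinates, so the norm of the whole is the
  larger of their norms. This turns the intersection of two free balls into one free ball.\<close>

lemma blk_norm_diag_le_iff:
  assumes n: "0 < n" and c: "0 \<le> c"
  shows "mat_norm (blk (r + r') (s + s') n
      (\<lambda>I J. if I < r then if J < s then F I J else 0\<^sub>m n n else if J < s then 0\<^sub>m n n else G (I - r) (J - s))) \<le> c
    \<longleftrightarrow> mat_norm (blk r s n F) \<le> c \<and> mat_norm (blk r' s' n G) \<le> c" (is "mat_norm (blk _ _ _ ?H) \<le> c \<longleftrightarrow> ?R")
proof -
  have 1: "(\<Sum>J<s + s'. \<Sum>b<n. ?H I J $$ (a, b) * v J b) = (\<Sum>J<s. \<Sum>b<n. F I J $$ (a, b) * v J b)"
    if "I < r" "a < n" for I a and v :: "nat \<Rightarrow> nat \<Rightarrow> complex"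
    using that by (simp add: sum_lessThan_add)
  have 2: "(\<Sum>J<s + s'. \<Sum>b<n. ?H (r + I) J $$ (a, b) * v J b) = (\<Sum>J<s'. \<Sum>b<n. G I J $$ (a, b) * v (s + J) b)"
    if "I < r'" "a < n" for I a and v :: "nat \<Rightarrow> nat \<Rightarrow> complex"
    using that by (simp add: sum_lessThan_add)
  have L: "(\<Sum>I<r + r'. \<Sum>a<n. (cmod (\<Sum>J<s + s'. \<Sum>b<n. ?H I J $$ (a, b) * v J b))\<^sup>2)
    = (\<Sum>I<r. \<Sum>a<n. (cmod (\<Sum>J<s. \<Sum>b<n. F I J $$ (a, b) * v J b))\<^sup>2)
      + (\<Sum>I<r'. \<Sum>a<n. (cmod (\<Sum>J<s'. \<Sum>b<n. G I J $$ (a, b) * v (s + J) b))\<^sup>2)" for v :: "nat \<Rightarrow> nat \<Rightarrow> complex"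
    unfolding sum_lessThan_add[of _ r r']
  proof (rule arg_cong2[of _ _ _ _ "(+)"])
    show "(\<Sum>I<r. \<Sum>a<n. (cmod (\<Sum>J<s + s'. \<Sum>b<n. ?H I J $$ (a, b) * v J b))\<^sup>2)
      = (\<Sum>I<r. \<Sum>a<n. (cmod (\<Sum>J<s. \<Sum>b<n. F I J $$ (a, b) * v J b))\<^sup>2)"
      by (rule sum.cong[OF refl], rule sum.cong[OF refl], rule arg_cong[of _ _ "\<lambda>z. (cmod z)\<^sup>2"], rule 1) auto
    show "(\<Sum>I<r'. \<Sum>a<n. (cmod (\<Sum>J<s + s'. \<Sum>b<n. ?H (r + I) J $$ (a, b) * v J b))\<^sup>2)
      = (\<Sum>I<r'. \<Sum>a<n. (cmod (\<Sum>J<s'. \<Sum>b<n. G I J $$ (a, b) * v (s + J) b))\<^sup>2)"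
      by (rule sum.cong[OF refl], rule sum.cong[OF refl], rule arg_cong[of _ _ "\<lambda>z. (cmod z)\<^sup>2"], rule 2) auto
  qed
  define A where "A v = (\<Sum>I<r. \<Sum>a<n. (cmod (\<Sum>J<s. \<Sum>b<n. F I J $$ (a, b) * v J b))\<^sup>2)" for v :: "nat \<Rightarrow> nat \<Rightarrow> complex"
  define B where "B v = (\<Sum>I<r'. \<Sum>a<n. (cmod (\<Sum>J<s'. \<Sum>b<n. G I J $$ (a, b) * v J b))\<^sup>2)" for v :: "nat \<Rightarrow> nat \<Rightarrow> complex"
  define X where "X v = (\<Sum>J<s. \<Sum>b<n. (cmod (v J b))\<^sup>2)" for v :: "nat \<Rightarrow> nat \<Rightarrow> complex"
  define Y where "Y v = (\<Sum>J<s'. \<Sum>b<n. (cmod (v J b))\<^sup>2)" for v :: "nat \<Rightarrow> nat \<Rightarrow> complex"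
  \<comment> \<open>Test vectors supported on one of the two groups of columns isolate the bounds
    for F and G.\<close>
  have AX: "A (\<lambda>J b. if J < s then v J b else 0) = A v" "X (\<lambda>J b. if J < s then v J b else 0) = X v"
    "A (\<lambda>J b. if J < s then 0 else w J b) = 0" "X (\<lambda>J b. if J < s then 0 else w J b) = 0" for v w
    by (simp_all add: A_def X_def)
  have BY: "B (\<lambda>J b. 0) = 0" "Y (\<lambda>J b. 0) = 0" by (simp_all add: B_def Y_def)
  have "(\<forall>v. A v + B (\<lambda>J. v (s + J)) \<le> c\<^sup>2 * X v + c\<^sup>2 * Y (\<lambda>J. v (s + J))) \<longleftrightarrow>
    (\<forall>v. A v \<le> c\<^sup>2 * X v) \<and> (\<forall>v. B v \<le> c\<^sup>2 * Y v)" (is "?l \<longleftrightarrow> _")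
  proof (intro iffI conjI allI)
    fix v assume ?l
    from spec[OF this, of "\<lambda>J b. if J < s then v J b else 0"]
    show "A v \<le> c\<^sup>2 * X v" by (simp add: AX BY)
  next
    fix v assume ?l
    from spec[OF this, of "\<lambda>J b. if J < s then 0 else v (J - s) b"]
    show "B v \<le> c\<^sup>2 * Y v" by (simp add: AX)
  next
    fix v assume a: "(\<forall>v. A v \<le> c\<^sup>2 * X v) \<and> (\<forall>v. B v \<le> c\<^sup>2 * Y v)"
    show "A v + B (\<lambda>J. v (s + J)) \<le> c\<^sup>2 * X v + c\<^sup>2 * Y (\<lambda>J. v (s + J))"
      using a by (intro add_mono) blast+
  qed
  then show ?thesis
    unfolding blk_norm_le_iff[OF n c] L
    unfolding sum_lessThan_add[of _ s s'] distrib_left A_def B_def X_def Y_def .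
qed

lemma L2_set_sum_le:
  "finite K \<Longrightarrow> L2_set (\<lambda>a. cmod (\<Sum>J\<in>K. f J a)) A \<le> (\<Sum>J\<in>K. L2_set (\<lambda>a. cmod (f J a)) A)"
proof (induction K rule: finite_induct)
  case (insert J K)
  have "L2_set (\<lambda>a. cmod (\<Sum>J\<in>insert J K. f J a)) A \<le> L2_set (\<lambda>a. cmod (f J a) + cmod (\<Sum>J\<in>K. f J a)) A"
    using insert by (intro L2_set_mono) (auto intro: norm_triangle_ineq)
  also have "\<dots> \<le> L2_set (\<lambda>a. cmod (f J a)) A + L2_set (\<lambda>a. cmod (\<Sum>J\<in>K. f J a)) A"
    by (rule L2_set_triangle_ineq)
  finally show ?case using insert by simp
qed (simp add: L2_set_0')

text \<open>Crude, but independent of n, which suffices to carry Lipschitz bounds from the entries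
  of \<open>\<delta>\<close> over to \<open>poly_mat_at \<delta>\<close>.\<close>

lemma blk_norm_le_sum:
  assumes n: "0 < n" and F: "\<And>I J. I < r \<Longrightarrow> J < s \<Longrightarrow> F I J \<in> carrier_mat n n"
  shows "mat_norm (blk r s n F) \<le> (\<Sum>I<r. \<Sum>J<s. mat_norm (F I J))" (is "_ \<le> ?c")
proof -
  have c: "0 \<le> ?c" by (auto intro!: sum_nonneg)
  show ?thesis
    unfolding blk_norm_le_iff[OF n c]
  proof
    fix v :: "nat \<Rightarrow> nat \<Rightarrow> complex"
    define T where "T = sqrt (\<Sum>J<s. \<Sum>b<n. (cmod (v J b))\<^sup>2)"
    have T: "T\<^sup>2 = (\<Sum>J<s. \<Sum>b<n. (cmod (v J b))\<^sup>2)" "0 \<le> T"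
      by (auto simp: T_def intro!: sum_nonneg)
    define V where "V = (\<lambda>J. Matrix.vec n (v J))"
    have V: "V J \<in> carrier_vec n" for J by (simp add: V_def)
    have VT: "vnorm (V J) \<le> T" if "J < s" for J
    proof -
      have "(\<Sum>b<n. (cmod (v J b))\<^sup>2) \<le> (\<Sum>J<s. \<Sum>b<n. (cmod (v J b))\<^sup>2)"
        using that by (intro member_le_sum[of J "{..<s}" "\<lambda>J. \<Sum>b<n. (cmod (v J b))\<^sup>2"]) (auto intro!: sum_nonneg)
      then show ?thesis by (simp add: V_def vnorm_def L2_set_def T_def)
    qed
    define u where "u = (\<lambda>I. L2_set (\<lambda>a. cmod (\<Sum>J<s. \<Sum>b<n. F I J $$ (a, b) * v J b)) {..<n})"
    have u: "u I \<le> (\<Sum>J<s. mat_norm (F I J)) * T" if I: "I < r" for I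
    proof -
      have "u I \<le> (\<Sum>J<s. L2_set (\<lambda>a. cmod (\<Sum>b<n. F I J $$ (a, b) * v J b)) {..<n})"
        unfolding u_def by (rule L2_set_sum_le) simp
      also have "\<dots> = (\<Sum>J<s. vnorm (F I J *\<^sub>v V J))"
      proof (intro sum.cong refl)
        fix J assume "J \<in> {..<s}"
        then have FJ: "F I J \<in> carrier_mat n n" using F I by simp
        show "L2_set (\<lambda>a. cmod (\<Sum>b<n. F I J $$ (a, b) * v J b)) {..<n} = vnorm (F I J *\<^sub>v V J)"
          unfolding vnorm_def using FJ
          by (intro L2_set_cong) (auto simp: mat_vec_index V_def simp del: index_mult_mat_vec)
      qed
      also have "\<dots> \<le> (\<Sum>J<s. mat_norm (F I J) * T)"
      proof (intro sum_mono)
        fix J assume J: "J \<in> {..<s}"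
        then have FJ: "F I J \<in> carrier_mat n n" using F I by simp
        have "vnorm (F I J *\<^sub>v V J) \<le> mat_norm (F I J) * vnorm (V J)"
          using FJ V by (intro vnorm_mult_le) auto
        also have "\<dots> \<le> mat_norm (F I J) * T" using VT J by (intro mult_left_mono) auto
        finally show "vnorm (F I J *\<^sub>v V J) \<le> mat_norm (F I J) * T" .
      qed
      finally show ?thesis by (simp add: sum_distrib_right)
    qed
    have u0: "0 \<le> u I" for I by (simp add: u_def)
    have "(\<Sum>I<r. \<Sum>a<n. (cmod (\<Sum>J<s. \<Sum>b<n. F I J $$ (a, b) * v J b))\<^sup>2) = (L2_set u {..<r})\<^sup>2"
      by (simp add: L2_set_def u_def sum_nonneg)
    also have "\<dots> \<le> (\<Sum>I<r. u I)\<^sup>2"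
      by (intro power_mono L2_set_le_sum u0) simp
    also have "\<dots> \<le> (\<Sum>I<r. (\<Sum>J<s. mat_norm (F I J)) * T)\<^sup>2"
      by (intro power_mono sum_mono sum_nonneg u u0) auto
    also have "\<dots> = ?c\<^sup>2 * T\<^sup>2" by (simp add: sum_distrib_right[symmetric] power_mult_distrib)
    finally show "(\<Sum>I<r. \<Sum>a<n. (cmod (\<Sum>J<s. \<Sum>b<n. F I J $$ (a, b) * v J b))\<^sup>2)
      \<le> ?c\<^sup>2 * (\<Sum>J<s. \<Sum>b<n. (cmod (v J b))\<^sup>2)" by (simp only: T(1))
  qed
qed

lemma blk_diff:
  assumes "\<And>I J. I < r \<Longrightarrow> J < s \<Longrightarrow> F I J \<in> carrier_mat n n" "\<And>I J. I < r \<Longrightarrow> J < s \<Longrightarrow> G I J \<in> carrier_mat n n"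
  shows "blk r s n F - blk r s n G = blk r s n (\<lambda>I J. F I J - G I J)"
proof (rule eq_matI, unfold blk_def dim_row_mat dim_col_mat)
  fix i j assume ij: "i < r * n" "j < s * n"
  then have d: "i div n < r" "j div n < s" "i mod n < n" "j mod n < n" using div_mod_less by blast+
  show "(mat (r * n) (s * n) (\<lambda>(i, j). F (i div n) (j div n) $$ (i mod n, j mod n))
      - mat (r * n) (s * n) (\<lambda>(i, j). G (i div n) (j div n) $$ (i mod n, j mod n))) $$ (i, j)
    = mat (r * n) (s * n) (\<lambda>(i, j). (F (i div n) (j div n) - G (i div n) (j div n)) $$ (i mod n, j mod n)) $$ (i, j)"
    using ij d assms(1)[OF d(1,2)] assms(2)[OF d(1,2)] by simp
qed auto

lemma blk_smult:
  assumes "\<And>I J. I < r \<Longrightarrow> J < s \<Longrightarrow> F I J \<in> carrier_mat n n"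
  shows "c \<cdot>\<^sub>m blk r s n F = blk r s n (\<lambda>I J. c \<cdot>\<^sub>m F I J)"
proof (rule eq_matI, unfold blk_def dim_row_mat dim_col_mat)
  fix i j assume ij: "i < r * n" "j < s * n"
  then have d: "i div n < r" "j div n < s" "i mod n < n" "j mod n < n" using div_mod_less by blast+
  show "(c \<cdot>\<^sub>m mat (r * n) (s * n) (\<lambda>(i, j). F (i div n) (j div n) $$ (i mod n, j mod n))) $$ (i, j)
    = mat (r * n) (s * n) (\<lambda>(i, j). (c \<cdot>\<^sub>m F (i div n) (j div n)) $$ (i mod n, j mod n)) $$ (i, j)"
    using ij d assms[OF d(1,2)] by simp
qed auto

lemma blk_one: "A \<in> carrier_mat n n \<Longrightarrow> blk 1 1 n (\<lambda>I J. A) = A"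
  by (intro eq_matI) (auto simp: blk_def)

section \<open>The free topology\<close>

text \<open>\<open>topology\<close> is meaningful only for a family that satisfies the axioms of a
  topology; the refinement property of B provides them for unions of members of B.\<close>

lemma openin_topology_with_base:
  assumes "\<And>U V x. U \<in> B \<Longrightarrow> V \<in> B \<Longrightarrow> x \<in> U \<Longrightarrow> x \<in> V \<Longrightarrow> \<exists>W\<in>B. x \<in> W \<and> W \<subseteq> U \<inter> V"
  shows "openin (topology_with_base B) W \<longleftrightarrow> (\<forall>x\<in>W. \<exists>U\<in>B. x \<in> U \<and> U \<subseteq> W)"
proof -
  have alt: "(arbitrary union_of (\<lambda>U. U \<in> B)) W \<longleftrightarrow> (\<forall>x\<in>W. \<exists>U\<in>B. x \<in> U \<and> U \<subseteq> W)" for W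
    by (auto simp: arbitrary_union_of_alt)
  have "istopology (arbitrary union_of (\<lambda>U. U \<in> B))"
    unfolding istopology_base_eq alt
  proof (intro allI impI ballI)
    fix S T x assume "S \<in> B \<and> T \<in> B" "x \<in> S \<inter> T"
    then show "\<exists>U\<in>B. x \<in> U \<and> U \<subseteq> S \<inter> T" using assms[of S T x] by blast
  qed
  then show ?thesis by (simp add: topology_with_base_def topology_inverse' alt)
qed

text \<open>Members of \<open>free_base\<close> are balls of radius 1, so the polynomials are scaled
  by 1/e.\<close>

lemma polyfun_blk_ball:
  assumes F: "\<And>I J. I < r \<Longrightarrow> J < s \<Longrightarrow> polyfun d (F I J)" and e: "0 < e"
  shows "{x \<in> Md d. mat_norm (blk r s (nc_size x) (\<lambda>I J. F I J x)) < e} \<in> free_base d"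
proof -
  have "\<exists>p. I < r \<longrightarrow> J < s \<longrightarrow> p \<in> free_polys d \<and> (\<forall>x\<in>Md d. poly_at p x = complex_of_real (1 / e) \<cdot>\<^sub>m F I J x)" for I J
    using polyfun_smult[OF F, of I J "complex_of_real (1 / e)"] by (auto simp: polyfun_def)
  then obtain p where p: "\<And>I J. I < r \<Longrightarrow> J < s \<Longrightarrow> p I J \<in> free_polys d"
    "\<And>I J x. I < r \<Longrightarrow> J < s \<Longrightarrow> x \<in> Md d \<Longrightarrow> poly_at (p I J) x = complex_of_real (1 / e) \<cdot>\<^sub>m F I J x"
    by metis
  define \<delta> where "\<delta> = mat r s (\<lambda>(I, J). p I J)"
  have "mat_norm (poly_mat_at \<delta> x) = mat_norm (blk r s (nc_size x) (\<lambda>I J. F I J x)) / e" if x: "x \<in> Md d" for x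
  proof -
    have "poly_mat_at \<delta> x = blk r s (nc_size x) (\<lambda>I J. complex_of_real (1 / e) \<cdot>\<^sub>m F I J x)"
      unfolding poly_mat_at_blk \<delta>_def dim_row_mat dim_col_mat
      by (rule blk_cong) (simp add: p(2)[OF _ _ x])
    also have "\<dots> = complex_of_real (1 / e) \<cdot>\<^sub>m blk r s (nc_size x) (\<lambda>I J. F I J x)"
      by (rule blk_smult[symmetric]) (rule polyfun_carrier[OF F x])
    finally show ?thesis using e by (simp add: mat_norm_smult norm_divide)
  qed
  then have "{x \<in> Md d. mat_norm (blk r s (nc_size x) (\<lambda>I J. F I J x)) < e} = free_ball d \<delta>"
    using e by (auto simp: free_ball_def divide_less_eq)
  moreover have "\<forall>i<dim_row \<delta>. \<forall>j<dim_col \<delta>. \<delta> $$ (i, j) \<in> free_polys d"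
    using p(1) by (simp add: \<delta>_def)
  ultimately show ?thesis unfolding free_base_def by blast
qed

lemma polyfun_ball:
  assumes F: "polyfun d F" and e: "0 < e"
  shows "{x \<in> Md d. mat_norm (F x) < e} \<in> free_base d"
proof -
  have "{x \<in> Md d. mat_norm (F x) < e} = {x \<in> Md d. mat_norm (blk 1 1 (nc_size x) (\<lambda>I J. F x)) < e}"
    using blk_one[OF polyfun_carrier[OF F]] by auto
  then show ?thesis using polyfun_blk_ball[OF _ e, of 1 1 d "\<lambda>I J. F"] F by simp
qed

lemma Md_free_base: "Md d \<in> free_base d"
proof -
  have "polyfun d (\<lambda>x. 0 \<cdot>\<^sub>m 1\<^sub>m (nc_size x))" by (rule polyfun_const)
  from polyfun_ball[OF this, of 1] show ?thesis by (simp add: mat_norm_smult)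
qed

lemma free_baseE:
  assumes "U \<in> free_base d"
  obtains \<delta> where "U = free_ball d \<delta>" "\<And>I J. I < dim_row \<delta> \<Longrightarrow> J < dim_col \<delta> \<Longrightarrow> \<delta> $$ (I, J) \<in> free_polys d"
  using assms by (auto simp: free_base_def)

text \<open>The block diagonal matrix with blocks \<open>\<delta>\<close> and
  \<open>\<epsilon>\<close> has the larger of the two norms, so its ball is the
  intersection.\<close>

lemma free_base_Int:
  assumes d: "0 < d" and "U \<in> free_base d" "V \<in> free_base d"
  shows "U \<inter> V \<in> free_base d"
proof -
  obtain \<delta> where \<delta>: "U = free_ball d \<delta>" "\<And>I J. I < dim_row \<delta> \<Longrightarrow> J < dim_col \<delta> \<Longrightarrow> \<delta> $$ (I, J) \<in> free_polys d"
    using assms(2) by (rule free_baseE) (rule that)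
  obtain \<epsilon> where \<epsilon>: "V = free_ball d \<epsilon>" "\<And>I J. I < dim_row \<epsilon> \<Longrightarrow> J < dim_col \<epsilon> \<Longrightarrow> \<epsilon> $$ (I, J) \<in> free_polys d"
    using assms(3) by (rule free_baseE) (rule that)
  let ?r = "dim_row \<delta>" and ?s = "dim_col \<delta>" and ?r' = "dim_row \<epsilon>" and ?s' = "dim_col \<epsilon>"
  define H where "H = (\<lambda>x I J. if I < ?r then if J < ?s then poly_at (\<delta> $$ (I, J)) x else 0\<^sub>m (nc_size x) (nc_size x)
    else if J < ?s then 0\<^sub>m (nc_size x) (nc_size x) else poly_at (\<epsilon> $$ (I - ?r, J - ?s)) x)"
  have z: "polyfun d (\<lambda>x. 0\<^sub>m (nc_size x) (nc_size x))"
    by (rule polyfun_cong[OF polyfun_const[of d 0]]) (auto intro!: eq_matI)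
  have "polyfun d (\<lambda>x. H x I J)" if "I < ?r + ?r'" "J < ?s + ?s'" for I J
    using z \<delta>(2) \<epsilon>(2)[of "I - ?r" "J - ?s"] that
    by (cases "I < ?r"; cases "J < ?s") (auto simp: H_def intro!: polyfun_poly_at)
  then have base: "{x \<in> Md d. mat_norm (blk (?r + ?r') (?s + ?s') (nc_size x) (H x)) < 1} \<in> free_base d"
    using polyfun_blk_ball[of "?r + ?r'" "?s + ?s'" d "\<lambda>I J x. H x I J" 1] by simp
  have iff: "mat_norm (blk (?r + ?r') (?s + ?s') (nc_size x) (H x)) \<le> c
      \<longleftrightarrow> mat_norm (poly_mat_at \<delta> x) \<le> c \<and> mat_norm (poly_mat_at \<epsilon> x) \<le> c"
    if "x \<in> Md d" "0 \<le> c" for x c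
    using blk_norm_diag_le_iff[OF _ that(2), of "nc_size x" ?r ?r' ?s ?s' "\<lambda>I J. poly_at (\<delta> $$ (I, J)) x" "\<lambda>I J. poly_at (\<epsilon> $$ (I, J)) x"]
      MdE(2)[OF that(1) d] by (simp add: poly_mat_at_blk H_def)
  \<comment> \<open>Strict inequalities follow from the equivalence for \<le> by choosing as bound c
    the norm of the whole in one direction and the maximum of the two norms in the other.\<close>
  have "mat_norm (blk (?r + ?r') (?s + ?s') (nc_size x) (H x)) < 1
      \<longleftrightarrow> mat_norm (poly_mat_at \<delta> x) < 1 \<and> mat_norm (poly_mat_at \<epsilon> x) < 1" if x: "x \<in> Md d" for x
    using iff[OF x mat_norm_nonneg, of "blk (?r + ?r') (?s + ?s') (nc_size x) (H x)"]
      iff[OF x, of "max (mat_norm (poly_mat_at \<delta> x)) (mat_norm (poly_mat_at \<epsilon> x))"] by (auto simp: le_max_iff_disj)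
  then have "U \<inter> V = {x \<in> Md d. mat_norm (blk (?r + ?r') (?s + ?s') (nc_size x) (H x)) < 1}"
    by (auto simp: \<delta>(1) \<epsilon>(1) free_ball_def)
  then show ?thesis using base by simp
qed

lemma free_domain_iff:
  assumes "0 < d"
  shows "free_domain d W \<longleftrightarrow> (\<forall>x\<in>W. \<exists>U\<in>free_base d. x \<in> U \<and> U \<subseteq> W)"
  unfolding free_domain_def free_topology_def
  by (rule openin_topology_with_base) (use free_base_Int[OF assms] in blast)

lemma free_base_subset: "U \<in> free_base d \<Longrightarrow> U \<subseteq> Md d"
  by (auto simp: free_base_def free_ball_def)

lemma free_base_free_domain: "0 < d \<Longrightarrow> U \<in> free_base d \<Longrightarrow> free_domain d U"
  by (auto simp: free_domain_iff)

lemma free_domain_Int: "free_domain d U \<Longrightarrow> free_domain d V \<Longrightarrow> free_domain d (U \<inter> V)"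
  unfolding free_domain_def by (rule openin_Int)

text \<open>Since \<delta>(x \<oplus> y) is a shuffled direct sum, its norm is at most the larger of
  two numbers below 1.\<close>

lemma free_base_nc_set:
  assumes d: "0 < d" and U: "U \<in> free_base d"
  shows "nc_set d U"
proof -
  obtain \<delta> where \<delta>: "U = free_ball d \<delta>" "\<And>I J. I < dim_row \<delta> \<Longrightarrow> J < dim_col \<delta> \<Longrightarrow> \<delta> $$ (I, J) \<in> free_polys d"
    using U by (rule free_baseE) (rule that)
  have "nc_dsum x y \<in> U" if xy: "x \<in> U" "y \<in> U" for x y
  proof -
    have M: "x \<in> Md d" "y \<in> Md d" using xy by (auto simp: \<delta>(1) free_ball_def)
    define c where "c = max (mat_norm (poly_mat_at \<delta> x)) (mat_norm (poly_mat_at \<delta> y))"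
    have c: "c < 1" using xy by (auto simp: c_def \<delta>(1) free_ball_def)
    have "poly_mat_at \<delta> (nc_dsum x y) = blk (dim_row \<delta>) (dim_col \<delta>) (nc_size x + nc_size y)
       (\<lambda>I J. dsum_mat (poly_at (\<delta> $$ (I, J)) x) (poly_at (\<delta> $$ (I, J)) y))"
      unfolding poly_mat_at_blk nc_size_dsum[OF M d]
      by (rule blk_cong) (simp add: poly_at_dsum[OF M d \<delta>(2)])
    also have "mat_norm \<dots> \<le> c"
      by (rule blk_norm_dsum_le)
         (use MdE(2)[OF M(1) d] MdE(2)[OF M(2) d] in \<open>auto simp: c_def poly_mat_at_blk\<close>)
    finally show ?thesis using c nc_dsum_Md[OF M] by (simp add: \<delta>(1) free_ball_def)
  qed
  then show ?thesis using free_base_subset[OF U] by (auto simp: nc_set_def)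
qed

lemma poly_mat_lipschitz:
  assumes d: "0 < d" and \<delta>: "\<And>I J. I < dim_row \<delta> \<Longrightarrow> J < dim_col \<delta> \<Longrightarrow> \<delta> $$ (I, J) \<in> free_polys d"
  obtains K where "0 \<le> K" "\<And>n x y e. x \<in> Mn d n \<Longrightarrow> y \<in> Mn d n \<Longrightarrow> 1 \<le> n \<Longrightarrow> 0 \<le> e \<Longrightarrow>
    (\<And>k. k < d \<Longrightarrow> mat_norm (x ! k) \<le> R) \<Longrightarrow> (\<And>k. k < d \<Longrightarrow> mat_norm (y ! k) \<le> R) \<Longrightarrow>
    (\<And>k. k < d \<Longrightarrow> mat_norm (x ! k - y ! k) \<le> e) \<Longrightarrow> mat_norm (poly_mat_at \<delta> x - poly_mat_at \<delta> y) \<le> K * e"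
proof -
  \<comment> \<open>As a predicate, the Lipschitz property lets one constant be chosen for each
    entry of \<open>\<delta>\<close>.\<close>
  define L where "L p K \<longleftrightarrow> 0 \<le> K \<and> (\<forall>n x y e. x \<in> Mn d n \<longrightarrow> y \<in> Mn d n \<longrightarrow> 1 \<le> n \<longrightarrow> 0 \<le> e \<longrightarrow>
    (\<forall>k<d. mat_norm (x ! k) \<le> R) \<longrightarrow> (\<forall>k<d. mat_norm (y ! k) \<le> R) \<longrightarrow>
    (\<forall>k<d. mat_norm (x ! k - y ! k) \<le> e) \<longrightarrow> mat_norm (poly_at p x - poly_at p y) \<le> K * e)" for p K
  have "\<exists>K. L p K" if p: "p \<in> free_polys d" for p
    by (rule poly_at_lipschitz[OF d p, of R]) (auto simp: L_def)
  then obtain K where K: "\<And>p. p \<in> free_polys d \<Longrightarrow> L p (K p)" by metis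
  define K' where "K' = (\<Sum>I<dim_row \<delta>. \<Sum>J<dim_col \<delta>. K (\<delta> $$ (I, J)))"
  show ?thesis
  proof (rule that[of K'])
    show "0 \<le> K'" unfolding K'_def using K[OF \<delta>] by (intro sum_nonneg) (auto simp: L_def)
    fix n x y and e :: real
    assume a: "x \<in> Mn d n" "y \<in> Mn d n" "1 \<le> n" "0 \<le> e"
      "\<And>k. k < d \<Longrightarrow> mat_norm (x ! k) \<le> R" "\<And>k. k < d \<Longrightarrow> mat_norm (y ! k) \<le> R"
      "\<And>k. k < d \<Longrightarrow> mat_norm (x ! k - y ! k) \<le> e"
    note nx = nc_size_eq[OF a(1) d] and ny = nc_size_eq[OF a(2) d]
    have c: "poly_at p x \<in> carrier_mat n n" "poly_at p y \<in> carrier_mat n n" for p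
      using poly_at_carrier[of p x] poly_at_carrier[of p y] nx ny by auto
    have "poly_mat_at \<delta> x - poly_mat_at \<delta> y
        = blk (dim_row \<delta>) (dim_col \<delta>) n (\<lambda>I J. poly_at (\<delta> $$ (I, J)) x - poly_at (\<delta> $$ (I, J)) y)"
      unfolding poly_mat_at_blk nx ny by (rule blk_diff) (rule c)+
    also have "mat_norm \<dots> \<le> (\<Sum>I<dim_row \<delta>. \<Sum>J<dim_col \<delta>. mat_norm (poly_at (\<delta> $$ (I, J)) x - poly_at (\<delta> $$ (I, J)) y))"
      by (rule blk_norm_le_sum) (use a(3) in simp, rule minus_carrier_mat[OF c(2)])
    also have "\<dots> \<le> (\<Sum>I<dim_row \<delta>. \<Sum>J<dim_col \<delta>. K (\<delta> $$ (I, J)) * e)"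
    proof (intro sum_mono)
      fix I J assume "I \<in> {..<dim_row \<delta>}" "J \<in> {..<dim_col \<delta>}"
      then have "L (\<delta> $$ (I, J)) (K (\<delta> $$ (I, J)))" using K[OF \<delta>] by simp
      then show "mat_norm (poly_at (\<delta> $$ (I, J)) x - poly_at (\<delta> $$ (I, J)) y) \<le> K (\<delta> $$ (I, J)) * e"
        using a by (auto simp: L_def)
    qed
    also have "\<dots> = K' * e" by (simp add: K'_def sum_distrib_right)
    finally show "mat_norm (poly_mat_at \<delta> x - poly_mat_at \<delta> y) \<le> K' * e" .
  qed
qed

text \<open>Openness of a free ball on the level of x, obtained from the Lipschitz bound on a
  bounded set that contains x and the points within distance 1 of it.\<close>

lemma free_base_euclid_nbhd:
  assumes d: "0 < d" and U: "U \<in> free_base d" and x: "x \<in> U" "x \<in> Mn d n" and n: "1 \<le> n"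
  obtains e where "0 < e" "\<And>y. y \<in> Mn d n \<Longrightarrow> (\<And>k. k < d \<Longrightarrow> mat_norm (y ! k - x ! k) < e) \<Longrightarrow> y \<in> U"
proof -
  obtain \<delta> where \<delta>: "U = free_ball d \<delta>" "\<And>I J. I < dim_row \<delta> \<Longrightarrow> J < dim_col \<delta> \<Longrightarrow> \<delta> $$ (I, J) \<in> free_polys d"
    using U by (rule free_baseE) (rule that)
  define R where "R = (\<Sum>k<d. mat_norm (x ! k)) + 1"
  obtain K where K: "0 \<le> K" "\<And>n x y e. x \<in> Mn d n \<Longrightarrow> y \<in> Mn d n \<Longrightarrow> 1 \<le> n \<Longrightarrow> 0 \<le> e \<Longrightarrow>
    (\<And>k. k < d \<Longrightarrow> mat_norm (x ! k) \<le> R) \<Longrightarrow> (\<And>k. k < d \<Longrightarrow> mat_norm (y ! k) \<le> R) \<Longrightarrow>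
    (\<And>k. k < d \<Longrightarrow> mat_norm (x ! k - y ! k) \<le> e) \<Longrightarrow> mat_norm (poly_mat_at \<delta> x - poly_mat_at \<delta> y) \<le> K * e"
    using poly_mat_lipschitz[OF d \<delta>(2), where R = R] by blast
  define t where "t = mat_norm (poly_mat_at \<delta> x)"
  have t: "t < 1" using x by (simp add: t_def \<delta>(1) free_ball_def)
  \<comment> \<open>K e has to be less than the slack 1 - t. The denominator K + 1 is positive even
    for K = 0, and e <= 1 keeps y within radius R.\<close>
  define e where "e = min 1 ((1 - t) / (K + 1))"
  have e: "0 < e" "e \<le> 1" "K * e < 1 - t"
  proof -
    show "0 < e" "e \<le> 1" using t K(1) by (auto simp: e_def)
    have "K * e \<le> K * ((1 - t) / (K + 1))" using K(1) by (intro mult_left_mono) (auto simp: e_def)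
    also have "\<dots> = (1 - t) * (K / (K + 1))" by simp
    also have "\<dots> < (1 - t) * 1" using t K(1) by (intro mult_strict_left_mono) auto
    finally show "K * e < 1 - t" by simp
  qed
  have xR: "mat_norm (x ! k) \<le> R - 1" if "k < d" for k
    using that member_le_sum[of k "{..<d}" "\<lambda>k. mat_norm (x ! k)"] by (simp add: R_def)
  show ?thesis
  proof (rule that[OF e(1)])
    fix y assume y: "y \<in> Mn d n" "\<And>k. k < d \<Longrightarrow> mat_norm (y ! k - x ! k) < e"
    have "mat_norm (y ! k) \<le> R" if k: "k < d" for k
      using mat_norm_triangle_sub[OF MnD[OF y(1) k] MnD[OF x(2) k]] xR[OF k] y(2)[OF k] e(2) by linarith
    moreover have "mat_norm (x ! k) \<le> R" if k: "k < d" for k using xR[OF k] by simp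
    ultimately have L: "mat_norm (poly_mat_at \<delta> y - poly_mat_at \<delta> x) \<le> K * e"
      using e(1) y(2) by (intro K(2)[OF y(1) x(2) n]) (auto intro: less_imp_le)
    have "poly_mat_at \<delta> y \<in> carrier_mat (dim_row \<delta> * n) (dim_col \<delta> * n)"
      "poly_mat_at \<delta> x \<in> carrier_mat (dim_row \<delta> * n) (dim_col \<delta> * n)"
      by (auto simp: poly_mat_at_blk nc_size_eq[OF y(1) d] nc_size_eq[OF x(2) d])
    from mat_norm_triangle_sub[OF this] have "mat_norm (poly_mat_at \<delta> y) < 1"
      using L e(3) unfolding t_def by linarith
    then show "y \<in> U" using Mn_Md[OF y(1) n] by (simp add: \<delta>(1) free_ball_def)
  qed
qed

section \<open>Continuity of bounded nc-functions on each level\<close>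

lemma nc_functionD:
  assumes "nc_function d D f"
  shows "nc_set d D" "\<And>n x. 1 \<le> n \<Longrightarrow> x \<in> D \<Longrightarrow> x \<in> Mn d n \<Longrightarrow> f x \<in> carrier_mat n n"
    "\<And>x y. x \<in> D \<Longrightarrow> y \<in> D \<Longrightarrow> f (nc_dsum x y) = dsum_mat (f x) (f y)"
    "\<And>n x s. 1 \<le> n \<Longrightarrow> x \<in> D \<Longrightarrow> x \<in> Mn d n \<Longrightarrow> s \<in> carrier_mat n n \<Longrightarrow> invertible_mat s \<Longrightarrow>
      nc_conj s x \<in> D \<Longrightarrow> f (nc_conj s x) = mat_inv s * f x * s"
  using assms by (auto simp: nc_function_def graded_on_def)

lemma nc_function_subset: "nc_function d D f \<Longrightarrow> nc_set d E \<Longrightarrow> E \<subseteq> D \<Longrightarrow> nc_function d E f"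
  unfolding nc_function_def graded_on_def by blast

text \<open>The inverse shear has -c in place of c, which puts c (P - Q) into the corner. The
  formula is applied twice: to the components of a point and to the value of an nc-function
  there.\<close>

lemma shear_conj:
  fixes P Q :: "complex mat" and c :: complex
  assumes P: "P \<in> carrier_mat n n" and Q: "Q \<in> carrier_mat n n"
  defines "s \<equiv> four_block_mat (1\<^sub>m n) (c \<cdot>\<^sub>m 1\<^sub>m n) (0\<^sub>m n n) (1\<^sub>m n)"
  shows "s \<in> carrier_mat (n + n) (n + n)" "invertible_mat s"
    "mat_inv s * dsum_mat P Q * s = four_block_mat P (c \<cdot>\<^sub>m (P - Q)) (0\<^sub>m n n) Q"
proof -
  let ?t = "four_block_mat (1\<^sub>m n) ((- c) \<cdot>\<^sub>m 1\<^sub>m n) (0\<^sub>m n n) (1\<^sub>m n)"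
  show s: "s \<in> carrier_mat (n + n) (n + n)" by (simp add: s_def)
  have t: "?t \<in> carrier_mat (n + n) (n + n)" by simp
  have c0: "c \<cdot>\<^sub>m 1\<^sub>m n + (- c) \<cdot>\<^sub>m 1\<^sub>m n = 0\<^sub>m n n" "(- c) \<cdot>\<^sub>m 1\<^sub>m n + c \<cdot>\<^sub>m 1\<^sub>m n = 0\<^sub>m n n"
    by (auto intro!: eq_matI)
  have st: "s * ?t = 1\<^sub>m (n + n)"
    unfolding s_def by (subst mult_four_block_mat[of _ n n _ n _ n _ _ n _ n]) (simp_all add: c0)
  have ts: "?t * s = 1\<^sub>m (n + n)"
    unfolding s_def by (subst mult_four_block_mat[of _ n n _ n _ n _ _ n _ n]) (simp_all add: c0)
  show "invertible_mat s"
    unfolding invertible_mat_def inverts_mat_def using s t st ts by (auto intro!: exI[of _ ?t])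
  have inv: "mat_inv s = ?t" by (rule mat_inv_eqI[OF s t st])
  have "?t * dsum_mat P Q = four_block_mat P ((- c) \<cdot>\<^sub>m Q) (0\<^sub>m n n) Q"
    unfolding dsum_mat_def using P Q
    by (subst mult_four_block_mat[of _ n n _ n _ n _ _ n _ n]) (simp_all add: mult_smult_one)
  then have "?t * dsum_mat P Q * s = four_block_mat P ((- c) \<cdot>\<^sub>m Q) (0\<^sub>m n n) Q * s" by simp
  also have "\<dots> = four_block_mat P (c \<cdot>\<^sub>m P + (- c) \<cdot>\<^sub>m Q) (0\<^sub>m n n) Q"
    unfolding s_def using P Q
    by (subst mult_four_block_mat[of _ n n _ n _ n _ _ n _ n]) (simp_all add: mult_smult_one_right)
  also have "c \<cdot>\<^sub>m P + (- c) \<cdot>\<^sub>m Q = c \<cdot>\<^sub>m (P - Q)" using P Q by (auto intro!: eq_matI simp: algebra_simps)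
  finally show "mat_inv s * dsum_mat P Q * s = four_block_mat P (c \<cdot>\<^sub>m (P - Q)) (0\<^sub>m n n) Q"
    by (simp only: inv)
qed

text \<open>Conjugating \<open>y \<oplus> x\<close> by a shear gives \<open>[y, c (y - x); 0, x]\<close>, which is close to \<open>x \<oplus> x\<close> when \<open>y\<close>
  is close to \<open>x\<close>; the value there contains the block \<open>c (g(y) - g(x))\<close>, which is bounded.\<close>

lemma nc_function_continuous:
  assumes d: "0 < d" and U: "U \<in> free_base d" and g: "nc_function d U g" and C: "\<And>y. y \<in> U \<Longrightarrow> mat_norm (g y) \<le> C"
    and x: "x \<in> U" "x \<in> Mn d n" and n: "1 \<le> n" and e: "0 < e"
  obtains \<eta> where "0 < \<eta>" "\<And>y. y \<in> Mn d n \<Longrightarrow> (\<And>k. k < d \<Longrightarrow> mat_norm (y ! k - x ! k) < \<eta>) \<Longrightarrow>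
    y \<in> U \<and> mat_norm (g y - g x) < e"
proof -
  note g = nc_functionD[OF g]
  have C0: "0 \<le> C" using C[OF x(1)] mat_norm_nonneg order_trans by blast
  obtain e1 where e1: "0 < e1" "\<And>y. y \<in> Mn d n \<Longrightarrow> (\<And>k. k < d \<Longrightarrow> mat_norm (y ! k - x ! k) < e1) \<Longrightarrow> y \<in> U"
    using free_base_euclid_nbhd[OF d U x n] by blast
  have xx: "nc_dsum x x \<in> U" "nc_dsum x x \<in> Mn d (n + n)"
    using g(1) x nc_dsum_Mn[OF x(2) x(2)] by (auto simp: nc_set_def)
  obtain e2 where e2: "0 < e2" "\<And>y. y \<in> Mn d (n + n) \<Longrightarrow> (\<And>k. k < d \<Longrightarrow> mat_norm (y ! k - nc_dsum x x ! k) < e2) \<Longrightarrow> y \<in> U"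
    using free_base_euclid_nbhd[OF d U xx] n by (metis trans_le_add1)
  \<comment> \<open>With this c, a bound C for c ||g(y) - g(x)|| yields ||g(y) - g(x)|| <= e C / (C
    + 1) < e.\<close>
  define c where "c = (C + 1) / e"
  have c: "0 < c" using C0 e by (simp add: c_def)
  \<comment> \<open>For h = y - x the sheared point differs from x \<oplus> x by [h, c h; 0, 0], of
    norm at most (1 + c) ||h||. The factor 2 brings this strictly below \<open>e2\<close>.\<close>
  define \<eta> where "\<eta> = min e1 (e2 / (2 * (1 + c)))"
  show ?thesis
  proof (rule that[of \<eta>])
    show "0 < \<eta>" using e1 e2 c by (simp add: \<eta>_def)
    fix y assume y: "y \<in> Mn d n" "\<And>k. k < d \<Longrightarrow> mat_norm (y ! k - x ! k) < \<eta>"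
    have yU: "y \<in> U" by (rule e1(2)[OF y(1)]) (use y(2) in \<open>auto simp: \<eta>_def\<close>)
    define s where "s = four_block_mat (1\<^sub>m n) (complex_of_real c \<cdot>\<^sub>m 1\<^sub>m n) (0\<^sub>m n n) (1\<^sub>m n)"
    note S = shear_conj[of _ n _ "complex_of_real c", folded s_def]
    define z where "z = nc_conj s (nc_dsum y x)"
    have yx: "nc_dsum y x \<in> U" "nc_dsum y x \<in> Mn d (n + n)"
      using g(1) x yU nc_dsum_Mn[OF y(1) x(2)] by (auto simp: nc_set_def)
    have zk: "z ! k = four_block_mat (y ! k) (complex_of_real c \<cdot>\<^sub>m (y ! k - x ! k)) (0\<^sub>m n n) (x ! k)" if k: "k < d" for k
    proof -
      have "z ! k = mat_inv s * (nc_dsum y x ! k) * s"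
        using yx(2) k by (simp add: z_def nc_conj_def Mn_def)
      then show ?thesis
        by (simp add: nc_dsum_nth[OF y(1) x(2) k] S(3)[OF MnD[OF y(1) k] MnD[OF x(2) k]])
    qed
    have zM: "z \<in> Mn d (n + n)"
    proof (rule MnI)
      show "length z = d" using yx(2) by (simp add: z_def nc_conj_def Mn_def)
      show "z ! k \<in> carrier_mat (n + n) (n + n)" if "k < d" for k
        unfolding zk[OF that] using MnD[OF y(1) that] MnD[OF x(2) that] by simp
    qed
    have "z \<in> U"
    proof (rule e2(2)[OF zM])
      fix k assume k: "k < d"
      let ?h = "y ! k - x ! k"
      have h: "?h \<in> carrier_mat n n" using MnD[OF y(1) k] MnD[OF x(2) k] by auto
      have "z ! k - nc_dsum x x ! k = dsum_mat ?h (0\<^sub>m n n)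
          + four_block_mat (0\<^sub>m n n) (complex_of_real c \<cdot>\<^sub>m ?h) (0\<^sub>m n n) (0\<^sub>m n n)"
        unfolding zk[OF k] nc_dsum_nth[OF x(2) x(2) k] dsum_mat_def
        using MnD[OF y(1) k] MnD[OF x(2) k] by (intro eq_matI) auto
      also have "mat_norm \<dots> \<le> mat_norm (dsum_mat ?h (0\<^sub>m n n))
          + mat_norm (four_block_mat (0\<^sub>m n n) (complex_of_real c \<cdot>\<^sub>m ?h) (0\<^sub>m n n) (0\<^sub>m n n))"
        by (rule mat_norm_add_le[of _ "n + n" "n + n"]) (use h in auto)
      also have "\<dots> \<le> mat_norm ?h + mat_norm (complex_of_real c \<cdot>\<^sub>m ?h)"
      proof (rule add_mono)
        show "mat_norm (dsum_mat ?h (0\<^sub>m n n)) \<le> mat_norm ?h"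
          by (rule mat_norm_dsum_le[OF h zero_carrier_mat]) auto
        show "mat_norm (four_block_mat (0\<^sub>m n n) (complex_of_real c \<cdot>\<^sub>m ?h) (0\<^sub>m n n) (0\<^sub>m n n))
            \<le> mat_norm (complex_of_real c \<cdot>\<^sub>m ?h)"
          by (rule mat_norm_upper_corner_le) (use h in simp)
      qed
      also have "\<dots> = (1 + c) * mat_norm ?h" using c by (simp add: mat_norm_smult algebra_simps)
      also have "\<dots> \<le> (1 + c) * (e2 / (2 * (1 + c)))"
        using y(2)[OF k] c by (intro mult_left_mono) (auto simp: \<eta>_def)
      also have "\<dots> = e2 / 2" using c by (simp add: field_simps)
      also have "\<dots> < e2" using e2(1) by simp
      finally show "mat_norm (z ! k - nc_dsum x x ! k) < e2" .
    qed
    then have zU: "nc_conj s (nc_dsum y x) \<in> U" by (simp add: z_def)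
    have gy: "g y \<in> carrier_mat n n" and gx: "g x \<in> carrier_mat n n"
      using g(2)[OF n] x y(1) yU by auto
    have "g z = mat_inv s * g (nc_dsum y x) * s"
      unfolding z_def by (rule g(4)[OF _ yx S(1)[OF gy gx] S(2)[OF gy gx] zU]) (use n in simp)
    also have "\<dots> = four_block_mat (g y) (complex_of_real c \<cdot>\<^sub>m (g y - g x)) (0\<^sub>m n n) (g x)"
      by (simp only: g(3)[OF yU x(1)] S(3)[OF gy gx])
    finally have gz: "g z = four_block_mat (g y) (complex_of_real c \<cdot>\<^sub>m (g y - g x)) (0\<^sub>m n n) (g x)" .
    have "complex_of_real c \<cdot>\<^sub>m (g y - g x) \<in> carrier_mat n n" using gx gy by auto
    then have "mat_norm (complex_of_real c \<cdot>\<^sub>m (g y - g x)) \<le> mat_norm (g z)"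
      unfolding gz using gx gy by (intro mat_norm_four_block_corner_le) auto
    also have "\<dots> \<le> C" by (rule C[OF \<open>z \<in> U\<close>])
    finally have "c * mat_norm (g y - g x) \<le> C" using c by (simp add: mat_norm_smult)
    then have "(C + 1) * mat_norm (g y - g x) \<le> C * e" using e by (simp add: c_def field_simps)
    also have "\<dots> < (C + 1) * e" using e by simp
    finally have "mat_norm (g y - g x) < e" using C0 by simp
    then show "y \<in> U \<and> mat_norm (g y - g x) < e" using yU by simp
  qed
qed

section \<open>The Zariski-free topology\<close>

text \<open>Unlike the members of \<^const>\<open>zariski_free_base\<close>, these sets are nc-sets.\<close>

definition zbasic :: "nat \<Rightarrow> ncpoint set \<Rightarrow> bool" where
  "zbasic d N \<longleftrightarrow> (\<exists>B G. B \<in> free_base d \<and> finite G \<and>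
     (\<forall>g\<in>G. nc_function d B g \<and> (\<exists>C. \<forall>y\<in>B. mat_norm (g y) \<le> C)) \<and>
     N = {y \<in> B. \<forall>g\<in>G. g y \<noteq> 0\<^sub>m (nc_size y) (nc_size y)})"

lemma zbasicE:
  assumes "zbasic d N"
  obtains B G where "B \<in> free_base d" "finite G" "\<And>g. g \<in> G \<Longrightarrow> nc_function d B g"
    "\<And>g. g \<in> G \<Longrightarrow> \<exists>C. \<forall>y\<in>B. mat_norm (g y) \<le> C"
    "N = {y \<in> B. \<forall>g\<in>G. g y \<noteq> 0\<^sub>m (nc_size y) (nc_size y)}"
  using assms unfolding zbasic_def by blast

text \<open>Each g cuts out a variety of its own; nonvanishing of all g then is the complement of a
  finite union of varieties.\<close>

lemma zbasic_in_zariski_base: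
  assumes d: "0 < d" and N: "zbasic d N"
  shows "N \<in> zariski_free_base d"
proof -
  obtain B G where B: "B \<in> free_base d" and G: "finite G" "\<And>g. g \<in> G \<Longrightarrow> nc_function d B g"
    "\<And>g. g \<in> G \<Longrightarrow> \<exists>C. \<forall>y\<in>B. mat_norm (g y) \<le> C"
    and N: "N = {y \<in> B. \<forall>g\<in>G. g y \<noteq> 0\<^sub>m (nc_size y) (nc_size y)}"
    using N by (rule zbasicE) (rule that)
  define T where "T g = {y \<in> B. \<forall>h\<in>{g}. h y = 0\<^sub>m (nc_size y) (nc_size y)}" for g :: "ncpoint \<Rightarrow> complex mat"
  have fB: "free_domain d B" by (rule free_base_free_domain[OF d B])
  have "freely_holomorphic d B g" if "g \<in> G" for g
    using G(2,3)[OF that] fB unfolding freely_holomorphic_def nc_function_def by blast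
  then have "free_variety d B (T g)" if "g \<in> G" for g
    unfolding free_variety_def T_def using that by (intro exI[of _ "{g}"]) auto
  then have "B - \<Union>(T ` G) \<in> zariski_free_base d"
    unfolding zariski_free_base_def using fB G(1)
    by (intro CollectI exI[of _ B] exI[of _ "T ` G"]) auto
  moreover have "N = B - \<Union>(T ` G)" by (auto simp: N T_def)
  ultimately show ?thesis by simp
qed

lemma zbasic_Int:
  assumes d: "0 < d" and "zbasic d N" "zbasic d N'"
  shows "zbasic d (N \<inter> N')"
proof -
  obtain B G where B: "B \<in> free_base d" and G: "finite G" "\<And>g. g \<in> G \<Longrightarrow> nc_function d B g"
    "\<And>g. g \<in> G \<Longrightarrow> \<exists>C. \<forall>y\<in>B. mat_norm (g y) \<le> C"
    and N: "N = {y \<in> B. \<forall>g\<in>G. g y \<noteq> 0\<^sub>m (nc_size y) (nc_size y)}"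
    using assms(2) by (rule zbasicE) (rule that)
  obtain B' G' where B': "B' \<in> free_base d" and G': "finite G'" "\<And>g. g \<in> G' \<Longrightarrow> nc_function d B' g"
    "\<And>g. g \<in> G' \<Longrightarrow> \<exists>C. \<forall>y\<in>B'. mat_norm (g y) \<le> C"
    and N': "N' = {y \<in> B'. \<forall>g\<in>G'. g y \<noteq> 0\<^sub>m (nc_size y) (nc_size y)}"
    using assms(3) by (rule zbasicE) (rule that)
  have BB: "B \<inter> B' \<in> free_base d" by (rule free_base_Int[OF d B B'])
  then have nc: "nc_set d (B \<inter> B')" by (rule free_base_nc_set[OF d])
  have "nc_function d (B \<inter> B') g" if "g \<in> G \<union> G'" for g
    using that G(2)[of g] G'(2)[of g] nc_function_subset[OF _ nc] by auto
  moreover have "\<exists>C. \<forall>y\<in>B \<inter> B'. mat_norm (g y) \<le> C" if "g \<in> G \<union> G'" for g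
    using that G(3)[of g] G'(3)[of g] by auto
  ultimately show ?thesis
    unfolding zbasic_def using BB G(1) G'(1)
    by (intro exI[of _ "B \<inter> B'"] exI[of _ "G \<union> G'"]) (auto simp: N N')
qed

lemma freely_holomorphic_nbhd:
  assumes d: "0 < d" and g: "freely_holomorphic d D g" and x: "x \<in> D"
  obtains B where "B \<in> free_base d" "x \<in> B" "B \<subseteq> D" "nc_function d B g" "\<exists>C. \<forall>y\<in>B. mat_norm (g y) \<le> C"
proof -
  obtain U V where U: "free_domain d U" "x \<in> U" "U \<subseteq> D" "nc_function d U g"
    and V: "free_domain d V" "x \<in> V" "\<exists>C. \<forall>y\<in>V. mat_norm (g y) \<le> C"
    using g x unfolding freely_holomorphic_def by blast
  obtain B where B: "B \<in> free_base d" "x \<in> B" "B \<subseteq> U \<inter> V"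
    using free_domain_Int[OF U(1) V(1)] U(2) V(2) unfolding free_domain_iff[OF d] by blast
  show ?thesis
  proof (rule that[OF B(1,2)])
    show "B \<subseteq> D" using B U by blast
    show "nc_function d B g" using nc_function_subset[OF U(4) free_base_nc_set[OF d B(1)]] B by blast
    show "\<exists>C. \<forall>y\<in>B. mat_norm (g y) \<le> C" using V(3) B(3) by (meson IntD2 subsetD)
  qed
qed

text \<open>A variety may be the common zero set of infinitely many functions, but to avoid it near
  x one g with g(x) \<noteq> 0 is enough. This g is restricted to a free ball where it is a bounded
  nc-function.\<close>

lemma zariski_base_nbhd:
  assumes d: "0 < d" and Z: "Z \<in> zariski_free_base d" and x: "x \<in> Z"
  shows "\<exists>N. zbasic d N \<and> x \<in> N \<and> N \<subseteq> Z"
proof -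
  obtain D \<V> where Z: "Z = D - \<Union>\<V>" and D: "free_domain d D" and \<V>: "finite \<V>" "\<And>T. T \<in> \<V> \<Longrightarrow> free_variety d D T"
    using Z unfolding zariski_free_base_def by blast
  have "\<exists>N. zbasic d N \<and> x \<in> N \<and> N \<subseteq> D - \<Union>\<V>"
    using \<V> x[unfolded Z]
  proof (induction \<V> rule: finite_induct)
    case empty
    then obtain B where B: "B \<in> free_base d" "x \<in> B" "B \<subseteq> D"
      using D unfolding free_domain_iff[OF d] by blast
    then have "zbasic d B" unfolding zbasic_def by (intro exI[of _ B] exI[of _ "{}"]) auto
    then show ?case using B by blast
  next
    case (insert T \<V>)
    obtain N where N: "zbasic d N" "x \<in> N" "N \<subseteq> D - \<Union>\<V>" using insert by auto
    obtain E where E: "\<And>g. g \<in> E \<Longrightarrow> freely_holomorphic d D g"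
      "T = {x \<in> D. \<forall>g\<in>E. g x = 0\<^sub>m (nc_size x) (nc_size x)}"
      using insert.prems(1)[of T] unfolding free_variety_def by blast
    obtain g where g: "g \<in> E" "g x \<noteq> 0\<^sub>m (nc_size x) (nc_size x)" using insert.prems E by auto
    obtain B where B: "B \<in> free_base d" "x \<in> B" "B \<subseteq> D" "nc_function d B g" "\<exists>C. \<forall>y\<in>B. mat_norm (g y) \<le> C"
      using freely_holomorphic_nbhd[OF d E(1)[OF g(1)], of x] insert.prems by auto
    let ?N = "{y \<in> B. \<forall>h\<in>{g}. h y \<noteq> 0\<^sub>m (nc_size y) (nc_size y)}"
    have "zbasic d ?N" unfolding zbasic_def using B by (intro exI[of _ B] exI[of _ "{g}"]) auto
    then have "zbasic d (N \<inter> ?N)" by (rule zbasic_Int[OF d N(1)])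
    moreover have "x \<in> N \<inter> ?N" using N B g by auto
    moreover have "N \<inter> ?N \<subseteq> D - \<Union>(insert T \<V>)" using N(3) E(2) g(1) by auto
    ultimately show ?case by blast
  qed
  then show ?thesis by (simp add: Z)
qed

lemma openin_zariski_iff:
  assumes d: "0 < d"
  shows "openin (zariski_free_topology d) W \<longleftrightarrow> (\<forall>x\<in>W. \<exists>N. zbasic d N \<and> x \<in> N \<and> N \<subseteq> W)"
proof -
  have "openin (zariski_free_topology d) W \<longleftrightarrow> (\<forall>x\<in>W. \<exists>U\<in>zariski_free_base d. x \<in> U \<and> U \<subseteq> W)"
    unfolding zariski_free_topology_def
  proof (rule openin_topology_with_base)
    fix U V x assume UV: "U \<in> zariski_free_base d" "V \<in> zariski_free_base d" "x \<in> U" "x \<in> V"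
    obtain N N' where "zbasic d N" "x \<in> N" "N \<subseteq> U" "zbasic d N'" "x \<in> N'" "N' \<subseteq> V"
      using zariski_base_nbhd[OF d UV(1,3)] zariski_base_nbhd[OF d UV(2,4)] by blast
    then show "\<exists>W\<in>zariski_free_base d. x \<in> W \<and> W \<subseteq> U \<inter> V"
      using zbasic_in_zariski_base[OF d zbasic_Int[OF d]] by (intro bexI[of _ "N \<inter> N'"]) auto
  qed
  then show ?thesis
    using zariski_base_nbhd[OF d] zbasic_in_zariski_base[OF d] by (meson subset_trans)
qed

lemma openin_zariski_base: "0 < d \<Longrightarrow> Z \<in> zariski_free_base d \<Longrightarrow> openin (zariski_free_topology d) Z"
  using zariski_base_nbhd by (simp add: openin_zariski_iff)

lemma free_domain_openin_zariski: "0 < d \<Longrightarrow> free_domain d D \<Longrightarrow> openin (zariski_free_topology d) D"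
proof (rule openin_zariski_base)
  assume "free_domain d D"
  then show "D \<in> zariski_free_base d"
    unfolding zariski_free_base_def by (intro CollectI exI[of _ D] exI[of _ "{}"]) auto
qed

text \<open>g(x \<oplus> y) = g(x) \<oplus> g(y) can vanish only if both summands do, so
  nonvanishing of each g survives direct sums.\<close>

lemma zbasic_nc_set:
  assumes d: "0 < d" and N: "zbasic d N"
  shows "nc_set d N"
proof -
  obtain B G where B: "B \<in> free_base d" and G: "\<And>g. g \<in> G \<Longrightarrow> nc_function d B g"
    and N: "N = {y \<in> B. \<forall>g\<in>G. g y \<noteq> 0\<^sub>m (nc_size y) (nc_size y)}"
    using N by (rule zbasicE) (rule that)
  have nB: "nc_set d B" by (rule free_base_nc_set[OF d B])
  have "nc_dsum x y \<in> N" if xy: "x \<in> N" "y \<in> N" for x y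
  proof -
    have xyB: "x \<in> B" "y \<in> B" using xy by (auto simp: N)
    then have M: "x \<in> Md d" "y \<in> Md d" using free_base_subset[OF B] by auto
    have "g (nc_dsum x y) \<noteq> 0\<^sub>m (nc_size (nc_dsum x y)) (nc_size (nc_dsum x y))" if g: "g \<in> G" for g
    proof
      note F = nc_functionD[OF G[OF g]]
      have c: "g x \<in> carrier_mat (nc_size x) (nc_size x)" "g y \<in> carrier_mat (nc_size y) (nc_size y)"
        using F(2) MdE[OF M(1) d] MdE[OF M(2) d] xyB by auto
      assume "g (nc_dsum x y) = 0\<^sub>m (nc_size (nc_dsum x y)) (nc_size (nc_dsum x y))"
      then have "dsum_mat (g x) (g y) = dsum_mat (0\<^sub>m (nc_size x) (nc_size x)) (0\<^sub>m (nc_size y) (nc_size y))"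
        by (simp add: F(3)[OF xyB] nc_size_dsum[OF M d] dsum_zero)
      then have "g x = 0\<^sub>m (nc_size x) (nc_size x)"
        using dsum_inject[OF c zero_carrier_mat zero_carrier_mat] by simp
      then show False using xy(1) g by (simp add: N)
    qed
    then show ?thesis using nB xyB by (auto simp: N nc_set_def)
  qed
  then show ?thesis using free_base_subset[OF B] by (auto simp: nc_set_def N)
qed

text \<open>By continuity g(y) stays within distance ||g(x)|| > 0 of g(x), hence away from 0;
  finiteness of G leaves a positive common radius.\<close>

lemma zbasic_euclid_open:
  assumes d: "0 < d" and N: "zbasic d N" and n: "1 \<le> n"
  shows "euclid_open d n (N \<inter> Mn d n)"
proof -
  obtain B G where B: "B \<in> free_base d" and G: "finite G" "\<And>g. g \<in> G \<Longrightarrow> nc_function d B g"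
    "\<And>g. g \<in> G \<Longrightarrow> \<exists>C. \<forall>y\<in>B. mat_norm (g y) \<le> C"
    and N: "N = {y \<in> B. \<forall>g\<in>G. g y \<noteq> 0\<^sub>m (nc_size y) (nc_size y)}"
    using N by (rule zbasicE) (rule that)
  have "\<exists>\<epsilon>>0. \<forall>y\<in>Mn d n. (\<forall>k<d. mat_norm (y ! k - x ! k) < \<epsilon>) \<longrightarrow> y \<in> N \<inter> Mn d n"
    if x: "x \<in> N" "x \<in> Mn d n" for x
  proof -
    have xB: "x \<in> B" using x by (simp add: N)
    obtain e0 where e0: "0 < e0" "\<And>y. y \<in> Mn d n \<Longrightarrow> (\<And>k. k < d \<Longrightarrow> mat_norm (y ! k - x ! k) < e0) \<Longrightarrow> y \<in> B"
      using free_base_euclid_nbhd[OF d B xB x(2) n] by blast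
    have "\<exists>e>0. \<forall>y\<in>Mn d n. (\<forall>k<d. mat_norm (y ! k - x ! k) < e) \<longrightarrow> g y \<noteq> 0\<^sub>m n n" if g: "g \<in> G" for g
    proof -
      obtain C where C: "\<And>y. y \<in> B \<Longrightarrow> mat_norm (g y) \<le> C" using G(3)[OF g] by blast
      have gx: "g x \<in> carrier_mat n n" by (rule nc_functionD(2)[OF G(2)[OF g] n xB x(2)])
      have gx0: "g x \<noteq> 0\<^sub>m n n" using x g by (auto simp: N nc_size_eq[OF x(2) d])
      have pos: "0 < mat_norm (g x)"
      proof (rule ccontr)
        assume "\<not> 0 < mat_norm (g x)"
        then have "mat_norm (g x) = 0" using mat_norm_nonneg[of "g x"] by linarith
        then have "g x $$ (i, j) = 0" if "i < n" "j < n" for i j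
          using index_mat_norm_le[of i "g x" j] gx that by simp
        then have "g x = 0\<^sub>m n n" using gx by (intro eq_matI) auto
        then show False using gx0 by simp
      qed
      obtain e where e: "0 < e" "\<And>y. y \<in> Mn d n \<Longrightarrow> (\<And>k. k < d \<Longrightarrow> mat_norm (y ! k - x ! k) < e) \<Longrightarrow>
          y \<in> B \<and> mat_norm (g y - g x) < mat_norm (g x)"
        using nc_function_continuous[OF d B G(2)[OF g] C xB x(2) n pos] by blast
      have "g y \<noteq> 0\<^sub>m n n" if y: "y \<in> Mn d n" "\<forall>k<d. mat_norm (y ! k - x ! k) < e" for y
      proof
        assume "g y = 0\<^sub>m n n"
        moreover have "mat_norm (0\<^sub>m n n - g x) = mat_norm (g x)"
        proof -
          have "0\<^sub>m n n - g x = (-1) \<cdot>\<^sub>m g x" using gx by (intro eq_matI) auto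
          then show ?thesis by (simp only: mat_norm_smult) simp
        qed
        ultimately show False using e(2)[OF y(1)] y(2) by simp
      qed
      then show ?thesis using e(1) by blast
    qed
    then obtain e where e: "\<And>g. g \<in> G \<Longrightarrow> 0 < e g" "\<And>g y. g \<in> G \<Longrightarrow> y \<in> Mn d n \<Longrightarrow>
        (\<forall>k<d. mat_norm (y ! k - x ! k) < e g) \<Longrightarrow> g y \<noteq> 0\<^sub>m n n"
      by metis
    \<comment> \<open>\<open>e0\<close> keeps y in B, and makes the minimum meaningful when G is
      empty.\<close>
    define \<epsilon> where "\<epsilon> = Min (insert e0 (e ` G))"
    have \<epsilon>: "0 < \<epsilon>" "\<epsilon> \<le> e0" "\<And>g. g \<in> G \<Longrightarrow> \<epsilon> \<le> e g"
      using G(1) e0(1) e(1) by (auto simp: \<epsilon>_def)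
    have "y \<in> N" if y: "y \<in> Mn d n" "\<forall>k<d. mat_norm (y ! k - x ! k) < \<epsilon>" for y
    proof -
      have "y \<in> B" using e0(2)[OF y(1)] y(2) \<epsilon>(2) by fastforce
      moreover have "g y \<noteq> 0\<^sub>m n n" if "g \<in> G" for g
        using e(2)[OF that y(1)] y(2) \<epsilon>(3)[OF that] by fastforce
      ultimately show ?thesis by (simp add: N nc_size_eq[OF y(1) d])
    qed
    then show ?thesis using \<epsilon>(1) by blast
  qed
  then show ?thesis unfolding euclid_open_def by blast
qed

lemma openin_zariski_subset:
  assumes d: "0 < d" and W: "openin (zariski_free_topology d) W"
  shows "W \<subseteq> Md d"
proof
  fix x assume "x \<in> W"
  then obtain N where N: "zbasic d N" "x \<in> N" using W unfolding openin_zariski_iff[OF d] by blast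
  then show "x \<in> Md d" using zbasic_nc_set[OF d N(1)] by (auto simp: nc_set_def)
qed

lemma openin_zariski_zbasic: "0 < d \<Longrightarrow> zbasic d N \<Longrightarrow> openin (zariski_free_topology d) N"
  unfolding openin_zariski_iff by blast

lemma topspace_zariski:
  assumes d: "0 < d"
  shows "topspace (zariski_free_topology d) = Md d"
proof
  show "topspace (zariski_free_topology d) \<subseteq> Md d" by (rule openin_zariski_subset[OF d openin_topspace])
  show "Md d \<subseteq> topspace (zariski_free_topology d)"
    by (intro openin_subset free_domain_openin_zariski free_base_free_domain Md_free_base d)
qed

lemma openin_zariski_Union:
  assumes d: "0 < d" and W: "openin (zariski_free_topology d) W"
  shows "\<exists>C. (\<forall>N\<in>C. zbasic d N) \<and> W = \<Union>C"
proof (intro exI conjI)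
  show "\<forall>N\<in>{N. zbasic d N \<and> N \<subseteq> W}. zbasic d N" by blast
  show "W = \<Union>{N. zbasic d N \<and> N \<subseteq> W}" using W unfolding openin_zariski_iff[OF d] by blast
qed

lemma nc_admissible_zariski:
  assumes d: "0 < d"
  shows "nc_admissible d (zariski_free_topology d)"
  unfolding nc_admissible_def
proof
  show "topspace (zariski_free_topology d) = Md d" by (rule topspace_zariski[OF d])
  have "\<forall>N\<in>Collect (zbasic d). openin (zariski_free_topology d) N \<and> nc_set d N \<and> (\<forall>n\<ge>1. euclid_open d n (N \<inter> Mn d n))"
    using openin_zariski_zbasic[OF d] zbasic_nc_set[OF d] zbasic_euclid_open[OF d] by simp
  moreover have "\<forall>W. openin (zariski_free_topology d) W \<longrightarrow> (\<exists>C\<subseteq>Collect (zbasic d). W = \<Union>C)"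
    using openin_zariski_Union[OF d] by blast
  ultimately show "\<exists>B. (\<forall>N\<in>B. openin (zariski_free_topology d) N \<and> nc_set d N \<and> (\<forall>n\<ge>1. euclid_open d n (N \<inter> Mn d n))) \<and>
    (\<forall>W. openin (zariski_free_topology d) W \<longrightarrow> (\<exists>C\<subseteq>B. W = \<Union>C))" by blast
qed

section \<open>The functional calculus on free domains\<close>

text \<open>The polynomial q is fixed before e, and only the neighbourhood shrinks with e. The two
  conditions on y, a norm bound and smallness of p(y), both define free balls.\<close>

lemma hol_calc_free_nbhd:
  assumes x: "x \<in> Md d" "k < d" and A: "open A" "spectrum (x ! k) \<subseteq> A" and f: "f holomorphic_on A"
  obtains q where "hol_calc f (x ! k) = peval q (x ! k)"
    "\<And>e. 0 < e \<Longrightarrow> \<exists>V\<in>free_base d. x \<in> V \<and>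
      (\<forall>y\<in>V. spectrum (y ! k) \<subseteq> A \<and> mat_norm (hol_calc f (y ! k) - peval q (y ! k)) < e)"
proof -
  have d: "0 < d" using x by simp
  note xk = Md_nth[OF x]
  obtain p q where pq: "peval p (x ! k) = 0\<^sub>m (nc_size x) (nc_size x)" "hol_calc f (x ! k) = peval q (x ! k)"
    "\<And>R e. e > 0 \<Longrightarrow> \<exists>d>0. \<forall>m y. y \<in> carrier_mat m m \<longrightarrow> mat_norm y \<le> R \<longrightarrow> mat_norm (peval p y) \<le> d \<longrightarrow>
       spectrum y \<subseteq> A \<and> mat_norm (hol_calc f y - peval q y) < e"
    by (rule hol_calc_approx[OF xk A f]) (rule that)
  show ?thesis
  proof (rule that[OF pq(2)])
    fix e :: real assume "0 < e"
    from pq(3)[OF this, of "mat_norm (x ! k) + 1"]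
    obtain b where b: "b > 0" "\<And>m y. y \<in> carrier_mat m m \<Longrightarrow> mat_norm y \<le> mat_norm (x ! k) + 1 \<Longrightarrow>
       mat_norm (peval p y) \<le> b \<Longrightarrow> spectrum y \<subseteq> A \<and> mat_norm (hol_calc f y - peval q y) < e" by blast
    let ?V1 = "{y \<in> Md d. mat_norm (y ! k) < mat_norm (x ! k) + 1}"
    let ?V2 = "{y \<in> Md d. mat_norm (peval p (y ! k)) < b}"
    have "0 < mat_norm (x ! k) + 1" by (rule add_nonneg_pos) auto
    then have V: "?V1 \<inter> ?V2 \<in> free_base d"
      using b(1) by (intro free_base_Int[OF d] polyfun_ball polyfun_peval polyfun_nth x(2))
    have xV: "x \<in> ?V1 \<inter> ?V2" using x b(1) by (simp add: pq(1))
    have yV: "spectrum (y ! k) \<subseteq> A \<and> mat_norm (hol_calc f (y ! k) - peval q (y ! k)) < e"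
      if y: "y \<in> ?V1 \<inter> ?V2" for y
      using y x(2) by (intro b(2)[of "y ! k" "nc_size y"] Md_nth) auto
    show "\<exists>V\<in>free_base d. x \<in> V \<and>
      (\<forall>y\<in>V. spectrum (y ! k) \<subseteq> A \<and> mat_norm (hol_calc f (y ! k) - peval q (y ! k)) < e)"
      by (rule bexI[OF _ V], rule conjI[OF xV], rule ballI, rule yV)
  qed
qed

definition spec_dom :: "nat \<Rightarrow> nat \<Rightarrow> complex set \<Rightarrow> ncpoint set" where
  "spec_dom d k A = {x \<in> Md d. spectrum (x ! k) \<subseteq> A}"

lemma free_domain_spec_dom:
  assumes k: "k < d" and A: "open A"
  shows "free_domain d (spec_dom d k A)"
proof -
  have d: "0 < d" using k by simp
  have "\<exists>V\<in>free_base d. x \<in> V \<and> V \<subseteq> spec_dom d k A" if x: "x \<in> spec_dom d k A" for x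
  proof -
    have x: "x \<in> Md d" "spectrum (x ! k) \<subseteq> A" using x by (auto simp: spec_dom_def)
    \<comment> \<open>The zero function is taken because only the control of the spectrum is
      wanted.\<close>
    obtain q where q: "\<And>e. 0 < e \<Longrightarrow> \<exists>V\<in>free_base d. x \<in> V \<and>
      (\<forall>y\<in>V. spectrum (y ! k) \<subseteq> A \<and> mat_norm (hol_calc (\<lambda>_. 0) (y ! k) - peval q (y ! k)) < e)"
      by (rule hol_calc_free_nbhd[OF x(1) k A x(2), of "\<lambda>_. 0"]) auto
    obtain V where V: "V \<in> free_base d" "x \<in> V"
      "\<forall>y\<in>V. spectrum (y ! k) \<subseteq> A \<and> mat_norm (hol_calc (\<lambda>_. 0) (y ! k) - peval q (y ! k)) < 1"
      using q[of 1, OF less_numeral_extra(1)] by (elim bexE conjE) (rule that)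
    have "V \<subseteq> spec_dom d k A" using V(3) free_base_subset[OF V(1)] by (auto simp: spec_dom_def)
    then show ?thesis using V(1,2) by (intro bexI[of _ V] conjI)
  qed
  then show ?thesis by (simp add: free_domain_iff[OF d])
qed

lemma nc_set_spec_dom:
  assumes k: "k < d"
  shows "nc_set d (spec_dom d k A)"
proof -
  have d: "0 < d" using k by simp
  have "nc_dsum x y \<in> spec_dom d k A" if xy: "x \<in> spec_dom d k A" "y \<in> spec_dom d k A" for x y
  proof -
    have M: "x \<in> Md d" "y \<in> Md d" using xy by (auto simp: spec_dom_def)
    show ?thesis
      using xy nc_dsum_Md[OF M] nc_dsum_nth[OF MdE(1)[OF M(1) d] MdE(1)[OF M(2) d] k]
        spectrum_dsum[OF Md_nth[OF M(1) k] Md_nth[OF M(2) k]]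
      by (simp add: spec_dom_def)
  qed
  then show ?thesis by (auto simp: nc_set_def spec_dom_def)
qed

lemma hol_calc_locally_bounded:
  assumes k: "k < d" and x: "x \<in> spec_dom d k A" and A: "open A" and f: "f holomorphic_on A"
  obtains V C where "V \<in> free_base d" "x \<in> V" "V \<subseteq> spec_dom d k A" "\<And>y. y \<in> V \<Longrightarrow> mat_norm (hol_calc f (y ! k)) \<le> C"
proof -
  have d: "0 < d" using k by simp
  have x: "x \<in> Md d" "spectrum (x ! k) \<subseteq> A" using x by (auto simp: spec_dom_def)
  obtain q where q: "\<And>e. 0 < e \<Longrightarrow> \<exists>V\<in>free_base d. x \<in> V \<and>
      (\<forall>y\<in>V. spectrum (y ! k) \<subseteq> A \<and> mat_norm (hol_calc f (y ! k) - peval q (y ! k)) < e)"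
    by (rule hol_calc_free_nbhd[OF x(1) k A x(2) f]) (rule that)
  obtain V where V0: "V \<in> free_base d" "x \<in> V"
    "\<forall>y\<in>V. spectrum (y ! k) \<subseteq> A \<and> mat_norm (hol_calc f (y ! k) - peval q (y ! k)) < 1"
    using q[of 1, OF less_numeral_extra(1)] by (elim bexE conjE) (rule that)
  then have V: "V \<in> free_base d" "x \<in> V"
    "\<And>y. y \<in> V \<Longrightarrow> spectrum (y ! k) \<subseteq> A" "\<And>y. y \<in> V \<Longrightarrow> mat_norm (hol_calc f (y ! k) - peval q (y ! k)) < 1" by simp_all
  let ?c = "mat_norm (peval q (x ! k)) + 1"
  let ?W = "{y \<in> Md d. mat_norm (peval q (y ! k)) < ?c}"
  have "0 < ?c" by (rule add_nonneg_pos) auto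
  then have W: "?W \<in> free_base d" by (intro polyfun_ball polyfun_peval polyfun_nth k)
  show ?thesis
  proof (rule that)
    show "V \<inter> ?W \<in> free_base d" by (rule free_base_Int[OF d V(1) W])
    show "x \<in> V \<inter> ?W" using V x by simp
    show "V \<inter> ?W \<subseteq> spec_dom d k A" using V(3) by (auto simp: spec_dom_def)
    fix y assume y: "y \<in> V \<inter> ?W"
    then have "y ! k \<in> carrier_mat (nc_size y) (nc_size y)" using Md_nth k by auto
    from mat_norm_triangle_sub[OF hol_calc_carrier[OF this] peval_carrier[OF this]]
    have "mat_norm (hol_calc f (y ! k)) \<le> mat_norm (peval q (y ! k)) + mat_norm (hol_calc f (y ! k) - peval q (y ! k))" .
    then show "mat_norm (hol_calc f (y ! k)) \<le> ?c + 1" using y V(4)[of y] by auto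
  qed
qed

section \<open>Commutators with the functional calculus, and continuity of sum and
  difference\<close>

lemma conj_diff:
  fixes P Q :: "complex mat"
  assumes c: "P \<in> carrier_mat n n" "Q \<in> carrier_mat n n" "B \<in> carrier_mat n n" "C \<in> carrier_mat n n"
  shows "P * B * Q - P * C * Q = P * (B - C) * Q"
  using minus_mult_distrib_mat[OF mult_carrier_mat[OF c(1,3)] mult_carrier_mat[OF c(1,4)] c(2)]
  by (simp add: mult_minus_distrib_mat[OF c(1,3,4)])

text \<open>For f = \<open>iota r \<gamma> \<tau>\<close> its nonvanishing is the condition that
  defines \<open>U_set\<close>. As a commutator this is a freely holomorphic function, whose zero
  set is a variety.\<close>

definition comm_fun :: "(complex \<Rightarrow> complex) \<Rightarrow> ncpoint \<Rightarrow> complex mat" where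
  "comm_fun f x = x ! 0 * hol_calc f (x ! 1) - hol_calc f (x ! 1) * x ! 0"

lemma nc_conj_nth: "x \<in> Mn d n \<Longrightarrow> k < d \<Longrightarrow> nc_conj s x ! k = mat_inv s * x ! k * s"
  by (simp add: nc_conj_def Mn_def)

lemma nc_function_comm_fun:
  assumes A: "open A" and f: "f holomorphic_on A"
  shows "nc_function 2 (spec_dom 2 1 A) (comm_fun f)"
  unfolding nc_function_def graded_on_def
proof (intro conjI ballI allI impI)
  show "nc_set 2 (spec_dom 2 1 A)" by (rule nc_set_spec_dom) simp
next
  fix n x assume "x \<in> spec_dom 2 1 A \<inter> Mn 2 n"
  then have "x ! 0 \<in> carrier_mat n n" "hol_calc f (x ! 1) \<in> carrier_mat n n"
    using MnD[of x 2 n 0] MnD[of x 2 n 1] by auto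
  then show "comm_fun f x \<in> carrier_mat n n"
    unfolding comm_fun_def by (intro minus_carrier_mat mult_carrier_mat)
next
  fix x y assume xy: "x \<in> spec_dom 2 1 A" "y \<in> spec_dom 2 1 A"
  then have M: "x \<in> Md 2" "y \<in> Md 2" and s: "spectrum (x ! 1) \<subseteq> A" "spectrum (y ! 1) \<subseteq> A"
    by (auto simp: spec_dom_def)
  have x0: "x ! 0 \<in> carrier_mat (nc_size x) (nc_size x)" "x ! 1 \<in> carrier_mat (nc_size x) (nc_size x)"
    and y0: "y ! 0 \<in> carrier_mat (nc_size y) (nc_size y)" "y ! 1 \<in> carrier_mat (nc_size y) (nc_size y)"
    using Md_nth M by auto
  have k: "nc_dsum x y ! k = dsum_mat (x ! k) (y ! k)" if "k < 2" for k
    using nc_dsum_nth[OF MdE(1)[OF M(1)] MdE(1)[OF M(2)] that] by simp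
  note hx = hol_calc_carrier[OF x0(2), of f] and hy = hol_calc_carrier[OF y0(2), of f]
  have h: "hol_calc f (nc_dsum x y ! 1) = dsum_mat (hol_calc f (x ! 1)) (hol_calc f (y ! 1))"
    using hol_calc_dsum[OF x0(2) y0(2) A s f] k[of 1] by simp
  show "comm_fun f (nc_dsum x y) = dsum_mat (comm_fun f x) (comm_fun f y)"
    unfolding comm_fun_def h k[OF zero_less_numeral]
    by (simp add: dsum_mult[OF x0(1) y0(1) hx hy] dsum_mult[OF hx hy x0(1) y0(1)]
        dsum_diff[OF mult_carrier_mat[OF x0(1) hx] mult_carrier_mat[OF y0(1) hy] mult_carrier_mat[OF hx x0(1)] mult_carrier_mat[OF hy y0(1)]] del: One_nat_def)
next
  fix n x s assume n: "(1::nat) \<le> n" and x: "x \<in> spec_dom 2 1 A \<inter> Mn 2 n" and s: "s \<in> carrier_mat n n"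
    and i: "invertible_mat s \<and> nc_conj s x \<in> spec_dom 2 1 A"
  have xM: "x \<in> Mn 2 n" and sp: "spectrum (x ! 1) \<subseteq> A" using x by (auto simp: spec_dom_def)
  have c: "x ! 0 \<in> carrier_mat n n" "x ! 1 \<in> carrier_mat n n" using MnD[OF xM] by auto
  note P = mat_inv_invertible[OF s, OF conjunct1[OF i]]
  note h = hol_calc_carrier[OF c(2), of f]
  have H: "hol_calc f (mat_inv s * x ! 1 * s) = mat_inv s * hol_calc f (x ! 1) * s"
    by (rule hol_calc_similar[OF c(2) P(1) s P(2,3) A sp f])
  have k: "nc_conj s x ! 0 = mat_inv s * x ! 0 * s" "nc_conj s x ! 1 = mat_inv s * x ! 1 * s"
    by (rule nc_conj_nth[OF xM], simp)+
  show "comm_fun f (nc_conj s x) = mat_inv s * comm_fun f x * s"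
    unfolding comm_fun_def k H
      conj_mult[OF P(1) s c(1) h P(2)] conj_mult[OF P(1) s h c(1) P(2)]
      conj_diff[OF P(1) s mult_carrier_mat[OF c(1) h] mult_carrier_mat[OF h c(1)]] ..
qed

lemma freely_holomorphic_comm_fun:
  assumes A: "open A" and f: "f holomorphic_on A"
  shows "freely_holomorphic 2 (spec_dom 2 1 A) (comm_fun f)"
proof -
  let ?D = "spec_dom 2 1 A"
  have D: "free_domain 2 ?D" by (rule free_domain_spec_dom[OF _ A]) simp
  have nc: "nc_function 2 ?D (comm_fun f)" by (rule nc_function_comm_fun[OF A f])
  have "\<exists>V. free_domain 2 V \<and> x \<in> V \<and> V \<subseteq> ?D \<and> (\<exists>C. \<forall>y\<in>V. mat_norm (comm_fun f y) \<le> C)"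
    if x: "x \<in> ?D" for x
  proof -
    obtain V C where V: "V \<in> free_base 2" "x \<in> V" "V \<subseteq> ?D" "\<And>y. y \<in> V \<Longrightarrow> mat_norm (hol_calc f (y ! 1)) \<le> C"
      by (rule hol_calc_locally_bounded[OF _ x A f]) (simp, rule that)
    let ?c = "mat_norm (x ! 0) + 1"
    let ?W = "{y \<in> Md 2. mat_norm (y ! 0) < ?c}"
    have "0 < ?c" by (rule add_nonneg_pos) auto
    then have W: "?W \<in> free_base 2" by (intro polyfun_ball polyfun_nth) auto
    have "free_domain 2 (V \<inter> ?W)"
      by (intro free_base_free_domain free_base_Int V(1) W) auto
    moreover have "x \<in> V \<inter> ?W" using V free_base_subset[OF V(1)] by auto
    moreover have "mat_norm (comm_fun f y) \<le> 2 * (?c * C)" if y: "y \<in> V \<inter> ?W" for y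
    proof -
      let ?h = "hol_calc f (y ! 1)"
      have c: "y ! 0 \<in> carrier_mat (nc_size y) (nc_size y)" "y ! 1 \<in> carrier_mat (nc_size y) (nc_size y)"
        using y Md_nth by auto
      note h = hol_calc_carrier[OF c(2), of f]
      have b: "mat_norm (y ! 0) \<le> ?c" "mat_norm ?h \<le> C" using y V(4) by auto
      then have p: "mat_norm (y ! 0) * mat_norm ?h \<le> ?c * C" by (intro mult_mono) auto
      have "mat_norm (comm_fun f y) \<le> mat_norm (y ! 0 * ?h) + mat_norm (?h * y ! 0)"
        unfolding comm_fun_def by (rule mat_norm_diff_le[OF mult_carrier_mat[OF c(1) h] mult_carrier_mat[OF h c(1)]])
      also have "\<dots> \<le> ?c * C + ?c * C"
        using mat_norm_mult_le[OF c(1) h] mat_norm_mult_le[OF h c(1)] p by (simp add: mult.commute)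
      finally show ?thesis by (simp only: mult_2)
    qed
    ultimately show ?thesis using V(3) by blast
  qed
  then show ?thesis using D nc unfolding freely_holomorphic_def nc_function_def by blast
qed

text \<open>This is the free continuity of \<open>omega\<close>. The map W defined by f is compared
  with the polynomial map F that has the same value at x. Half of the slack 1 - t is spent on moving
  F away from x, the other half on passing from F to W.\<close>

lemma free_domain_add_diff:
  assumes A: "open A" and f: "f holomorphic_on A" and S: "free_domain 2 S"
  shows "free_domain 2 {x \<in> spec_dom 2 1 A. [x ! 0 + hol_calc f (x ! 1), x ! 0 - hol_calc f (x ! 1)] \<in> S}"
    (is "free_domain 2 ?T")
proof -
  have d: "0 < (2::nat)" by simp
  have "\<exists>V\<in>free_base 2. x \<in> V \<and> V \<subseteq> ?T" if x: "x \<in> ?T" for x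
  proof -
    have xM: "x \<in> Md 2" and xs: "spectrum (x ! 1) \<subseteq> A" using x by (auto simp: spec_dom_def)
    obtain q where q: "hol_calc f (x ! 1) = peval q (x ! 1)" "\<And>e. 0 < e \<Longrightarrow> \<exists>V\<in>free_base 2. x \<in> V \<and>
      (\<forall>y\<in>V. spectrum (y ! 1) \<subseteq> A \<and> mat_norm (hol_calc f (y ! 1) - peval q (y ! 1)) < e)"
      by (rule hol_calc_free_nbhd[OF xM _ A xs f]) (simp, rule that)
    define F where "F = (\<lambda>y::ncpoint. [y ! 0 + peval q (y ! 1), y ! 0 - peval q (y ! 1)])"
    define W where "W = (\<lambda>y::ncpoint. [y ! 0 + hol_calc f (y ! 1), y ! 0 - hol_calc f (y ! 1)])"
    have FW: "F x = W x" by (simp only: F_def W_def q(1))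
    obtain B where B: "B \<in> free_base 2" "W x \<in> B" "B \<subseteq> S"
      using S x unfolding free_domain_iff[OF d] W_def by blast
    obtain \<delta> where \<delta>: "B = free_ball 2 \<delta>" "\<And>I J. I < dim_row \<delta> \<Longrightarrow> J < dim_col \<delta> \<Longrightarrow> \<delta> $$ (I, J) \<in> free_polys 2"
      using B(1) by (rule free_baseE) (rule that)
    define t where "t = mat_norm (poly_mat_at \<delta> (F x))"
    have t: "t < 1" "0 \<le> t" using B(2) by (auto simp: t_def FW \<delta>(1) free_ball_def)
    define a where "a = mat_norm (x ! 0) + 1"
    define b where "b = mat_norm (peval q (x ! 1)) + 1"
    have ab: "0 < a" "0 < b" by (auto simp: a_def b_def intro!: add_nonneg_pos)
    \<comment> \<open>a + b bounds the components of F; the additional 1 covers those of W, as f(y)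
      is within e <= 1 of q(y).\<close>
    define R where "R = a + b + 1"
    obtain K where K: "0 \<le> K" "\<And>n x y e. x \<in> Mn 2 n \<Longrightarrow> y \<in> Mn 2 n \<Longrightarrow> 1 \<le> n \<Longrightarrow> 0 \<le> e \<Longrightarrow>
      (\<And>k. k < 2 \<Longrightarrow> mat_norm (x ! k) \<le> R) \<Longrightarrow> (\<And>k. k < 2 \<Longrightarrow> mat_norm (y ! k) \<le> R) \<Longrightarrow>
      (\<And>k. k < 2 \<Longrightarrow> mat_norm (x ! k - y ! k) \<le> e) \<Longrightarrow> mat_norm (poly_mat_at \<delta> x - poly_mat_at \<delta> y) \<le> K * e"
      using poly_mat_lipschitz[OF d \<delta>(2), where R = R] by blast
    \<comment> \<open>This makes K e less than half the slack; the ball \<open>?V3\<close> uses up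
      the other half.\<close>
    define e where "e = min 1 ((1 - t) / (2 * (K + 1)))"
    have e: "0 < e" "e \<le> 1" "K * e < (1 - t) / 2"
    proof -
      show "0 < e" "e \<le> 1" using t K(1) by (auto simp: e_def)
      have "K * e \<le> K * ((1 - t) / (2 * (K + 1)))" using K(1) by (intro mult_left_mono) (auto simp: e_def)
      also have "\<dots> = (1 - t) / 2 * (K / (K + 1))" by simp
      also have "\<dots> < (1 - t) / 2 * 1" using t K(1) by (intro mult_strict_left_mono) auto
      finally show "K * e < (1 - t) / 2" by simp
    qed
    obtain V where V0: "V \<in> free_base 2" "x \<in> V"
      "\<forall>y\<in>V. spectrum (y ! 1) \<subseteq> A \<and> mat_norm (hol_calc f (y ! 1) - peval q (y ! 1)) < e"
      using q(2)[OF e(1)] by (elim bexE conjE) (rule that)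
    then have V: "V \<in> free_base 2" "x \<in> V" "\<And>y. y \<in> V \<Longrightarrow> spectrum (y ! 1) \<subseteq> A"
      "\<And>y. y \<in> V \<Longrightarrow> mat_norm (hol_calc f (y ! 1) - peval q (y ! 1)) < e" by simp_all
    have cF: "y ! 0 \<in> carrier_mat (nc_size y) (nc_size y)" "y ! 1 \<in> carrier_mat (nc_size y) (nc_size y)"
      "F y \<in> Mn 2 (nc_size y)" "W y \<in> Mn 2 (nc_size y)" if "y \<in> Md 2" for y
    proof -
      show c: "y ! 0 \<in> carrier_mat (nc_size y) (nc_size y)" "y ! 1 \<in> carrier_mat (nc_size y) (nc_size y)"
        using Md_nth[OF that] by auto
      show "F y \<in> Mn 2 (nc_size y)" "W y \<in> Mn 2 (nc_size y)"
        unfolding F_def W_def Mn_def using c peval_carrier[OF c(2), of q] hol_calc_carrier[OF c(2), of f]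
        by (auto intro!: add_carrier_mat minus_carrier_mat)
    qed
    let ?V1 = "{y \<in> Md 2. mat_norm (y ! 0) < a}"
    let ?V2 = "{y \<in> Md 2. mat_norm (peval q (y ! 1)) < b}"
    let ?V3 = "{y \<in> Md 2. mat_norm (poly_mat_at \<delta> (F y)) < (1 + t) / 2}"
    have V1: "?V1 \<in> free_base 2" by (intro polyfun_ball polyfun_nth ab) simp
    have V2: "?V2 \<in> free_base 2" by (intro polyfun_ball polyfun_peval polyfun_nth ab) simp
    have V3: "?V3 \<in> free_base 2"
    proof -
      have pf: "polyfun 2 (\<lambda>y. poly_at (\<delta> $$ (I, J)) (F y))" if IJ: "I < dim_row \<delta>" "J < dim_col \<delta>" for I J
      proof (rule polyfun_comp[OF \<delta>(2)[OF IJ], of 2 F "\<lambda>k y. F y ! k"])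
        fix k :: nat assume "k < 2"
        then consider "k = 0" | "k = 1" by linarith
        then show "polyfun 2 (\<lambda>y. F y ! k)"
          by cases (auto simp: F_def intro!: polyfun_add polyfun_diff polyfun_peval polyfun_nth)
      qed (use nc_size_eq[OF cF(3) d] in auto)
      from polyfun_blk_ball[of "dim_row \<delta>" "dim_col \<delta>" 2 "\<lambda>I J y. poly_at (\<delta> $$ (I, J)) (F y)" "(1 + t) / 2", OF pf]
      have "{y \<in> Md 2. mat_norm (blk (dim_row \<delta>) (dim_col \<delta>) (nc_size y) (\<lambda>I J. poly_at (\<delta> $$ (I, J)) (F y))) < (1 + t) / 2} \<in> free_base 2"
        using t by simp
      moreover have "poly_mat_at \<delta> (F y) = blk (dim_row \<delta>) (dim_col \<delta>) (nc_size y) (\<lambda>I J. poly_at (\<delta> $$ (I, J)) (F y))"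
        if "y \<in> Md 2" for y
        by (simp add: poly_mat_at_blk nc_size_eq[OF cF(3)[OF that] d])
      ultimately show ?thesis by (simp cong: conj_cong)
    qed
    show ?thesis
    proof (intro bexI conjI subsetI)
      show "V \<inter> (?V1 \<inter> (?V2 \<inter> ?V3)) \<in> free_base 2"
        by (intro free_base_Int[OF d] V(1) V1 V2 V3)
      show "x \<in> V \<inter> (?V1 \<inter> (?V2 \<inter> ?V3))" using V(2) xM t by (simp add: a_def b_def t_def)
      fix y assume y: "y \<in> V \<inter> (?V1 \<inter> (?V2 \<inter> ?V3))"
      then have yM: "y \<in> Md 2" by simp
      let ?n = "nc_size y" and ?h = "hol_calc f (y ! 1)" and ?q = "peval q (y ! 1)"
      note c = cF[OF yM]
      note h = hol_calc_carrier[OF c(2), of f] and qc = peval_carrier[OF c(2), of q]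
      have n: "1 \<le> ?n" using MdE[OF yM d] by simp
      have hq: "mat_norm (?h - ?q) < e" using V(4) y by simp
      have nh: "mat_norm ?h \<le> b + 1"
        using mat_norm_triangle_sub[OF h qc] hq e(2) y by simp
      have W01: "W y ! 0 = y ! 0 + ?h" "W y ! 1 = y ! 0 - ?h" "F y ! 0 = y ! 0 + ?q" "F y ! 1 = y ! 0 - ?q"
        by (simp_all add: W_def F_def)
      have two: "P k" if "k < 2" "P 0" "P 1" for P and k :: nat
        using that by (metis One_nat_def less_2_cases)
      have "mat_norm (poly_mat_at \<delta> (W y) - poly_mat_at \<delta> (F y)) \<le> K * e"
      proof (rule K(2)[OF c(4,3) n])
        show "0 \<le> e" using e by simp
        show "mat_norm (W y ! k) \<le> R" if "k < 2" for k
          using that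
        proof (rule two)
          show "mat_norm (W y ! 0) \<le> R" "mat_norm (W y ! 1) \<le> R"
            using mat_norm_add_le[OF c(1) h] mat_norm_diff_le[OF c(1) h] nh y by (auto simp: W01 R_def simp del: One_nat_def)
        qed
        show "mat_norm (F y ! k) \<le> R" if "k < 2" for k
          using that
        proof (rule two)
          show "mat_norm (F y ! 0) \<le> R" "mat_norm (F y ! 1) \<le> R"
            using mat_norm_add_le[OF c(1) qc] mat_norm_diff_le[OF c(1) qc] y by (auto simp: W01 R_def simp del: One_nat_def)
        qed
        show "mat_norm (W y ! k - F y ! k) \<le> e" if "k < 2" for k
          using that
        proof (rule two)
          have "y ! 0 + ?h - (y ! 0 + ?q) = ?h - ?q" "y ! 0 - ?h - (y ! 0 - ?q) = ?q - ?h"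
            using c(1) h qc by (auto intro!: eq_matI simp: carrier_matD[OF h] carrier_matD[OF qc])
          then show "mat_norm (W y ! 0 - F y ! 0) \<le> e" "mat_norm (W y ! 1 - F y ! 1) \<le> e"
            using hq mat_norm_diff_commute[OF h qc] by (auto simp: W01 simp del: One_nat_def)
        qed
      qed
      moreover have "poly_mat_at \<delta> (W y) \<in> carrier_mat (dim_row \<delta> * ?n) (dim_col \<delta> * ?n)"
        "poly_mat_at \<delta> (F y) \<in> carrier_mat (dim_row \<delta> * ?n) (dim_col \<delta> * ?n)"
        by (simp_all add: poly_mat_at_blk nc_size_eq[OF c(3) d] nc_size_eq[OF c(4) d])
      note mat_norm_triangle_sub[OF this]
      moreover have "mat_norm (poly_mat_at \<delta> (F y)) < (1 + t) / 2" using y by simp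
      ultimately have "mat_norm (poly_mat_at \<delta> (W y)) < 1" using e(3) by argo
      then have "W y \<in> S" using B(3) Mn_Md[OF c(4) n] by (auto simp: \<delta>(1) free_ball_def)
      then show "y \<in> ?T" using V(3)[of y] y by (simp add: W_def spec_dom_def)
    qed
  qed
  then show ?thesis unfolding free_domain_iff[OF d] by blast
qed

section \<open>Charts and their overlaps\<close>

lemma discs_eq: "discs r \<gamma> = (\<Union>c\<in>\<gamma>. ball c (r \<gamma>))"
  by (auto simp: discs_def dist_norm norm_minus_commute)

lemma open_discs: "open (discs r \<gamma>)"
  by (auto simp: discs_eq)

text \<open>Centres are more than \<open>4 * r \<gamma>\<close> apart, so no point lies in two discs
  and the definite description in \<open>iota\<close> picks c.\<close>

lemma iota_eq:
  assumes r: "admissible_radii r" and \<gamma>: "\<gamma> \<in> Gam" and c: "c \<in> \<gamma>" "z \<in> ball c (r \<gamma>)"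
  shows "iota r \<gamma> \<tau> z = \<tau> c"
proof -
  have "(THE c. c \<in> \<gamma> \<and> cmod (z - c) < r \<gamma>) = c"
  proof (rule the_equality)
    show "c \<in> \<gamma> \<and> cmod (z - c) < r \<gamma>" using c by (simp add: dist_norm norm_minus_commute)
    fix d assume d: "d \<in> \<gamma> \<and> cmod (z - d) < r \<gamma>"
    have "dist c d \<le> dist c z + dist z d" by (rule dist_triangle)
    then have "cmod (c - d) < 2 * r \<gamma>" using c(2) d by (simp add: dist_norm)
    moreover have "0 < r \<gamma>" "c \<noteq> d \<Longrightarrow> r \<gamma> < 1/4 * cmod (c - d)"
      using r \<gamma> c d by (auto simp: admissible_radii_def)
    ultimately show "d = c" by (cases "c = d") auto
  qed
  then show ?thesis by (simp add: iota_def)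
qed

lemma iota_holomorphic:
  assumes r: "admissible_radii r" and \<gamma>: "\<gamma> \<in> Gam"
  shows "iota r \<gamma> \<tau> holomorphic_on discs r \<gamma>"
  unfolding discs_eq
proof (rule holomorphic_on_UN_open)
  fix c assume "c \<in> \<gamma>"
  then show "iota r \<gamma> \<tau> holomorphic_on ball c (r \<gamma>)"
    using holomorphic_on_const[of "\<tau> c" "ball c (r \<gamma>)"] iota_eq[OF r \<gamma>]
    by (subst holomorphic_cong[OF refl, of _ _ "\<lambda>_. \<tau> c"]) auto
qed simp

lemma discs_nonzero:
  assumes r: "admissible_radii r" and \<gamma>: "\<gamma> \<in> Gam"
  shows "0 \<notin> discs r \<gamma>"
  using r \<gamma> by (fastforce simp: discs_def admissible_radii_def)

text \<open>By multiplicativity of the calculus \<open>S_fun\<close> is the calculus of this one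
  scalar square root, so that questions about charts become questions about scalar
  functions.\<close>

definition branch :: "(complex set \<Rightarrow> real) \<Rightarrow> (complex set \<Rightarrow> complex \<Rightarrow> complex) \<Rightarrow> complex set \<Rightarrow>
    (complex \<Rightarrow> complex) \<Rightarrow> complex \<Rightarrow> complex" where
  "branch r s \<gamma> \<tau> z = s \<gamma> z * iota r \<gamma> \<tau> z"

lemma branch_holomorphic:
  assumes "admissible_radii r" "sqrt_branches r s" "\<gamma> \<in> Gam"
  shows "branch r s \<gamma> \<tau> holomorphic_on discs r \<gamma>"
proof -
  have "s \<gamma> holomorphic_on discs r \<gamma>" using assms by (simp add: sqrt_branches_def)
  then show ?thesis
    unfolding branch_def[abs_def] using iota_holomorphic[OF assms(1,3), of \<tau>] by (rule holomorphic_on_mult)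
qed

lemma branch_sq:
  assumes r: "admissible_radii r" and s: "sqrt_branches r s" and \<gamma>: "\<gamma> \<in> Gam" and \<tau>: "\<tau> \<in> signs \<gamma>" and z: "z \<in> discs r \<gamma>"
  shows "branch r s \<gamma> \<tau> z * branch r s \<gamma> \<tau> z = z"
proof -
  obtain c where c: "c \<in> \<gamma>" "z \<in> ball c (r \<gamma>)" using z by (auto simp: discs_eq)
  have "\<tau> c = 1 \<or> \<tau> c = -1" using \<tau> c by (auto simp: signs_def PiE_iff)
  moreover have "s \<gamma> z * s \<gamma> z = z"
    using s \<gamma> z by (simp add: sqrt_branches_def power2_eq_square)
  ultimately show ?thesis unfolding branch_def iota_eq[OF r \<gamma> c] by auto
qed

text \<open>Both functions are square roots of z on the common domain, and 0 lies in none of the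
  discs. These are the scalar facts used for every overlap.\<close>

lemma branch_pair:
  assumes r: "admissible_radii r" and s: "sqrt_branches r s" and \<gamma>: "\<gamma> \<in> Gam" "\<gamma>' \<in> Gam"
    and \<tau>: "\<tau> \<in> signs \<gamma>" "\<tau>' \<in> signs \<gamma>'"
  defines "A \<equiv> discs r \<gamma> \<inter> discs r \<gamma>'" and "f \<equiv> branch r s \<gamma> \<tau>" and "g \<equiv> branch r s \<gamma>' \<tau>'"
  shows "f holomorphic_on A" "g holomorphic_on A"
    "\<And>z. z \<in> A \<Longrightarrow> f z * f z = g z * g z" "\<And>z. z \<in> A \<Longrightarrow> f z \<noteq> 0"
proof -
  show "f holomorphic_on A" "g holomorphic_on A"
    using branch_holomorphic[OF r s \<gamma>(1)] branch_holomorphic[OF r s \<gamma>(2)]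
    by (auto simp: A_def f_def g_def intro: holomorphic_on_subset)
  fix z assume z: "z \<in> A"
  have f2: "f z * f z = z" and g2: "g z * g z = z"
    using z branch_sq[OF r s \<gamma>(1) \<tau>(1)] branch_sq[OF r s \<gamma>(2) \<tau>(2)] by (auto simp: A_def f_def g_def)
  show "f z * f z = g z * g z" by (simp only: f2 g2)
  show "f z \<noteq> 0" using f2 discs_nonzero[OF r \<gamma>(1)] z by (auto simp: A_def)
qed

lemma S_fun_eq:
  assumes "admissible_radii r" "sqrt_branches r s" "\<gamma> \<in> Gam"
    and x: "x \<in> carrier_mat n n" "spectrum x \<subseteq> discs r \<gamma>"
  shows "S_fun r s \<gamma> \<tau> x = hol_calc (branch r s \<gamma> \<tau>) x"
proof -
  have "s \<gamma> holomorphic_on discs r \<gamma>" using assms by (simp add: sqrt_branches_def)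
  from hol_calc_mult[OF x(1) open_discs x(2) this iota_holomorphic[OF assms(1,3), of \<tau>]]
  show ?thesis by (simp add: S_fun_def branch_def[abs_def])
qed

section \<open>The chart domains are Zariski-freely open\<close>

lemma Md2_eq: "p \<in> Md 2 \<Longrightarrow> p = [p ! 0, p ! 1]"
  by (auto simp: Md_def Mn_def numeral_2_eq_2 length_Suc_conv)

lemma mat_diff_eq_0_iff:
  fixes A B :: "complex mat"
  assumes "A \<in> carrier_mat n n" "B \<in> carrier_mat n n"
  shows "A - B = 0\<^sub>m n n \<longleftrightarrow> A = B"
proof
  assume e: "A - B = 0\<^sub>m n n"
  have "A = (A - B) + B" using assms by (intro eq_matI) auto
  also have "\<dots> = B" unfolding e using assms by simp
  finally show "A = B" .
qed (use assms in auto)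

lemma U_set_eq:
  "U_set r \<gamma> = {p \<in> spec_dom 2 1 (discs r \<gamma>).
     \<forall>\<tau>\<in>nonconst_signs \<gamma>. comm_fun (iota r \<gamma> \<tau>) p \<noteq> 0\<^sub>m (nc_size p) (nc_size p)}"
proof -
  have c: "comm_fun (iota r \<gamma> \<tau>) p \<noteq> 0\<^sub>m (nc_size p) (nc_size p)
      \<longleftrightarrow> p ! 0 * I_fun r \<gamma> \<tau> (p ! 1) \<noteq> I_fun r \<gamma> \<tau> (p ! 1) * p ! 0" if "p \<in> Md 2" for p \<tau>
  proof -
    have c0: "p ! 0 \<in> carrier_mat (nc_size p) (nc_size p)" and c1: "p ! 1 \<in> carrier_mat (nc_size p) (nc_size p)"
      using Md_nth[OF that] by auto
    note h = hol_calc_carrier[OF c1, of "iota r \<gamma> \<tau>"]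
    show ?thesis
      unfolding comm_fun_def I_fun_def mat_diff_eq_0_iff[OF mult_carrier_mat[OF c0 h] mult_carrier_mat[OF h c0]] ..
  qed
  have D: "p ! 1 \<in> D_set r \<gamma> \<longleftrightarrow> spectrum (p ! 1) \<subseteq> discs r \<gamma>" if "p \<in> Md 2" for p
  proof -
    have "p ! 1 \<in> carrier_mat (nc_size p) (nc_size p)" "1 \<le> nc_size p"
      using Md_nth[OF that] MdE[OF that] by auto
    then show ?thesis unfolding D_set_def by auto
  qed
  have U: "p \<in> U_set r \<gamma> \<longleftrightarrow> p \<in> Md 2 \<and> p ! 1 \<in> D_set r \<gamma> \<and>
      (\<forall>\<tau>\<in>nonconst_signs \<gamma>. p ! 0 * I_fun r \<gamma> \<tau> (p ! 1) \<noteq> I_fun r \<gamma> \<tau> (p ! 1) * p ! 0)" for p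
  proof
    assume "p \<in> U_set r \<gamma>"
    then show "p \<in> Md 2 \<and> p ! 1 \<in> D_set r \<gamma> \<and>
      (\<forall>\<tau>\<in>nonconst_signs \<gamma>. p ! 0 * I_fun r \<gamma> \<tau> (p ! 1) \<noteq> I_fun r \<gamma> \<tau> (p ! 1) * p ! 0)"
      unfolding U_set_def by auto
  next
    assume a: "p \<in> Md 2 \<and> p ! 1 \<in> D_set r \<gamma> \<and>
      (\<forall>\<tau>\<in>nonconst_signs \<gamma>. p ! 0 * I_fun r \<gamma> \<tau> (p ! 1) \<noteq> I_fun r \<gamma> \<tau> (p ! 1) * p ! 0)"
    have e: "[p ! 0, p ! 1] = p" by (rule Md2_eq[symmetric]) (use a in blast)
    show "p \<in> U_set r \<gamma>" unfolding U_set_def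
      by (rule CollectI, rule exI[of _ "p ! 0"], rule exI[of _ "p ! 1"], simp only: e a simp_thms)
        (use a in blast)
  qed
  show ?thesis
  proof (rule Set.set_eqI)
    fix p
    show "p \<in> U_set r \<gamma> \<longleftrightarrow> p \<in> {p \<in> spec_dom 2 1 (discs r \<gamma>).
        \<forall>\<tau>\<in>nonconst_signs \<gamma>. comm_fun (iota r \<gamma> \<tau>) p \<noteq> 0\<^sub>m (nc_size p) (nc_size p)}"
      using U[of p] c[of p] D[of p] by (cases "p \<in> Md 2") (simp_all add: spec_dom_def del: One_nat_def)
  qed
qed

lemma U_setD:
  assumes "p \<in> U_set r \<gamma>"
  shows "p \<in> Md 2" "p ! 0 \<in> carrier_mat (nc_size p) (nc_size p)" "p ! 1 \<in> carrier_mat (nc_size p) (nc_size p)"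
    "spectrum (p ! 1) \<subseteq> discs r \<gamma>"
proof -
  show p: "p \<in> Md 2" and "spectrum (p ! 1) \<subseteq> discs r \<gamma>" using assms by (auto simp: U_set_eq spec_dom_def)
  show "p ! 0 \<in> carrier_mat (nc_size p) (nc_size p)" "p ! 1 \<in> carrier_mat (nc_size p) (nc_size p)"
    using Md_nth[OF p] by auto
qed

text \<open>A finite \<open>\<gamma>\<close> has finitely many sign functions, so only finitely many
  varieties are removed from the free domain of points with spectrum in the discs.\<close>

lemma openin_U_set:
  assumes r: "admissible_radii r" and \<gamma>: "\<gamma> \<in> Gam"
  shows "openin (zariski_free_topology 2) (U_set r \<gamma>)"
proof -
  let ?D = "spec_dom 2 1 (discs r \<gamma>)"
  define T where "T \<tau> = {p \<in> ?D. \<forall>g\<in>{comm_fun (iota r \<gamma> \<tau>)}. g p = 0\<^sub>m (nc_size p) (nc_size p)}" for \<tau>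
  have "finite (signs \<gamma>)" using \<gamma> by (auto simp: signs_def Gam_def intro!: finite_PiE)
  then have fin: "finite (T ` nonconst_signs \<gamma>)" by (auto simp: nonconst_signs_def)
  have "free_variety 2 ?D (T \<tau>)" for \<tau>
    unfolding free_variety_def T_def
    using freely_holomorphic_comm_fun[OF open_discs iota_holomorphic[OF r \<gamma>, of \<tau>]]
    by (intro exI[of _ "{comm_fun (iota r \<gamma> \<tau>)}"]) simp
  moreover have "free_domain 2 ?D" by (rule free_domain_spec_dom[OF _ open_discs]) simp
  ultimately have "?D - \<Union>(T ` nonconst_signs \<gamma>) \<in> zariski_free_base 2"
    unfolding zariski_free_base_def using fin
    by (intro CollectI exI[of _ ?D] exI[of _ "T ` nonconst_signs \<gamma>"]) auto
  moreover have "U_set r \<gamma> = ?D - \<Union>(T ` nonconst_signs \<gamma>)" by (auto simp: U_set_eq T_def)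
  ultimately show ?thesis using openin_zariski_base[of 2] by simp
qed

lemma openin_U_dom:
  assumes r: "admissible_radii r" and s: "sqrt_branches r s" and \<gamma>: "\<gamma> \<in> Gam" and S: "free_domain 2 S"
  shows "openin (zariski_free_topology 2) (U_dom r s S \<gamma> \<tau>)"
proof -
  let ?f = "branch r s \<gamma> \<tau>"
  let ?T = "{x \<in> spec_dom 2 1 (discs r \<gamma>). [x ! 0 + hol_calc ?f (x ! 1), x ! 0 - hol_calc ?f (x ! 1)] \<in> S}"
  have "U_dom r s S \<gamma> \<tau> = U_set r \<gamma> \<inter> ?T"
  proof -
    have "omega r s \<gamma> \<tau> p = [p ! 0 + hol_calc ?f (p ! 1), p ! 0 - hol_calc ?f (p ! 1)]" if "p \<in> U_set r \<gamma>" for p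
      using S_fun_eq[OF r s \<gamma> U_setD(3,4)[OF that]] by (simp add: omega_def Let_def)
    then show ?thesis by (auto simp: U_dom_def U_set_eq)
  qed
  moreover have "openin (zariski_free_topology 2) ?T"
    using free_domain_add_diff[OF open_discs branch_holomorphic[OF r s \<gamma>] S]
    by (rule free_domain_openin_zariski[rotated]) simp
  ultimately show ?thesis using openin_Int[OF openin_U_set[OF r \<gamma>]] by (simp only:)
qed

section \<open>Coincidence of two charts\<close>

definition agree :: "(complex \<Rightarrow> complex) \<Rightarrow> (complex \<Rightarrow> complex) \<Rightarrow> complex set \<Rightarrow> complex set" where
  "agree f g A = {z \<in> A. f z = g z}"

text \<open>Equality of functions is in general a closed condition. Here f = g or f = -g holds at
  each point and f has no zero, so f = g means f + g \<noteq> 0.\<close>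

lemma open_agree:
  assumes A: "open A" and f: "f holomorphic_on A" and g: "g holomorphic_on A"
    and sq: "\<And>z. z \<in> A \<Longrightarrow> f z * f z = g z * g z" "\<And>z. z \<in> A \<Longrightarrow> f z \<noteq> 0"
  shows "open (agree f g A)"
proof -
  have "z \<in> agree f g A \<longleftrightarrow> z \<in> A \<and> f z + g z \<noteq> 0" for z
  proof (cases "z \<in> A")
    case True
    then have "f z = g z \<or> f z = - g z" using sq(1) by (simp add: square_eq_iff)
    then show ?thesis using True sq(2)[OF True] by (auto simp: agree_def)
  qed (simp add: agree_def)
  then have "agree f g A = A \<inter> (\<lambda>z. f z + g z) -` (- {0})" by auto
  moreover have "continuous_on A (\<lambda>z. f z + g z)"
    using f g by (intro continuous_intros holomorphic_on_imp_continuous_on)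
  ultimately show ?thesis using continuous_open_preimage[OF _ A, of "\<lambda>z. f z + g z" "- {0}"] by auto
qed

text \<open>With \<open>J = F\<^sup>-\<^sup>1 F'\<close> the hypothesis reads \<open>u = J u J\<close>, and \<open>J\<^sup>2 = 1\<close>.\<close>

lemma involution_commutes:
  assumes x: "x \<in> carrier_mat n n" "u \<in> carrier_mat n n" and A: "open A" "spectrum x \<subseteq> A"
    and f: "f holomorphic_on A" and g: "g holomorphic_on A"
    and sq: "\<And>z. z \<in> A \<Longrightarrow> f z * f z = g z * g z" "\<And>z. z \<in> A \<Longrightarrow> f z \<noteq> 0"
    and eq: "hol_calc f x * u * hol_calc f x = hol_calc g x * u * hol_calc g x"
  shows "u * hol_calc (\<lambda>z. g z / f z) x = hol_calc (\<lambda>z. g z / f z) x * u"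
proof -
  define F where "F = hol_calc f x"
  define F' where "F' = hol_calc g x"
  define G where "G = hol_calc (\<lambda>z. 1 / f z) x"
  define J where "J = hol_calc (\<lambda>z. g z / f z) x"
  have j: "(\<lambda>z. g z / f z) holomorphic_on A" and i: "(\<lambda>z. 1 / f z) holomorphic_on A"
    using sq(2) by (auto intro!: holomorphic_intros f g)
  have one: "hol_calc h x = 1\<^sub>m n" if "\<And>z. z \<in> A \<Longrightarrow> h z = 1" for h
    using hol_calc_poly[OF x(1) A, of h 1] that by (simp add: peval_one[OF x(1)])
  have FG: "F * G = 1\<^sub>m n" unfolding F_def G_def hol_calc_mult[OF x(1) A f i, symmetric] by (rule one) (simp add: sq(2))
  have GF: "G * F = 1\<^sub>m n" unfolding F_def G_def hol_calc_mult[OF x(1) A i f, symmetric] by (rule one) (simp add: sq(2))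
  have JJ: "J * J = 1\<^sub>m n" unfolding J_def hol_calc_mult[OF x(1) A j j, symmetric]
  proof (rule one)
    fix z assume "z \<in> A"
    then show "g z / f z * (g z / f z) = 1" using sq[of z] by (simp flip: sq(1))
  qed
  have FJ: "F * J = F'" unfolding F_def J_def F'_def hol_calc_mult[OF x(1) A f j, symmetric]
    by (rule hol_calc_cong[OF x(1) A g]) (simp add: sq(2))
  have JF: "J * F = F'" unfolding F_def J_def F'_def hol_calc_mult[OF x(1) A j f, symmetric]
    by (rule hol_calc_cong[OF x(1) A g]) (simp add: sq(2))
  have c: "F \<in> carrier_mat n n" "G \<in> carrier_mat n n" "J \<in> carrier_mat n n"
    using x by (auto simp: F_def G_def J_def)
  note m = mult_carrier_mat[where n = n and nr = n and nc = n]
  note as = assoc_mult_mat[where ?n\<^sub>1.0 = n and ?n\<^sub>2.0 = n and ?n\<^sub>3.0 = n and ?n\<^sub>4.0 = n]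
  have cancel: "G * (F * w * F) * G = w" if w: "w \<in> carrier_mat n n" for w
  proof -
    have "G * (F * w * F) * G = (G * F) * w * (F * G)" using c w by (simp add: as m)
    then show ?thesis using w by (simp add: FG GF)
  qed
  have eq': "F * u * F = F' * u * F'" using eq unfolding F_def F'_def .
  \<comment> \<open>From F J = J F = F' the hypothesis becomes F u F = F (J u J) F, where F is
    cancelled by its inverse G.\<close>
  have "F * u * F = (F * J) * u * (J * F)" by (simp only: eq' FJ JF)
  also have "\<dots> = F * (J * u * J) * F" using c x(2) by (simp add: as m)
  finally have "G * (F * u * F) * G = G * (F * (J * u * J) * F) * G" by simp
  then have uJ: "u = J * u * J" using cancel[OF x(2)] cancel[of "J * u * J"] c x(2) by (simp add: m)
  have "u * J = (J * u * J) * J" using uJ by simp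
  also have "\<dots> = J * u * (J * J)" using c x(2) by (simp add: as m)
  also have "\<dots> = J * u" using c x(2) by (simp add: JJ m right_mult_one_mat[of _ n n])
  finally show ?thesis by (simp add: J_def)
qed

text \<open>When \<open>r\<^sub>\<gamma>\<^sub>' \<le> r\<^sub>\<gamma>\<close>, each disc of \<open>\<gamma>'\<close> meets at most one disc of \<open>\<gamma>\<close>, so that the quotient of the
  two square roots is constant on the trace of each disc of \<open>\<gamma>'\<close>, that is, it is some \<open>\<iota>\<^sub>\<gamma>\<^sub>'\<^sub>\<tau>\<close>.\<close>

lemma quotient_constant_on_disc:
  fixes j :: "complex \<Rightarrow> complex"
  assumes r: "admissible_radii r" and \<gamma>: "\<gamma> \<in> Gam" "\<gamma>' \<in> Gam" and le: "r \<gamma>' \<le> r \<gamma>"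
    and j: "continuous_on (discs r \<gamma> \<inter> discs r \<gamma>') j" "\<And>z. z \<in> discs r \<gamma> \<inter> discs r \<gamma>' \<Longrightarrow> j z = 1 \<or> j z = -1"
    and d: "d \<in> \<gamma>'" and z: "z \<in> discs r \<gamma> \<inter> ball d (r \<gamma>')" and w: "w \<in> discs r \<gamma> \<inter> ball d (r \<gamma>')"
  shows "j z = j w"
proof -
  obtain c where c: "c \<in> \<gamma>" "z \<in> ball c (r \<gamma>)" using z by (auto simp: discs_eq)
  obtain c' where c': "c' \<in> \<gamma>" "w \<in> ball c' (r \<gamma>)" using w by (auto simp: discs_eq)
  have "c' = c"
  proof (rule ccontr)
    assume "c' \<noteq> c"
    then have "r \<gamma> < 1/4 * cmod (c - c')" using r \<gamma>(1) c(1) c'(1) by (auto simp: admissible_radii_def)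
    \<comment> \<open>The path c, z, d, w, c' is shorter than
      \<open>2 * r \<gamma> + 2 * r \<gamma>'\<close>, which is at most
      \<open>4 * r \<gamma>\<close>.\<close>
    moreover have "dist c c' \<le> dist c z + dist z d + dist d w + dist w c'"
      using dist_triangle[of c c' z] dist_triangle[of z c' d] dist_triangle[of d c' w] by linarith
    ultimately show False using c(2) c'(2) z w le by (simp add: dist_commute flip: dist_norm)
  qed
  \<comment> \<open>The intersection of two discs is convex, hence connected, and a continuous
    function with values 1 and -1 is constant there.\<close>
  let ?K = "ball c (r \<gamma>) \<inter> ball d (r \<gamma>')"
  have sub: "?K \<subseteq> discs r \<gamma> \<inter> discs r \<gamma>'" using c(1) d by (auto simp: discs_eq)
  have "j constant_on ?K"
  proof (rule continuous_finite_range_constant)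
    show "connected ?K" by (intro convex_connected convex_Int convex_ball)
    show "continuous_on ?K j" by (rule continuous_on_subset[OF j(1) sub])
    have "j ` ?K \<subseteq> {1, -1}" using j(2) sub by blast
    then show "finite (j ` ?K)" by (rule finite_subset) simp
  qed
  then show ?thesis using c(2) c'(2) z w \<open>c' = c\<close> unfolding constant_on_def by (metis IntD2 IntI)
qed

text \<open>If both alternatives fail, the quotient j of the branches takes the values 1 and -1 on
  the spectrum. It then equals \<open>iota r \<gamma>' \<kappa>\<close> on the common discs for a
  nonconstant \<open>\<kappa>\<close>, and its value at x commutes with u, contradicting membership
  of p in \<open>U_set r \<gamma>'\<close>.\<close>

lemma agree_dichotomy:
  assumes r: "admissible_radii r" and s: "sqrt_branches r s" and \<gamma>: "\<gamma> \<in> Gam" "\<gamma>' \<in> Gam"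
    and \<tau>: "\<tau> \<in> signs \<gamma>" "\<tau>' \<in> signs \<gamma>'" and le: "r \<gamma>' \<le> r \<gamma>"
    and p: "p \<in> U_set r \<gamma>" "p \<in> U_set r \<gamma>'" and eq: "Phi r s \<gamma> \<tau> p = Phi r s \<gamma>' \<tau>' p"
  shows "spectrum (p ! 1) \<subseteq> agree (branch r s \<gamma> \<tau>) (branch r s \<gamma>' \<tau>') (discs r \<gamma> \<inter> discs r \<gamma>') \<or>
    spectrum (p ! 1) \<subseteq> agree (branch r s \<gamma> \<tau>) (\<lambda>z. - branch r s \<gamma>' \<tau>' z) (discs r \<gamma> \<inter> discs r \<gamma>')"
proof (rule ccontr)
  assume neg: "\<not> ?thesis"
  let ?A = "discs r \<gamma> \<inter> discs r \<gamma>'" and ?f = "branch r s \<gamma> \<tau>" and ?g = "branch r s \<gamma>' \<tau>'"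
  define n where "n = nc_size p"
  define u where "u = p ! 0"
  define x where "x = p ! 1"
  define j where "j = (\<lambda>z. ?g z / ?f z)"
  have ux: "u \<in> carrier_mat n n" "x \<in> carrier_mat n n" and sp: "spectrum x \<subseteq> ?A"
    using U_setD[OF p(1)] U_setD(4)[OF p(2)] by (auto simp: n_def u_def x_def)
  have A: "open ?A" by (intro open_Int open_discs)
  note f = branch_pair(1)[OF r s \<gamma> \<tau>] and g = branch_pair(2)[OF r s \<gamma> \<tau>] and sq = branch_pair(3,4)[OF r s \<gamma> \<tau>]
  have jh: "j holomorphic_on ?A" unfolding j_def by (intro holomorphic_intros f g sq(2))
  have j1: "j z = 1 \<or> j z = -1" if "z \<in> ?A" for z
  proof -
    have "?g z = ?f z \<or> ?g z = - ?f z" using sq(1)[OF that, symmetric] by (simp add: square_eq_iff)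
    then show ?thesis using sq(2)[OF that] by (auto simp: j_def)
  qed
  have "S_fun r s \<gamma> \<tau> x = hol_calc ?f x" "S_fun r s \<gamma>' \<tau>' x = hol_calc ?g x"
    using S_fun_eq[OF r s \<gamma>(1) ux(2), of \<tau>] S_fun_eq[OF r s \<gamma>(2) ux(2), of \<tau>'] sp by auto
  then have "hol_calc ?f x * u * hol_calc ?f x = hol_calc ?g x * u * hol_calc ?g x"
    using eq by (simp add: Phi_def Let_def u_def x_def)
  then have comm: "u * hol_calc j x = hol_calc j x * u"
    unfolding j_def by (intro involution_commutes[OF ux(2,1) A sp f g sq])
  \<comment> \<open>A disc of \<open>\<gamma>'\<close> that misses the discs of
    \<open>\<gamma>\<close> gets the sign 1, so that \<open>\<kappa>\<close> is a sign function on
    all of \<open>\<gamma>'\<close>. On the other discs j is constant, so any point w gives the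
    right sign.\<close>
  define \<kappa> where "\<kappa> = restrict (\<lambda>d. if discs r \<gamma> \<inter> ball d (r \<gamma>') = {} then 1
      else j (SOME w. w \<in> discs r \<gamma> \<inter> ball d (r \<gamma>'))) \<gamma>'"
  have \<kappa>: "\<kappa> d = j z" if "d \<in> \<gamma>'" "z \<in> discs r \<gamma> \<inter> ball d (r \<gamma>')" for d z
  proof -
    have w0: "(SOME w. w \<in> discs r \<gamma> \<inter> ball d (r \<gamma>')) \<in> discs r \<gamma> \<inter> ball d (r \<gamma>')" using that(2) by (rule someI)
    have "j (SOME w. w \<in> discs r \<gamma> \<inter> ball d (r \<gamma>')) = j z"
      by (rule quotient_constant_on_disc[OF r \<gamma> le holomorphic_on_imp_continuous_on[OF jh] j1 that(1) w0 that(2)])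
    then show ?thesis using that by (auto simp: \<kappa>_def)
  qed
  have iota: "iota r \<gamma>' \<kappa> z = j z" if z: "z \<in> ?A" for z
  proof -
    obtain d where d: "d \<in> \<gamma>'" "z \<in> ball d (r \<gamma>')" using z by (auto simp: discs_eq)
    then show ?thesis using iota_eq[OF r \<gamma>(2) d] \<kappa>[OF d(1)] z by simp
  qed
  have "\<kappa> d \<in> {-1, 1}" if "d \<in> \<gamma>'" for d
  proof (cases "discs r \<gamma> \<inter> ball d (r \<gamma>') = {}")
    case False
    then obtain z where z: "z \<in> discs r \<gamma> \<inter> ball d (r \<gamma>')" by blast
    then have "z \<in> ?A" using that by (auto simp: discs_eq)
    then show ?thesis using \<kappa>[OF that z] j1 by auto
  qed (use that in \<open>simp add: \<kappa>_def\<close>)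
  then have \<kappa>s: "\<kappa> \<in> signs \<gamma>'" by (auto simp: signs_def PiE_iff \<kappa>_def)
  obtain z1 where z1: "z1 \<in> spectrum x" "?f z1 \<noteq> ?g z1"
    using neg sp by (auto simp: agree_def x_def)
  obtain z2 where z2: "z2 \<in> spectrum x" "?f z2 \<noteq> - ?g z2"
    using neg sp by (auto simp: agree_def x_def)
  have z1A: "z1 \<in> ?A" and z2A: "z2 \<in> ?A" using z1 z2 sp by auto
  have "j z1 \<noteq> 1" using z1 sq(2)[OF z1A] by (auto simp: j_def)
  moreover have "j z2 \<noteq> -1" using z2 sq(2)[OF z2A] by (auto simp: j_def field_simps)
  ultimately have ne: "j z1 \<noteq> j z2" using j1[OF z1A] j1[OF z2A] by auto
  obtain d1 d2 where d: "d1 \<in> \<gamma>'" "z1 \<in> ball d1 (r \<gamma>')" "d2 \<in> \<gamma>'" "z2 \<in> ball d2 (r \<gamma>')"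
    using z1A z2A by (auto simp: discs_eq)
  have "\<kappa> d1 \<noteq> \<kappa> d2" using \<kappa>[OF d(1), of z1] \<kappa>[OF d(3), of z2] d z1A z2A ne by auto
  then have "\<kappa> \<in> nonconst_signs \<gamma>'" using \<kappa>s d by (auto simp: nonconst_signs_def)
  then have "comm_fun (iota r \<gamma>' \<kappa>) p \<noteq> 0\<^sub>m n n" using p(2) by (auto simp: U_set_eq n_def)
  moreover have hc: "hol_calc (iota r \<gamma>' \<kappa>) x = hol_calc j x" by (rule hol_calc_cong[OF ux(2) A sp jh iota])
  have "comm_fun (iota r \<gamma>' \<kappa>) p = u * hol_calc j x - hol_calc j x * u"
    unfolding comm_fun_def u_def[symmetric] x_def[symmetric] hc ..
  moreover have "u * hol_calc j x - hol_calc j x * u = 0\<^sub>m n n"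
    using comm mat_diff_eq_0_iff[OF mult_carrier_mat[OF ux(1) hol_calc_carrier[OF ux(2)]] mult_carrier_mat[OF hol_calc_carrier[OF ux(2)] ux(1)]]
    by blast
  ultimately show False by simp
qed

lemma Phi_nth [simp]: "Phi r s \<gamma> \<tau> p ! 0 = p ! 0" "Phi r s \<gamma> \<tau> p ! 1 = p ! 1" "Phi r s \<gamma> \<tau> p ! Suc 0 = p ! Suc 0"
  by (simp_all add: Phi_def Let_def)

text \<open>Every chart keeps u and x as the first two components, so two charts can identify only
  equal parameters.\<close>

lemma Phi_inject:
  assumes "p \<in> Md 2" "q \<in> Md 2" "Phi r s \<gamma> \<tau> p = Phi r s \<gamma>' \<tau>' q"
  shows "p = q"
proof -
  have "p ! 0 = q ! 0" using arg_cong[OF assms(3), of "\<lambda>x. x ! 0"] by simp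
  moreover have "p ! 1 = q ! 1" using arg_cong[OF assms(3), of "\<lambda>x. x ! 1"] by simp
  ultimately show ?thesis using Md2_eq[OF assms(1)] Md2_eq[OF assms(2)] by argo
qed

text \<open>Two pieces, because F u F does not change when F is replaced by -F: the branches agree
  on the whole spectrum or are opposite on the whole of it.\<close>

definition coincidence :: "(complex set \<Rightarrow> real) \<Rightarrow> (complex set \<Rightarrow> complex \<Rightarrow> complex) \<Rightarrow> complex set \<Rightarrow>
    (complex \<Rightarrow> complex) \<Rightarrow> complex set \<Rightarrow> (complex \<Rightarrow> complex) \<Rightarrow> ncpoint set" where
  "coincidence r s \<gamma> \<tau> \<gamma>' \<tau>' =
     spec_dom 2 1 (agree (branch r s \<gamma> \<tau>) (branch r s \<gamma>' \<tau>') (discs r \<gamma> \<inter> discs r \<gamma>')) \<union>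
     spec_dom 2 1 (agree (branch r s \<gamma> \<tau>) (\<lambda>z. - branch r s \<gamma>' \<tau>' z) (discs r \<gamma> \<inter> discs r \<gamma>'))"

context
  fixes r :: "complex set \<Rightarrow> real" and s :: "complex set \<Rightarrow> complex \<Rightarrow> complex"
  assumes r: "admissible_radii r" and s: "sqrt_branches r s"
begin

lemma open_agree_branch:
  assumes \<gamma>: "\<gamma> \<in> Gam" "\<gamma>' \<in> Gam" and \<tau>: "\<tau> \<in> signs \<gamma>" "\<tau>' \<in> signs \<gamma>'"
  shows "open (agree (branch r s \<gamma> \<tau>) (branch r s \<gamma>' \<tau>') (discs r \<gamma> \<inter> discs r \<gamma>'))"
    "open (agree (branch r s \<gamma> \<tau>) (\<lambda>z. - branch r s \<gamma>' \<tau>' z) (discs r \<gamma> \<inter> discs r \<gamma>'))"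
proof -
  let ?A = "discs r \<gamma> \<inter> discs r \<gamma>'" and ?f = "branch r s \<gamma> \<tau>" and ?g = "branch r s \<gamma>' \<tau>'"
  have A: "open ?A" by (intro open_Int open_discs)
  note f = branch_pair(1)[OF r s \<gamma> \<tau>] and g = branch_pair(2)[OF r s \<gamma> \<tau>] and sq = branch_pair(3,4)[OF r s \<gamma> \<tau>]
  show "open (agree ?f ?g ?A)" by (rule open_agree[OF A f g sq])
  show "open (agree ?f (\<lambda>z. - ?g z) ?A)"
    by (rule open_agree[OF A f holomorphic_on_minus[OF g]]) (simp_all add: sq)
qed

lemma openin_coincidence:
  assumes "\<gamma> \<in> Gam" "\<gamma>' \<in> Gam" "\<tau> \<in> signs \<gamma>" "\<tau>' \<in> signs \<gamma>'"
  shows "openin (zariski_free_topology 2) (coincidence r s \<gamma> \<tau> \<gamma>' \<tau>')"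
  unfolding coincidence_def using open_agree_branch[OF assms]
  by (intro openin_Un free_domain_openin_zariski free_domain_spec_dom) auto

text \<open>The dichotomy asks that the second radius not exceed the first; otherwise the charts
  exchange roles, which leaves the agreement sets unchanged. Conversely, in the opposite case the
  two signs cancel in F u F.\<close>

lemma Phi_eq_iff:
  assumes \<gamma>: "\<gamma> \<in> Gam" "\<gamma>' \<in> Gam" and \<tau>: "\<tau> \<in> signs \<gamma>" "\<tau>' \<in> signs \<gamma>'"
    and p: "p \<in> U_set r \<gamma>" "p \<in> U_set r \<gamma>'"
  shows "Phi r s \<gamma> \<tau> p = Phi r s \<gamma>' \<tau>' p \<longleftrightarrow> p \<in> coincidence r s \<gamma> \<tau> \<gamma>' \<tau>'"
proof
  let ?A = "discs r \<gamma> \<inter> discs r \<gamma>'" and ?f = "branch r s \<gamma> \<tau>" and ?g = "branch r s \<gamma>' \<tau>'"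
  assume eq: "Phi r s \<gamma> \<tau> p = Phi r s \<gamma>' \<tau>' p"
  have "spectrum (p ! 1) \<subseteq> agree ?f ?g ?A \<or> spectrum (p ! 1) \<subseteq> agree ?f (\<lambda>z. - ?g z) ?A"
  proof (cases "r \<gamma>' \<le> r \<gamma>")
    case True
    then show ?thesis by (rule agree_dichotomy[OF r s \<gamma> \<tau> _ p eq])
  next
    case False
    then have "spectrum (p ! 1) \<subseteq> agree ?g ?f (discs r \<gamma>' \<inter> discs r \<gamma>)
        \<or> spectrum (p ! 1) \<subseteq> agree ?g (\<lambda>z. - ?f z) (discs r \<gamma>' \<inter> discs r \<gamma>)"
      by (intro agree_dichotomy[OF r s \<gamma>(2,1) \<tau>(2,1) _ p(2,1) eq[symmetric]]) simp
    moreover have "agree ?g ?f (discs r \<gamma>' \<inter> discs r \<gamma>) = agree ?f ?g ?A"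
      "agree ?g (\<lambda>z. - ?f z) (discs r \<gamma>' \<inter> discs r \<gamma>) = agree ?f (\<lambda>z. - ?g z) ?A"
      by (auto simp: agree_def)
    ultimately show ?thesis by simp
  qed
  then show "p \<in> coincidence r s \<gamma> \<tau> \<gamma>' \<tau>'"
    using U_setD(1)[OF p(1)] by (auto simp: coincidence_def spec_dom_def)
next
  let ?A = "discs r \<gamma> \<inter> discs r \<gamma>'" and ?f = "branch r s \<gamma> \<tau>" and ?g = "branch r s \<gamma>' \<tau>'"
  define n where "n = nc_size p"
  have c: "p ! 0 \<in> carrier_mat n n" "p ! 1 \<in> carrier_mat n n" using U_setD[OF p(1)] by (auto simp: n_def)
  have Sf: "S_fun r s \<gamma> \<tau> (p ! 1) = hol_calc ?f (p ! 1)"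
    by (rule S_fun_eq[OF r s \<gamma>(1) c(2) U_setD(4)[OF p(1)]])
  have Sg: "S_fun r s \<gamma>' \<tau>' (p ! 1) = hol_calc ?g (p ! 1)"
    by (rule S_fun_eq[OF r s \<gamma>(2) c(2) U_setD(4)[OF p(2)]])
  note G = hol_calc_carrier[OF c(2), of ?g]
  assume "p \<in> coincidence r s \<gamma> \<tau> \<gamma>' \<tau>'"
  then consider (plus) "spectrum (p ! 1) \<subseteq> agree ?f ?g ?A" | (minus) "spectrum (p ! 1) \<subseteq> agree ?f (\<lambda>z. - ?g z) ?A"
    by (auto simp: coincidence_def spec_dom_def)
  then have "hol_calc ?f (p ! 1) * p ! 0 * hol_calc ?f (p ! 1) = hol_calc ?g (p ! 1) * p ! 0 * hol_calc ?g (p ! 1)"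
  proof cases
    case plus
    have "?g holomorphic_on agree ?f ?g ?A"
      using branch_holomorphic[OF r s \<gamma>(2)] by (rule holomorphic_on_subset) (auto simp: agree_def)
    then have "hol_calc ?f (p ! 1) = hol_calc ?g (p ! 1)"
      by (rule hol_calc_cong[OF c(2) open_agree_branch(1)[OF \<gamma> \<tau>] plus]) (simp add: agree_def)
    then show ?thesis by simp
  next
    case minus
    have g: "?g holomorphic_on agree ?f (\<lambda>z. - ?g z) ?A"
      using branch_holomorphic[OF r s \<gamma>(2)] by (rule holomorphic_on_subset) (auto simp: agree_def)
    note op = open_agree_branch(2)[OF \<gamma> \<tau>]
    have "hol_calc ?f (p ! 1) = hol_calc (\<lambda>z. - ?g z) (p ! 1)"
      by (rule hol_calc_cong[OF c(2) op minus holomorphic_on_minus[OF g]]) (simp add: agree_def)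
    also have "\<dots> = - hol_calc ?g (p ! 1)" by (rule hol_calc_uminus[OF c(2) op minus g])
    finally have e: "hol_calc ?f (p ! 1) = - hol_calc ?g (p ! 1)" .
    have "(- M) * N * (- M) = M * N * M" if "M \<in> carrier_mat n n" "N \<in> carrier_mat n n" for M N :: "complex mat"
      using that mult_carrier_mat[OF that] by simp
    from this[OF G c(1)] show ?thesis by (simp only: e)
  qed
  then show "Phi r s \<gamma> \<tau> p = Phi r s \<gamma>' \<tau>' p"
    unfolding Phi_def Let_def Sf Sg by (rule arg_cong[of _ _ "\<lambda>M. [p ! 0, p ! 1, M]"])
qed

text \<open>Together with the openness of \<open>coincidence\<close> this description of an overlap
  gives the base property of \<open>G_base\<close>, the openness of the charts, and the domains of
  the transition maps.\<close>

lemma Phi_image_Int: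
  assumes "\<gamma> \<in> Gam" "\<gamma>' \<in> Gam" "\<tau> \<in> signs \<gamma>" "\<tau>' \<in> signs \<gamma>'"
    and U: "U \<subseteq> U_set r \<gamma>" "U' \<subseteq> U_set r \<gamma>'"
  shows "Phi r s \<gamma> \<tau> ` U \<inter> Phi r s \<gamma>' \<tau>' ` U' = Phi r s \<gamma> \<tau> ` (U \<inter> U' \<inter> coincidence r s \<gamma> \<tau> \<gamma>' \<tau>')"
proof (intro equalityI subsetI)
  fix y assume "y \<in> Phi r s \<gamma> \<tau> ` U \<inter> Phi r s \<gamma>' \<tau>' ` U'"
  then obtain p q where pq: "p \<in> U" "y = Phi r s \<gamma> \<tau> p" "q \<in> U'" "y = Phi r s \<gamma>' \<tau>' q" by auto
  then have m: "p \<in> U_set r \<gamma>" "q \<in> U_set r \<gamma>'" using U by auto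
  have "Phi r s \<gamma> \<tau> p = Phi r s \<gamma>' \<tau>' q" using pq by simp
  then have "p = q" by (rule Phi_inject[OF U_setD(1)[OF m(1)] U_setD(1)[OF m(2)]])
  then show "y \<in> Phi r s \<gamma> \<tau> ` (U \<inter> U' \<inter> coincidence r s \<gamma> \<tau> \<gamma>' \<tau>')"
    using pq m Phi_eq_iff[OF assms(1-4), of p] by blast
next
  fix y assume "y \<in> Phi r s \<gamma> \<tau> ` (U \<inter> U' \<inter> coincidence r s \<gamma> \<tau> \<gamma>' \<tau>')"
  then obtain p where p: "p \<in> U" "p \<in> U'" "p \<in> coincidence r s \<gamma> \<tau> \<gamma>' \<tau>'" "y = Phi r s \<gamma> \<tau> p" by auto
  then have "y = Phi r s \<gamma>' \<tau>' p" using Phi_eq_iff[OF assms(1-4), of p] U by auto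
  then show "y \<in> Phi r s \<gamma> \<tau> ` U \<inter> Phi r s \<gamma>' \<tau>' ` U'" using p by blast
qed

section \<open>The topology generated by the images of the charts\<close>

lemma G_baseE:
  assumes "B \<in> G_base r s"
  obtains \<gamma> \<tau> U where "B = Phi r s \<gamma> \<tau> ` U" "\<gamma> \<in> Gam" "\<tau> \<in> signs \<gamma>" "U \<subseteq> U_set r \<gamma>" "openin (zariski_free_topology 2) U"
  using assms unfolding G_base_def by blast

lemma G_baseI:
  "\<gamma> \<in> Gam \<Longrightarrow> \<tau> \<in> signs \<gamma> \<Longrightarrow> U \<subseteq> U_set r \<gamma> \<Longrightarrow> openin (zariski_free_topology 2) U \<Longrightarrow> Phi r s \<gamma> \<tau> ` U \<in> G_base r s"
  unfolding G_base_def by blast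

lemma openin_G_iff: "openin (G_topology r s) W \<longleftrightarrow> (\<forall>y\<in>W. \<exists>B\<in>G_base r s. y \<in> B \<and> B \<subseteq> W)"
  unfolding G_topology_def
proof (rule openin_topology_with_base)
  fix B B' y assume B: "B \<in> G_base r s" "B' \<in> G_base r s" "y \<in> B" "y \<in> B'"
  obtain \<gamma> \<tau> U where U: "B = Phi r s \<gamma> \<tau> ` U" "\<gamma> \<in> Gam" "\<tau> \<in> signs \<gamma>" "U \<subseteq> U_set r \<gamma>" "openin (zariski_free_topology 2) U"
    using B(1) by (rule G_baseE) (rule that)
  obtain \<gamma>' \<tau>' U' where U': "B' = Phi r s \<gamma>' \<tau>' ` U'" "\<gamma>' \<in> Gam" "\<tau>' \<in> signs \<gamma>'" "U' \<subseteq> U_set r \<gamma>'" "openin (zariski_free_topology 2) U'"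
    using B(2) by (rule G_baseE) (rule that)
  have "B \<inter> B' = Phi r s \<gamma> \<tau> ` (U \<inter> U' \<inter> coincidence r s \<gamma> \<tau> \<gamma>' \<tau>')"
    unfolding U(1) U'(1) by (rule Phi_image_Int[OF U(2) U'(2) U(3) U'(3) U(4) U'(4)])
  moreover have "\<dots> \<in> G_base r s"
    using U(4) by (intro G_baseI[OF U(2,3)] openin_Int U(5) U'(5) openin_coincidence[OF U(2) U'(2) U(3) U'(3)]) blast
  ultimately show "\<exists>W\<in>G_base r s. y \<in> W \<and> W \<subseteq> B \<inter> B'" using B by (intro bexI[of _ "B \<inter> B'"]) auto
qed

lemma openin_G_Phi_image:
  "\<gamma> \<in> Gam \<Longrightarrow> \<tau> \<in> signs \<gamma> \<Longrightarrow> U \<subseteq> U_set r \<gamma> \<Longrightarrow> openin (zariski_free_topology 2) U \<Longrightarrow>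
    openin (G_topology r s) (Phi r s \<gamma> \<tau> ` U)"
  using G_baseI[of \<gamma> \<tau> U] unfolding openin_G_iff by blast

text \<open>This is continuity of the parametrisation. A basic set about the image point may come
  from another chart, but its part in the image of D is the image of an open set under the given
  chart.\<close>

lemma openin_Phi_preimage:
  assumes \<gamma>: "\<gamma> \<in> Gam" and \<tau>: "\<tau> \<in> signs \<gamma>" and D: "D \<subseteq> U_set r \<gamma>" "openin (zariski_free_topology 2) D"
    and W: "openin (G_topology r s) W"
  shows "openin (zariski_free_topology 2) {p \<in> D. Phi r s \<gamma> \<tau> p \<in> W}"
proof (subst openin_subopen, intro ballI)
  fix p assume "p \<in> {p \<in> D. Phi r s \<gamma> \<tau> p \<in> W}"
  then have p: "p \<in> D" "Phi r s \<gamma> \<tau> p \<in> W" by auto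
  then obtain B where B: "B \<in> G_base r s" "Phi r s \<gamma> \<tau> p \<in> B" "B \<subseteq> W" using W unfolding openin_G_iff by blast
  obtain \<gamma>' \<tau>' U' where U': "B = Phi r s \<gamma>' \<tau>' ` U'" "\<gamma>' \<in> Gam" "\<tau>' \<in> signs \<gamma>'" "U' \<subseteq> U_set r \<gamma>'" "openin (zariski_free_topology 2) U'"
    using B(1) by (rule G_baseE) (rule that)
  let ?T = "D \<inter> U' \<inter> coincidence r s \<gamma> \<tau> \<gamma>' \<tau>'"
  have im: "Phi r s \<gamma> \<tau> ` D \<inter> B = Phi r s \<gamma> \<tau> ` ?T"
    unfolding U'(1) by (rule Phi_image_Int[OF \<gamma> U'(2) \<tau> U'(3) D(1) U'(4)])
  then obtain q where q: "q \<in> ?T" "Phi r s \<gamma> \<tau> p = Phi r s \<gamma> \<tau> q" using p B(2) by blast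
  have "p \<in> U_set r \<gamma>" "q \<in> U_set r \<gamma>" using p q D(1) by auto
  then have "p = q" using Phi_inject[OF U_setD(1) U_setD(1) q(2)] by blast
  moreover have "?T \<subseteq> {p \<in> D. Phi r s \<gamma> \<tau> p \<in> W}" using im B(3) by blast
  moreover have "openin (zariski_free_topology 2) ?T"
    by (intro openin_Int D(2) U'(5) openin_coincidence[OF \<gamma> U'(2) \<tau> U'(3)])
  ultimately show "\<exists>T. openin (zariski_free_topology 2) T \<and> p \<in> T \<and> T \<subseteq> {p \<in> D. Phi r s \<gamma> \<tau> p \<in> W}"
    using q(1) by blast
qed

end

section \<open>The atlas\<close>

text \<open>F is known to be the identity only on N, so closure of N under direct sums is what
  determines F at a direct sum.\<close>

lemma nc_mapping_id:
  assumes d: "0 < d" and N: "nc_set d N" and F: "\<And>p. p \<in> N \<Longrightarrow> F p = p"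
  shows "nc_mapping d d N F"
proof -
  have sub: "N \<subseteq> Md d" and ds: "nc_dsum x y \<in> N" if "x \<in> N" "y \<in> N" for x y
    using N that by (auto simp: nc_set_def)
  have "nc_function d N (\<lambda>x. F x ! k)" if k: "k < d" for k
    unfolding nc_function_def graded_on_def
  proof (intro conjI ballI allI impI)
    show "nc_set d N" by (rule N)
    show "F x ! k \<in> carrier_mat n n" if "x \<in> N \<inter> Mn d n" for n x
      using that F MnD[of x d n k] k by simp
    show "F (nc_dsum x y) ! k = dsum_mat (F x ! k) (F y ! k)" if xy: "x \<in> N" "y \<in> N" for x y
    proof -
      have "x \<in> Md d" "y \<in> Md d" using sub[OF xy] xy by auto
      then show ?thesis using nc_dsum_nth[OF MdE(1)[OF _ d] MdE(1)[OF _ d] k] F xy ds[OF xy] by simp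
    qed
    show "F (nc_conj t x) ! k = mat_inv t * F x ! k * t"
      if "x \<in> N \<inter> Mn d n" "invertible_mat t \<and> nc_conj t x \<in> N" for n x t
      using that F nc_conj_nth[of x d n k t] k by simp
  qed
  moreover have "F x \<in> Md d" if "x \<in> N" for x using sub[OF that that] that F by auto
  ultimately show ?thesis using N by (simp add: nc_mapping_def)
qed

theorem theorem9p10:
  fixes r :: "complex set \<Rightarrow> real"
    and s :: "complex set \<Rightarrow> complex \<Rightarrow> complex"
    and S :: "ncpoint set"
  assumes "admissible_radii r"
    and "sqrt_branches r s"
    and "free_domain 2 S"
    and "nc_symmetric S"
  shows "G_oo r s S \<subseteq> G_set r s \<and>
    openin (G_topology r s) (G_oo r s S) \<and>
    zariski_free_manifold 2 (G_oo r s S) (G_oo_topology r s S) (G_oo_atlas r s S)"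
proof -
  note r = assms(1) and s = assms(2) and S = assms(3)
  let ?Z = "zariski_free_topology 2" and ?G = "G_topology r s" and ?X = "G_oo r s S"
  let ?D = "U_dom r s S" and ?Phi = "Phi r s"
  \<comment> \<open>This is the chart map in \<open>G_oo_atlas\<close>. Being inverse to
    \<open>?Phi\<close> on \<open>?D\<close> is the property through which it is used below.\<close>
  define \<alpha> where "\<alpha> \<gamma> \<tau> = restrict (inv_into (U_set r \<gamma>) (?Phi \<gamma> \<tau>)) (?Phi \<gamma> \<tau> ` ?D \<gamma> \<tau>)" for \<gamma> \<tau>
  have DU: "?D \<gamma> \<tau> \<subseteq> U_set r \<gamma>" for \<gamma> \<tau> by (auto simp: U_dom_def)
  have D: "openin ?Z (?D \<gamma> \<tau>)" if "\<gamma> \<in> Gam" for \<gamma> \<tau> by (rule openin_U_dom[OF r s that S])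
  have chart_open: "openin ?G (?Phi \<gamma> \<tau> ` ?D \<gamma> \<tau>)" if "\<gamma> \<in> Gam" "\<tau> \<in> signs \<gamma>" for \<gamma> \<tau>
    by (rule openin_G_Phi_image[OF r s that DU D[OF that(1)]])
  have sub: "?Phi \<gamma> \<tau> ` ?D \<gamma> \<tau> \<subseteq> ?X" if "\<gamma> \<in> Gam" "\<tau> \<in> signs \<gamma>" for \<gamma> \<tau>
    using that unfolding G_oo_def by blast
  have XG: "?X \<subseteq> G_set r s" using DU unfolding G_oo_def G_set_def by blast
  have X: "openin ?G ?X" unfolding G_oo_def using chart_open by (intro openin_Union) auto
  have inj: "inj_on (?Phi \<gamma> \<tau>) (U_set r \<gamma>)" for \<gamma> \<tau>
    using Phi_inject[OF U_setD(1) U_setD(1)] by (auto intro!: inj_onI)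
  have \<alpha>: "\<alpha> \<gamma> \<tau> (?Phi \<gamma> \<tau> p) = p" if "p \<in> ?D \<gamma> \<tau>" for \<gamma> \<tau> p
    using that DU[of \<gamma> \<tau>] inv_into_f_f[OF inj, of p \<gamma> \<tau>] by (auto simp: \<alpha>_def)
  have \<alpha>im: "\<alpha> \<gamma> \<tau> ` (?Phi \<gamma> \<tau> ` W) = W" if "W \<subseteq> ?D \<gamma> \<tau>" for \<gamma> \<tau> W
    using \<alpha>[of _ \<gamma> \<tau>] that by (force simp: image_image)
  have atlas: "c \<in> G_oo_atlas r s S \<longleftrightarrow> (\<exists>\<gamma>\<in>Gam. \<exists>\<tau>\<in>signs \<gamma>. c = (?Phi \<gamma> \<tau> ` ?D \<gamma> \<tau>, ?D \<gamma> \<tau>, \<alpha> \<gamma> \<tau>))" for c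
    unfolding G_oo_atlas_def \<alpha>_def by blast
  have homeo: "homeomorphic_map (subtopology (G_oo_topology r s S) (?Phi \<gamma> \<tau> ` ?D \<gamma> \<tau>)) (subtopology ?Z (?D \<gamma> \<tau>)) (\<alpha> \<gamma> \<tau>)"
    if \<gamma>: "\<gamma> \<in> Gam" and \<tau>: "\<tau> \<in> signs \<gamma>" for \<gamma> \<tau>
  proof -
    let ?U = "?Phi \<gamma> \<tau> ` ?D \<gamma> \<tau>"
    \<comment> \<open>The chart lies in \<open>?X\<close>, so restricting first to \<open>?X\<close>
      makes no difference.\<close>
    have st: "subtopology (G_oo_topology r s S) ?U = subtopology ?G ?U"
      using sub[OF \<gamma> \<tau>] by (simp add: G_oo_topology_def subtopology_subtopology Int_absorb1)
    have tU: "topspace (subtopology ?G ?U) = ?U" using openin_subset[OF chart_open[OF \<gamma> \<tau>]] by (auto simp: topspace_subtopology)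
    have tD: "topspace (subtopology ?Z (?D \<gamma> \<tau>)) = ?D \<gamma> \<tau>" using openin_subset[OF D[OF \<gamma>, of \<tau>]] by (auto simp: topspace_subtopology)
    show ?thesis
      unfolding st
    proof (rule bijective_open_imp_homeomorphic_map)
      show "continuous_map (subtopology ?G ?U) (subtopology ?Z (?D \<gamma> \<tau>)) (\<alpha> \<gamma> \<tau>)"
        unfolding continuous_map_def tU tD
      proof (intro conjI allI impI)
        show "\<alpha> \<gamma> \<tau> \<in> ?U \<rightarrow> ?D \<gamma> \<tau>" using \<alpha> by auto
        fix W assume "openin (subtopology ?Z (?D \<gamma> \<tau>)) W"
        then have W: "openin ?Z W" "W \<subseteq> ?D \<gamma> \<tau>" using openin_open_subtopology[OF D[OF \<gamma>]] by auto
        \<comment> \<open>The preimage of W under the chart is the image of W under the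
          parametrisation, which is open in \<open>?G\<close>.\<close>
        have "{x \<in> ?U. \<alpha> \<gamma> \<tau> x \<in> W} = ?Phi \<gamma> \<tau> ` W" using \<alpha>[of _ \<gamma> \<tau>] W(2) by auto
        moreover have "openin ?G (?Phi \<gamma> \<tau> ` W)" by (rule openin_G_Phi_image[OF r s \<gamma> \<tau> _ W(1)]) (use W(2) DU in blast)
        ultimately show "openin (subtopology ?G ?U) {x \<in> ?U. \<alpha> \<gamma> \<tau> x \<in> W}"
          using openin_open_subtopology[OF chart_open[OF \<gamma> \<tau>]] by auto
      qed
      show "open_map (subtopology ?G ?U) (subtopology ?Z (?D \<gamma> \<tau>)) (\<alpha> \<gamma> \<tau>)"
        unfolding open_map_def
      proof (intro allI impI)
        fix W assume "openin (subtopology ?G ?U) W"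
        then have W: "openin ?G W" "W \<subseteq> ?U" using openin_open_subtopology[OF chart_open[OF \<gamma> \<tau>]] by auto
        let ?P = "{p \<in> ?D \<gamma> \<tau>. ?Phi \<gamma> \<tau> p \<in> W}"
        have "W = ?Phi \<gamma> \<tau> ` ?P" using W(2) by auto
        then have "\<alpha> \<gamma> \<tau> ` W = ?P" using \<alpha>im[of ?P \<gamma> \<tau>] by auto
        moreover have "openin ?Z ?P" by (rule openin_Phi_preimage[OF r s \<gamma> \<tau> DU D[OF \<gamma>] W(1)])
        ultimately show "openin (subtopology ?Z (?D \<gamma> \<tau>)) (\<alpha> \<gamma> \<tau> ` W)"
          using openin_open_subtopology[OF D[OF \<gamma>]] by auto
      qed
      show "\<alpha> \<gamma> \<tau> ` topspace (subtopology ?G ?U) = topspace (subtopology ?Z (?D \<gamma> \<tau>))"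
        unfolding tU tD by (rule \<alpha>im) simp
      show "inj_on (\<alpha> \<gamma> \<tau>) (topspace (subtopology ?G ?U))"
        unfolding tU using \<alpha>[of _ \<gamma> \<tau>] by (auto intro!: inj_onI)
    qed
  qed
  have transition: "(\<exists>\<N>. (\<forall>N\<in>\<N>. nc_set 2 N) \<and> \<alpha> \<gamma> \<tau> ` (?Phi \<gamma> \<tau> ` ?D \<gamma> \<tau> \<inter> ?Phi \<gamma>' \<tau>' ` ?D \<gamma>' \<tau>') = \<Union>\<N>) \<and>
      (\<forall>N. nc_set 2 N \<and> N \<subseteq> \<alpha> \<gamma> \<tau> ` (?Phi \<gamma> \<tau> ` ?D \<gamma> \<tau> \<inter> ?Phi \<gamma>' \<tau>' ` ?D \<gamma>' \<tau>') \<longrightarrow>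
        nc_mapping 2 2 N (\<alpha> \<gamma>' \<tau>' \<circ> inv_into (?Phi \<gamma> \<tau> ` ?D \<gamma> \<tau>) (\<alpha> \<gamma> \<tau>)))"
    if g: "\<gamma> \<in> Gam" "\<tau> \<in> signs \<gamma>" and g': "\<gamma>' \<in> Gam" "\<tau>' \<in> signs \<gamma>'" for \<gamma> \<tau> \<gamma>' \<tau>'
  proof (intro conjI allI impI)
    \<comment> \<open>The parameters of the overlap, the same for both charts.\<close>
    let ?T = "?D \<gamma> \<tau> \<inter> ?D \<gamma>' \<tau>' \<inter> coincidence r s \<gamma> \<tau> \<gamma>' \<tau>'"
    have im: "?Phi \<gamma> \<tau> ` ?D \<gamma> \<tau> \<inter> ?Phi \<gamma>' \<tau>' ` ?D \<gamma>' \<tau>' = ?Phi \<gamma> \<tau> ` ?T"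
      by (rule Phi_image_Int[OF r s g(1) g'(1) g(2) g'(2) DU DU])
    have \<alpha>T: "\<alpha> \<gamma> \<tau> ` (?Phi \<gamma> \<tau> ` ?D \<gamma> \<tau> \<inter> ?Phi \<gamma>' \<tau>' ` ?D \<gamma>' \<tau>') = ?T"
      unfolding im by (rule \<alpha>im) blast
    have "openin ?Z ?T" by (intro openin_Int D openin_coincidence[OF r s] g g')
    then obtain C where "\<forall>N\<in>C. zbasic 2 N" "?T = \<Union>C" using openin_zariski_Union[of 2 ?T] by auto
    then show "\<exists>\<N>. (\<forall>N\<in>\<N>. nc_set 2 N) \<and> \<alpha> \<gamma> \<tau> ` (?Phi \<gamma> \<tau> ` ?D \<gamma> \<tau> \<inter> ?Phi \<gamma>' \<tau>' ` ?D \<gamma>' \<tau>') = \<Union>\<N>"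
      unfolding \<alpha>T using zbasic_nc_set[of 2] by (intro exI[of _ C]) auto
    fix N assume N: "nc_set 2 N \<and> N \<subseteq> \<alpha> \<gamma> \<tau> ` (?Phi \<gamma> \<tau> ` ?D \<gamma> \<tau> \<inter> ?Phi \<gamma>' \<tau>' ` ?D \<gamma>' \<tau>')"
    show "nc_mapping 2 2 N (\<alpha> \<gamma>' \<tau>' \<circ> inv_into (?Phi \<gamma> \<tau> ` ?D \<gamma> \<tau>) (\<alpha> \<gamma> \<tau>))"
    proof (rule nc_mapping_id)
      fix p assume "p \<in> N"
      then have p: "p \<in> ?T" using N unfolding \<alpha>T by blast
      have inj\<alpha>: "inj_on (\<alpha> \<gamma> \<tau>) (?Phi \<gamma> \<tau> ` ?D \<gamma> \<tau>)" using \<alpha>[of _ \<gamma> \<tau>] by (auto intro!: inj_onI)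
      have "inv_into (?Phi \<gamma> \<tau> ` ?D \<gamma> \<tau>) (\<alpha> \<gamma> \<tau>) p = ?Phi \<gamma> \<tau> p"
        using inv_into_f_f[OF inj\<alpha>, of "?Phi \<gamma> \<tau> p"] p \<alpha>[of p \<gamma> \<tau>] by auto
      \<comment> \<open>On \<open>?T\<close> the two parametrisations have equal values, so the
        second chart leads back to p.\<close>
      also have "\<dots> = ?Phi \<gamma>' \<tau>' p"
        using Phi_eq_iff[OF r s g(1) g'(1) g(2) g'(2), of p] p DU[of \<gamma> \<tau>] DU[of \<gamma>' \<tau>'] by blast
      finally show "(\<alpha> \<gamma>' \<tau>' \<circ> inv_into (?Phi \<gamma> \<tau> ` ?D \<gamma> \<tau>) (\<alpha> \<gamma> \<tau>)) p = p"
        using \<alpha>[of p \<gamma>' \<tau>'] p by simp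
    qed (use N in auto)
  qed
  have "topological_nc_manifold 2 ?Z ?X (G_oo_topology r s S) (G_oo_atlas r s S)"
    unfolding topological_nc_manifold_def
  proof (intro conjI)
    show "nc_admissible 2 ?Z" by (rule nc_admissible_zariski) simp
    show "topspace (G_oo_topology r s S) = ?X"
      using openin_subset[OF X] by (auto simp: G_oo_topology_def topspace_subtopology)
    show "\<forall>(U, D, a)\<in>G_oo_atlas r s S. openin (G_oo_topology r s S) U \<and> openin ?Z D \<and>
        homeomorphic_map (subtopology (G_oo_topology r s S) U) (subtopology ?Z D) a"
    proof (rule ballI)
      fix c assume "c \<in> G_oo_atlas r s S"
      then obtain \<gamma> \<tau> where g: "\<gamma> \<in> Gam" "\<tau> \<in> signs \<gamma>" and c: "c = (?Phi \<gamma> \<tau> ` ?D \<gamma> \<tau>, ?D \<gamma> \<tau>, \<alpha> \<gamma> \<tau>)"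
        unfolding atlas by blast
      have "openin (G_oo_topology r s S) (?Phi \<gamma> \<tau> ` ?D \<gamma> \<tau>)"
        unfolding G_oo_topology_def openin_open_subtopology[OF X] using chart_open[OF g] sub[OF g] by blast
      then show "case c of (U, D, a) \<Rightarrow> openin (G_oo_topology r s S) U \<and> openin ?Z D \<and>
        homeomorphic_map (subtopology (G_oo_topology r s S) U) (subtopology ?Z D) a"
        unfolding c prod.case using D[OF g(1)] homeo[OF g] by blast
    qed
    show "(\<Union>(U, D, a)\<in>G_oo_atlas r s S. U) = ?X"
    proof -
      have "y \<in> (\<Union>c\<in>G_oo_atlas r s S. fst c) \<longleftrightarrow> y \<in> ?X" for y
      proof
        assume "y \<in> (\<Union>c\<in>G_oo_atlas r s S. fst c)"
        then obtain c where c: "c \<in> G_oo_atlas r s S" "y \<in> fst c" by (rule UN_E)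
        then obtain \<gamma> \<tau> where g: "\<gamma> \<in> Gam" "\<tau> \<in> signs \<gamma>" and "c = (?Phi \<gamma> \<tau> ` ?D \<gamma> \<tau>, ?D \<gamma> \<tau>, \<alpha> \<gamma> \<tau>)"
          unfolding atlas by (elim bexE) (rule that)
        then have "y \<in> ?Phi \<gamma> \<tau> ` ?D \<gamma> \<tau>" using c(2) by simp
        then show "y \<in> ?X" using sub[OF g] by (rule rev_subsetD)
      next
        assume "y \<in> ?X"
        then obtain \<gamma> \<tau> where g: "\<gamma> \<in> Gam" "\<tau> \<in> signs \<gamma>" "y \<in> ?Phi \<gamma> \<tau> ` ?D \<gamma> \<tau>"
          unfolding G_oo_def by (elim UN_E) (rule that)
        then have "(?Phi \<gamma> \<tau> ` ?D \<gamma> \<tau>, ?D \<gamma> \<tau>, \<alpha> \<gamma> \<tau>) \<in> G_oo_atlas r s S"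
          unfolding atlas by (intro bexI[of _ \<gamma>] bexI[of _ \<tau>] refl)
        then show "y \<in> (\<Union>c\<in>G_oo_atlas r s S. fst c)" by (rule UN_I) (simp add: g(3))
      qed
      then show ?thesis by (simp add: case_prod_unfold set_eq_iff)
    qed
    show "\<forall>(U, D, a)\<in>G_oo_atlas r s S. \<forall>(V, E, b)\<in>G_oo_atlas r s S.
        (\<exists>\<N>. (\<forall>N\<in>\<N>. nc_set 2 N) \<and> a ` (U \<inter> V) = \<Union>\<N>) \<and>
        (\<forall>N. nc_set 2 N \<and> N \<subseteq> a ` (U \<inter> V) \<longrightarrow> nc_mapping 2 2 N (b \<circ> inv_into U a))"
    proof (rule ballI)
      fix c assume "c \<in> G_oo_atlas r s S"
      then obtain \<gamma> \<tau> where g: "\<gamma> \<in> Gam" "\<tau> \<in> signs \<gamma>" and c: "c = (?Phi \<gamma> \<tau> ` ?D \<gamma> \<tau>, ?D \<gamma> \<tau>, \<alpha> \<gamma> \<tau>)"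
        unfolding atlas by blast
      show "case c of (U, D, a) \<Rightarrow> \<forall>(V, E, b)\<in>G_oo_atlas r s S.
        (\<exists>\<N>. (\<forall>N\<in>\<N>. nc_set 2 N) \<and> a ` (U \<inter> V) = \<Union>\<N>) \<and>
        (\<forall>N. nc_set 2 N \<and> N \<subseteq> a ` (U \<inter> V) \<longrightarrow> nc_mapping 2 2 N (b \<circ> inv_into U a))"
        unfolding c prod.case
      proof (rule ballI)
        fix c' assume "c' \<in> G_oo_atlas r s S"
        then obtain \<gamma>' \<tau>' where g': "\<gamma>' \<in> Gam" "\<tau>' \<in> signs \<gamma>'" and c': "c' = (?Phi \<gamma>' \<tau>' ` ?D \<gamma>' \<tau>', ?D \<gamma>' \<tau>', \<alpha> \<gamma>' \<tau>')"
          unfolding atlas by blast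
        show "case c' of (V, E, b) \<Rightarrow>
          (\<exists>\<N>. (\<forall>N\<in>\<N>. nc_set 2 N) \<and> \<alpha> \<gamma> \<tau> ` (?Phi \<gamma> \<tau> ` ?D \<gamma> \<tau> \<inter> V) = \<Union>\<N>) \<and>
          (\<forall>N. nc_set 2 N \<and> N \<subseteq> \<alpha> \<gamma> \<tau> ` (?Phi \<gamma> \<tau> ` ?D \<gamma> \<tau> \<inter> V) \<longrightarrow>
            nc_mapping 2 2 N (b \<circ> inv_into (?Phi \<gamma> \<tau> ` ?D \<gamma> \<tau>) (\<alpha> \<gamma> \<tau>)))"
          unfolding c' prod.case by (rule transition[OF g g'])
      qed
    qed
  qed
  then show ?thesis using XG X by (simp add: zariski_free_manifold_def)
qed

end
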